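(* Assume the Riemann Hypothesis and let $c>0$ be fixed. For the critical window $h=c\sqrt x$, the layer-count variance satisfies $$\frac1X\int_X^{2X}\bigl(N(x)-\langle N\rangle(x)\bigr)^2\,dx\ll\sqrt X\,(\log X)^2\qquad(X\to\infty),$$ whence $\mathrm{RMS}_X(N-\langle N\rangle)\ll X^{1/4}\log X$, i.e. the per-prime $\zeta$-footprint on the layer occupancy is $\ll p^{-1/4}(\log p)^2$, in the sense that $$\frac{\mathrm{RMS}_X(N-\langle N\rangle)}{\sqrt X/\log X}\ll X^{-1/4}(\log X)^2$$ for primes $p\asymp X$.
   Context: For $x\ge2$ and $h=c\sqrt x$, $N(x)$ is the number of primes in the window $(x,x+h]$ (the layer count) and $\langle N\rangle(x)=\int_x^{x+h}\frac{dt}{\log t}$ is its expected value. $\mathrm{RMS}_X(N-\langle N\rangle):=\bigl(\frac1X\int_X^{2X}(N(x)-\langle N\rangle(x))^2\,dx\bigr)^{1/2}$. The per-prime $\zeta$-footprint is the root-mean-square fluctuation divided by the layer occupancy, which is of order $\sqrt X/\log X$. *)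

theory Defs
  imports "HOL-Complex_Analysis.Complex_Analysis" "HOL-Library.Landau_Symbols"
    "HOL-Computational_Algebra.Primes"
begin

definition is_zeta :: "(complex \<Rightarrow> complex) \<Rightarrow> bool" where
  "is_zeta f \<longleftrightarrow> f holomorphic_on (- {1}) \<and>
     (\<forall>s. Re s > 1 \<longrightarrow> (\<lambda>n. of_nat (Suc n) powr (- s)) sums f s)"

definition riemann_zeta :: "complex \<Rightarrow> complex" where
  \<comment> \<open>The analytic continuation leaves the value at the pole open; it is set to 0 there.\<close>
  "riemann_zeta = (THE f. is_zeta f \<and> f 1 = 0)"

definition riemann_hypothesis :: bool where
  "riemann_hypothesis \<longleftrightarrow>
     (\<forall>s. riemann_zeta s = 0 \<and> 0 < Re s \<and> Re s < 1 \<longrightarrow> Re s = 1 / 2)"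

definition layer_count :: "real \<Rightarrow> real \<Rightarrow> nat" where
  "layer_count c x = card {p::nat. prime p \<and> x < real p \<and> real p \<le> x + c * sqrt x}"

definition layer_mean :: "real \<Rightarrow> real \<Rightarrow> real" where
  "layer_mean c x = integral {x..x + c * sqrt x} (\<lambda>t. 1 / ln t)"

definition mean_square :: "(real \<Rightarrow> real) \<Rightarrow> real \<Rightarrow> real" where
  "mean_square f X = 1 / X * integral {X..2 * X} (\<lambda>x. (f x)\<^sup>2)"

definition RMS :: "(real \<Rightarrow> real) \<Rightarrow> real \<Rightarrow> real" where
  "RMS f X = sqrt (mean_square f X)"

definition layer_fluctuation :: "real \<Rightarrow> real \<Rightarrow> real" where
  "layer_fluctuation c x = real (layer_count c x) - layer_mean c x"

definition zeta_footprint :: "real \<Rightarrow> real \<Rightarrow> real" where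
  \<comment> \<open>RMS fluctuation relative to the layer occupancy, the latter normalised as \<open>sqrt X / ln X\<close>.\<close>
  "zeta_footprint c X = RMS (layer_fluctuation c) X / (sqrt X / ln X)"

text \<open>
  The description in \<open>riemann_zeta\<close> is proper: the continuation exists and is unique. For existence,
  expand \<open>(n + 1) powr (1 - s)\<close> around \<open>n\<close> to order \<open>K\<close> and sum over \<open>n\<close>; this expresses
  \<open>(s - 1) * zeta s\<close> through \<open>zeta (s + 1), zeta (s + 2), ...\<close> and a remainder that is
  holomorphic for \<open>Re s > 1 - K\<close>.
\<close>

lemma norm_nat_powr: "norm (of_nat (Suc n) powr (s::complex)) = real (Suc n) powr Re s"
  by (subst norm_powr_real_powr) auto

lemma halfplane_series:
  fixes t :: "nat \<Rightarrow> complex \<Rightarrow> complex" and a :: real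
  assumes hol: "\<And>n. t n holomorphic_on {s. Re s > a}"
    and C: "continuous_on UNIV C"
    and bd: "\<And>n s. Re s > a \<Longrightarrow> norm (t n s) \<le> C s * real (Suc n) powr (a - 1 - Re s)"
  shows "(\<lambda>s. \<Sum>n. t n s) holomorphic_on {s. Re s > a}"
    and "Re s > a \<Longrightarrow> summable (\<lambda>n. t n s)"
proof -
  have sm: "summable (\<lambda>n. B * real (Suc n) powr (- 1 - d))" if "d > 0" for d B :: real
  proof -
    have "summable (\<lambda>n. real n powr (- 1 - d))"
      using that by (subst summable_real_powr_iff) auto
    then have "summable (\<lambda>n. real (Suc n) powr (- 1 - d))"
      by (subst summable_Suc_iff)
    then show ?thesis by (rule summable_mult)
  qed
  show "summable (\<lambda>n. t n s)" if "Re s > a"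
  proof (rule summable_comparison_test')
    show "summable (\<lambda>n. C s * real (Suc n) powr (- 1 - (Re s - a)))"
      using that by (intro sm) auto
    show "norm (t n s) \<le> C s * real (Suc n) powr (- 1 - (Re s - a))" if "n \<ge> 0" for n
      using bd[of s n] \<open>Re s > a\<close> by (simp add: algebra_simps)
  qed
  show "(\<lambda>s. \<Sum>n. t n s) holomorphic_on {s. Re s > a}"
  proof (rule holomorphic_uniform_sequence)
    show "open {s. Re s > a}" by (rule open_halfspace_Re_gt)
    show "(\<lambda>s. \<Sum>i<n. t i s) holomorphic_on {s. Re s > a}" for n
      by (intro holomorphic_intros hol)
    fix s0 assume "s0 \<in> {s. Re s > a}"
    then have s0: "Re s0 > a" by simp
    define d where "d = (Re s0 - a) / 2"
    have d: "d > 0" using s0 by (simp add: d_def)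
    have re: "Re s \<ge> a + d" if "s \<in> cball s0 d" for s
    proof -
      have "Re s0 - Re s \<le> norm (s0 - s)" using complex_Re_le_cmod[of "s0 - s"] by simp
      then show ?thesis using that by (simp add: dist_norm d_def field_simps)
    qed
    have "bounded (C ` cball s0 d)"
      using C by (intro compact_imp_bounded compact_continuous_image)
        (auto intro: continuous_on_subset)
    then obtain B where B: "\<And>s. s \<in> cball s0 d \<Longrightarrow> norm (C s) \<le> B"
      unfolding bounded_iff by blast
    have "uniform_limit (cball s0 d) (\<lambda>n s. \<Sum>i<n. t i s) (\<lambda>s. \<Sum>n. t n s) sequentially"
    proof (rule Weierstrass_m_test)
      show "summable (\<lambda>n. B * real (Suc n) powr (- 1 - d))" by (rule sm[OF d])
      fix n s assume s: "s \<in> cball s0 d"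
      have "norm (t n s) \<le> C s * real (Suc n) powr (a - 1 - Re s)"
        using re[OF s] d by (intro bd) auto
      also have "\<dots> \<le> B * real (Suc n) powr (a - 1 - Re s)"
        using B[OF s] by (intro mult_right_mono) auto
      also have "\<dots> \<le> B * real (Suc n) powr (- 1 - d)"
      proof (rule mult_left_mono)
        show "real (Suc n) powr (a - 1 - Re s) \<le> real (Suc n) powr (- 1 - d)"
          using re[OF s] by (intro powr_mono) auto
        show "0 \<le> B" using B[OF s] norm_ge_zero by (rule order_trans[rotated])
      qed
      finally show "norm (t n s) \<le> B * real (Suc n) powr (- 1 - d)" .
    qed
    then show "\<exists>d>0. cball s0 d \<subseteq> {s. Re s > a} \<and>
        uniform_limit (cball s0 d) (\<lambda>n s. \<Sum>i<n. t i s) (\<lambda>s. \<Sum>n. t n s) sequentially"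
      using d re by (intro exI[of _ d]) force
  qed
qed

definition zeta_series :: "complex \<Rightarrow> complex" where
  "zeta_series s = (\<Sum>n. of_nat (Suc n) powr (- s))"

lemma zeta_series_hol: "zeta_series holomorphic_on {s. Re s > 1}"
  and zeta_series_sums: "Re s > 1 \<Longrightarrow> (\<lambda>n. of_nat (Suc n) powr (- s)) sums zeta_series s"
proof -
  have h: "\<And>n. (\<lambda>s. of_nat (Suc n) powr (- s)) holomorphic_on {s. Re s > 1}"
    by (intro holomorphic_intros)
  have b: "\<And>n s. Re s > 1 \<Longrightarrow> norm (of_nat (Suc n) powr (- s)) \<le> 1 * real (Suc n) powr (1 - 1 - Re s)"
    unfolding norm_nat_powr by simp
  show "zeta_series holomorphic_on {s. Re s > 1}"
    unfolding zeta_series_def using halfplane_series(1)[OF h _ b] by simp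
  show "(\<lambda>n. of_nat (Suc n) powr (- s)) sums zeta_series s" if "Re s > 1"
    unfolding zeta_series_def using halfplane_series(2)[OF h _ b that] by (simp add: summable_sums)
qed

definition zeta_fall :: "nat \<Rightarrow> complex \<Rightarrow> complex" where
  "zeta_fall i s = (\<Prod>m<i. 1 - s - of_nat m)"

lemma zeta_fall_0 [simp]: "zeta_fall 0 s = 1" and zeta_fall_Suc: "zeta_fall (Suc i) s = zeta_fall i s * (1 - s - of_nat i)"
  by (simp_all add: zeta_fall_def)

definition zeta_rem :: "nat \<Rightarrow> nat \<Rightarrow> complex \<Rightarrow> complex" where
  "zeta_rem K n s = of_nat (Suc (Suc n)) powr (1 - s)
     - (\<Sum>j\<le>K. zeta_fall j s / fact j * of_nat (Suc n) powr (1 - s - of_nat j))"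

lemma zeta_rem_bound:
  assumes s: "Re s > 1 - real K"
  shows "norm (zeta_rem K n s) \<le> norm (zeta_fall (Suc K) s) * real (Suc n) powr (1 - real K - 1 - Re s)"
proof -
  define F where "F i t = zeta_fall i s * t powr (1 - s - of_nat i)" for i and t :: complex
  define S where "S = closed_segment (of_nat (Suc n)) (of_nat (Suc (Suc n)) :: complex)"
  have S: "\<exists>u\<ge>real (Suc n). x = of_real u" if "x \<in> S" for x
  proof -
    have "x \<in> of_real ` closed_segment (real (Suc n)) (real (Suc (Suc n)))"
      using that unfolding S_def closed_segment_of_real[symmetric] by simp
    then show ?thesis by (auto simp: closed_segment_eq_real_ivl)
  qed
  have "norm (F 0 (of_nat (Suc (Suc n))) - (\<Sum>i\<le>K. F i (of_nat (Suc n)) *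
       (of_nat (Suc (Suc n)) - of_nat (Suc n)) ^ i / fact i))
     \<le> norm (zeta_fall (Suc K) s) * real (Suc n) powr (- real K - Re s)
         * norm (of_nat (Suc (Suc n)) - of_nat (Suc n) :: complex) ^ Suc K / fact K"
  proof (rule complex_Taylor[where S = S])
    show "convex S" by (simp add: S_def)
    show "of_nat (Suc n) \<in> S" "of_nat (Suc (Suc n)) \<in> S" by (simp_all add: S_def)
    fix x assume x: "x \<in> S"
    then obtain u where u: "u \<ge> real (Suc n)" "x = of_real u" using S by blast
    then have xn: "x \<notin> \<real>\<^sub>\<le>\<^sub>0" by simp
    show "(F i has_field_derivative F (Suc i) x) (at x within S)" for i
      unfolding F_def zeta_fall_Suc
      by (rule derivative_eq_intros has_field_derivative_at_within[OF has_field_derivative_powr] xn refl)+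
         (simp add: algebra_simps)
    have "norm (F (Suc K) x) = norm (zeta_fall (Suc K) s) * u powr (- real K - Re s)"
    proof -
      have "1 - Re s - real (Suc K) = - real K - Re s" by simp
      moreover have "norm (F (Suc K) x) = norm (zeta_fall (Suc K) s) * u powr (1 - Re s - real (Suc K))"
        using u by (simp add: F_def norm_mult norm_powr_real_powr del: of_nat_Suc)
      ultimately show ?thesis by (simp only:)
    qed
    also have "\<dots> \<le> norm (zeta_fall (Suc K) s) * real (Suc n) powr (- real K - Re s)"
      using u s by (intro mult_left_mono powr_mono2') auto
    finally show "norm (F (Suc K) x) \<le> norm (zeta_fall (Suc K) s) * real (Suc n) powr (- real K - Re s)" .
  qed
  also have "\<dots> = norm (zeta_fall (Suc K) s) * real (Suc n) powr (- real K - Re s) / fact K"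
    by simp
  also have "\<dots> \<le> norm (zeta_fall (Suc K) s) * real (Suc n) powr (- real K - Re s) / 1"
    by (intro divide_left_mono) auto
  finally show ?thesis
    by (simp add: F_def zeta_rem_def algebra_simps)
qed

lemma zeta_fall_hol [holomorphic_intros]: "zeta_fall i holomorphic_on A"
  unfolding zeta_fall_def by (intro holomorphic_intros)

lemma zeta_rem_series:
  shows "(\<lambda>s. \<Sum>n. zeta_rem K n s) holomorphic_on {s. Re s > 1 - real K}"
    and "Re s > 1 - real K \<Longrightarrow> summable (\<lambda>n. zeta_rem K n s)"
proof -
  have h: "zeta_rem K n holomorphic_on {s. Re s > 1 - real K}" for n
    unfolding zeta_rem_def by (intro holomorphic_intros) auto
  have c: "continuous_on UNIV (\<lambda>s. norm (zeta_fall (Suc K) s))"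
    by (intro continuous_intros holomorphic_on_imp_continuous_on zeta_fall_hol)
  show "(\<lambda>s. \<Sum>n. zeta_rem K n s) holomorphic_on {s. Re s > 1 - real K}"
    and "Re s > 1 - real K \<Longrightarrow> summable (\<lambda>n. zeta_rem K n s)"
    using halfplane_series[OF h c zeta_rem_bound] by auto
qed

lemma zeta_rem_sum:
  assumes s: "Re s > 1"
  shows "(\<Sum>n. zeta_rem K n s) = - 1 - (\<Sum>j=1..K. zeta_fall j s / fact j * zeta_series (s + of_nat j - 1))"
proof -
  have "(\<lambda>n. of_nat (Suc n) powr (1 - s) :: complex) \<longlonglongrightarrow> 0"
  proof (rule tendsto_norm_zero_cancel)
    have "(\<lambda>n. real (Suc n) powr (1 - Re s)) \<longlonglongrightarrow> 0"
      using s by (intro tendsto_neg_powr filterlim_compose[OF filterlim_real_sequentially filterlim_Suc]) auto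
    then show "(\<lambda>n. norm (of_nat (Suc n) powr (1 - s) :: complex)) \<longlonglongrightarrow> 0"
      unfolding norm_nat_powr by simp
  qed
  then have "(\<lambda>n. of_nat (Suc (Suc n)) powr (1 - s) - of_nat (Suc n) powr (1 - s))
      sums (0 - of_nat (Suc 0) powr (1 - s) :: complex)"
    by (rule telescope_sums)
  moreover have "(\<lambda>n. \<Sum>j=1..K. zeta_fall j s / fact j * of_nat (Suc n) powr (- (s + of_nat j - 1)))
      sums (\<Sum>j=1..K. zeta_fall j s / fact j * zeta_series (s + of_nat j - 1))"
    using s by (intro sums_sum sums_mult zeta_series_sums) auto
  ultimately have "(\<lambda>n. (of_nat (Suc (Suc n)) powr (1 - s) - of_nat (Suc n) powr (1 - s))
      - (\<Sum>j=1..K. zeta_fall j s / fact j * of_nat (Suc n) powr (- (s + of_nat j - 1))))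
      sums ((0 - of_nat (Suc 0) powr (1 - s))
      - (\<Sum>j=1..K. zeta_fall j s / fact j * zeta_series (s + of_nat j - 1)))"
    by (rule sums_diff)
  moreover have "(of_nat (Suc (Suc n)) powr (1 - s) - of_nat (Suc n) powr (1 - s))
      - (\<Sum>j=1..K. zeta_fall j s / fact j * of_nat (Suc n) powr (- (s + of_nat j - 1))) = zeta_rem K n s" for n
  proof -
    have "{..K} = insert 0 {1..K}" by auto
    then show ?thesis by (simp add: zeta_rem_def algebra_simps)
  qed
  ultimately show ?thesis by (simp add: sums_iff)
qed

lemma zeta_step:
  "\<exists>G. G holomorphic_on {s. Re s > 1 - real k} \<and> (\<forall>s. Re s > 1 \<longrightarrow> G s = (s - 1) * zeta_series s)"
proof (induction k)
  case 0
  show ?case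
    by (intro exI[of _ "\<lambda>s. (s - 1) * zeta_series s"]) (auto intro!: holomorphic_intros zeta_series_hol)
next
  case (Suc k)
  then obtain G where G: "G holomorphic_on {s. Re s > 1 - real k}"
    "\<And>s. Re s > 1 \<Longrightarrow> G s = (s - 1) * zeta_series s" by blast
  define H where "H s = 1 - (\<Sum>j=2..Suc k. zeta_fall (j - 1) s / fact j * G (s + (of_nat j - 1)))
     + (\<Sum>n. zeta_rem (Suc k) n s)" for s
  have "H holomorphic_on {s. Re s > 1 - real (Suc k)}"
  proof -
    have "(\<lambda>s. G (s + (of_nat j - 1))) holomorphic_on {s. Re s > 1 - real (Suc k)}"
      if "j \<in> {2..Suc k}" for j
    proof -
      have "(G \<circ> (\<lambda>s. s + (of_nat j - 1))) holomorphic_on {s. Re s > 1 - real (Suc k)}"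
        using that by (intro holomorphic_on_compose_gen[OF _ G(1)] holomorphic_intros) auto
      then show ?thesis by (simp add: o_def)
    qed
    then show ?thesis
      unfolding H_def by (intro holomorphic_intros zeta_rem_series) auto
  qed
  moreover have "H s = (s - 1) * zeta_series s" if s: "Re s > 1" for s
  proof -
    have eq: "zeta_fall (j - 1) s / fact j * G (s + (of_nat j - 1))
        = - (zeta_fall j s / fact j * zeta_series (s + of_nat j - 1))" if j: "j \<in> {2..Suc k}" for j
    proof -
      obtain i where i: "j = Suc i" using j by (cases j) auto
      have "G (s + (of_nat j - 1)) = (s + of_nat i - 1) * zeta_series (s + of_nat i)"
        using s i j by (subst G(2)) auto
      moreover have "zeta_fall j s = - (zeta_fall i s * (s + of_nat i - 1))"
        by (simp add: i zeta_fall_Suc algebra_simps)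
      ultimately show ?thesis by (simp add: i)
    qed
    have "(\<Sum>j=2..Suc k. zeta_fall (j - 1) s / fact j * G (s + (of_nat j - 1)))
        = - (\<Sum>j=2..Suc k. zeta_fall j s / fact j * zeta_series (s + of_nat j - 1))"
      unfolding sum_negf[symmetric] by (intro sum.cong refl eq)
    moreover have "(\<Sum>j=1..Suc k. zeta_fall j s / fact j * zeta_series (s + of_nat j - 1))
      = (1 - s) * zeta_series s + (\<Sum>j=2..Suc k. zeta_fall j s / fact j * zeta_series (s + of_nat j - 1))"
      by (subst sum.atLeast_Suc_atMost)
         (simp_all add: zeta_fall_def numeral_2_eq_2 del: sum.cl_ivl_Suc)
    ultimately show ?thesis
      unfolding H_def zeta_rem_sum[OF s] by (simp add: left_diff_distrib del: sum.cl_ivl_Suc)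
  qed
  ultimately show ?case by blast
qed

lemma is_zeta_exists: "\<exists>f. is_zeta f"
proof -
  obtain G where G: "\<And>k. G k holomorphic_on {s. Re s > 1 - real k}"
    "\<And>k s. Re s > 1 \<Longrightarrow> G k s = (s - 1) * zeta_series s"
    using zeta_step by metis
  have agree: "G k s = G l s" if "k \<le> l" "Re s > 1 - real k" for k l s
  proof (rule analytic_continuation_open[of "{s. Re s > 1}" "{s. Re s > 1 - real k}" "G k" "G l"])
    show "{s. Re s > 1} \<noteq> {}" by (auto intro!: exI[of _ 2])
    show "connected {s. Re s > 1 - real k}"
      by (intro convex_connected convex_halfspace_Re_gt)
    show "G l holomorphic_on {s. Re s > 1 - real k}"
      using that by (intro holomorphic_on_subset[OF G(1)]) auto
  qed (use G that in \<open>auto simp: open_halfspace_Re_gt\<close>)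
  define E where "E s = G (nat \<lceil>2 - Re s\<rceil>) s" for s
  have E: "E s = G k s" if "Re s > 1 - real k" for k s
  proof -
    have "Re s > 1 - real (nat \<lceil>2 - Re s\<rceil>)" by linarith
    then show ?thesis
      unfolding E_def using agree that by (cases "k \<le> nat \<lceil>2 - Re s\<rceil>") auto
  qed
  have holE: "E holomorphic_on UNIV"
  proof -
    have "E holomorphic_on (\<Union>k. {s. Re s > 1 - real k})"
      by (rule holomorphic_on_UN_open)
         (auto simp: open_halfspace_Re_gt intro: holomorphic_transform[OF G(1)] simp: E)
    moreover have "(\<Union>k. {s. Re s > 1 - real k}) = UNIV"
    proof (intro equalityI subsetI UNIV_I)
      fix s :: complex
      obtain k :: nat where "1 - Re s < real k" using reals_Archimedean2 by blast
      then have "s \<in> {s. Re s > 1 - real k}" by simp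
      then show "s \<in> (\<Union>k. {s. Re s > 1 - real k})" by blast
    qed
    ultimately show ?thesis by simp
  qed
  have "is_zeta (\<lambda>s. E s / (s - 1))"
    unfolding is_zeta_def
  proof (intro conjI allI impI)
    show "(\<lambda>s. E s / (s - 1)) holomorphic_on - {1}"
      by (intro holomorphic_intros holomorphic_on_subset[OF holE]) auto
    fix s :: complex assume s: "Re s > 1"
    then have "s \<noteq> 1" by auto
    then have "E s / (s - 1) = zeta_series s"
      using E[of 0 s] G(2)[of s 0] s by simp
    then show "(\<lambda>n. of_nat (Suc n) powr (- s)) sums (E s / (s - 1))"
      using zeta_series_sums[OF s] by simp
  qed
  then show ?thesis by blast
qed

lemma is_zeta_unique:
  assumes "is_zeta f" "is_zeta g" "s \<noteq> 1"
  shows "f s = g s"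
proof (rule analytic_continuation_open[of "{s. Re s > 1}" "- {1}" f g])
  show "{s. Re s > 1} \<noteq> {}" by (auto intro!: exI[of _ 2])
  show "connected (- {1::complex})"
    by (intro connected_punctured_universe) auto
  show "f s = g s" if "s \<in> {s. Re s > 1}" for s
    using assms that unfolding is_zeta_def by (auto intro: sums_unique2)
qed (use assms in \<open>auto simp: open_halfspace_Re_gt is_zeta_def\<close>)

lemma is_zeta_riemann_zeta: "is_zeta riemann_zeta"
proof -
  obtain f where f: "is_zeta f" using is_zeta_exists by blast
  define g where "g s = (if s = 1 then 0 else f s)" for s
  have "g holomorphic_on - {1}"
    using f unfolding is_zeta_def by (intro holomorphic_transform[of f _ g]) (simp_all add: g_def)
  moreover have "g s = f s" if "Re s > 1" for s using that by (auto simp: g_def)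
  ultimately have g: "is_zeta g" "g 1 = 0"
    using f by (auto simp: is_zeta_def g_def)
  have "is_zeta riemann_zeta \<and> riemann_zeta 1 = 0"
    unfolding riemann_zeta_def
  proof (rule theI[where P = "\<lambda>f. is_zeta f \<and> f 1 = 0" and a = g])
    show "is_zeta g \<and> g 1 = 0" using g by simp
    show "h = g" if "is_zeta h \<and> h 1 = 0" for h
    proof (rule ext)
      fix s show "h s = g s"
        using is_zeta_unique[of h g s] that g by (cases "s = 1") auto
    qed
  qed
  then show ?thesis by blast
qed

text \<open>
  The integrals above are not default values: all integrands are integrable on their intervals.
\<close>

lemma layer_mean_integrable: "x \<ge> 2 \<Longrightarrow> (\<lambda>t. 1 / ln t) integrable_on {x..y::real}"
  by (intro integrable_continuous_real continuous_intros) auto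

lemma layer_fluctuation_square_integrable:
  assumes c: "c > 0" and X: "X \<ge> 2"
  shows "(\<lambda>x. (layer_fluctuation c x)\<^sup>2) integrable_on {X..2 * X}"
proof -
  define w where "w x = x + c * sqrt x" for x
  define P where "P y = real (card {p::nat. prime p \<and> real p \<le> y})" for y
  define L where "L y = integral {X..y} (\<lambda>t. 1 / ln t)" for y :: real
  have fin: "finite {p::nat. prime p \<and> real p \<le> y}" for y
    by (rule finite_subset[of _ "{..nat \<lfloor>y\<rfloor>}"]) (auto simp: le_nat_floor)
  have w_mono: "w x \<le> w y" if "x \<le> y" for x y
    using that c by (auto simp: w_def intro!: add_mono mult_left_mono)
  have w_ge: "w x \<ge> x" if "x \<ge> X" for x using that c X by (simp add: w_def)
  have P_mono: "mono P"
    unfolding P_def by (intro monoI) (auto intro!: card_mono fin)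
  have P_pos: "P y \<ge> 0" for y by (simp add: P_def)
  have meas: "P \<in> borel_measurable borel" "(\<lambda>x. P (w x)) \<in> borel_measurable borel"
    using P_mono w_mono by (auto intro!: borel_measurable_mono simp: mono_def)
  have N: "real (layer_count c x) = P (w x) - P x" if "x \<ge> X" for x
  proof -
    have "{p::nat. prime p \<and> x < real p \<and> real p \<le> w x}
        = {p. prime p \<and> real p \<le> w x} - {p. prime p \<and> real p \<le> x}" by auto
    moreover have "card ({p. prime p \<and> real p \<le> w x} - {p. prime p \<and> real p \<le> x})
        = card {p. prime p \<and> real p \<le> w x} - card {p. prime p \<and> real p \<le> x}"
      using w_ge[OF that] by (intro card_Diff_subset fin) auto
    moreover have "card {p. prime p \<and> real p \<le> x} \<le> card {p. prime p \<and> real p \<le> w x}"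
      using w_ge[OF that] by (intro card_mono fin) auto
    ultimately show ?thesis
      unfolding layer_count_def P_def w_def by (simp add: of_nat_diff)
  qed
  have M: "layer_mean c x = L (w x) - L x" if "x \<ge> X" for x
    using Henstock_Kurzweil_Integration.integral_combine[of X x "w x" "\<lambda>t. 1 / ln t"]
      that w_ge[OF that] layer_mean_integrable[OF X]
    by (simp add: layer_mean_def L_def w_def)
  have Lc: "continuous_on {X..w (2 * X)} L"
    unfolding L_def by (intro indefinite_integral_continuous_1 layer_mean_integrable X)
  have wc: "continuous_on {X..2 * X} w" unfolding w_def by (intro continuous_intros)
  have Ic: "continuous_on {X..2 * X} (\<lambda>x. L (w x) - L x)"
  proof (intro continuous_on_diff)
    show "continuous_on {X..2 * X} (\<lambda>x. L (w x))"
      proof (rule continuous_on_compose2[OF Lc wc])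
      show "w ` {X..2 * X} \<subseteq> {X..w (2 * X)}"
      proof
        fix y assume "y \<in> w ` {X..2 * X}"
        then obtain x where "y = w x" "X \<le> x" "x \<le> 2 * X" by auto
        then show "y \<in> {X..w (2 * X)}" using w_ge[of x] w_mono[of x "2 * X"] by simp
      qed
    qed
    show "continuous_on {X..2 * X} L"
      using w_ge[of "2 * X"] X by (intro continuous_on_subset[OF Lc]) auto
  qed
  obtain B where B: "\<And>x. x \<in> {X..2 * X} \<Longrightarrow> norm (L (w x) - L x) \<le> B"
    using compact_imp_bounded[OF compact_continuous_image[OF Ic compact_Icc]]
    unfolding bounded_iff by blast
  have bound: "norm ((layer_fluctuation c x)\<^sup>2) \<le> (P (w (2 * X)) + B)\<^sup>2" if x: "x \<in> {X..2 * X}" for x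
  proof -
    have "P (w x) - P x \<le> P (w (2 * X))"
      using monoD[OF P_mono, of "w x" "w (2 * X)"] w_mono[of x "2 * X"] x
      by (simp add: P_def add_increasing)
    moreover have "real (layer_count c x) \<ge> 0" by simp
    ultimately have "\<bar>layer_fluctuation c x\<bar> \<le> P (w (2 * X)) + B"
      using B[OF x] N[of x] M[of x] x P_pos unfolding layer_fluctuation_def real_norm_def by auto
    then have "\<bar>layer_fluctuation c x\<bar>\<^sup>2 \<le> (P (w (2 * X)) + B)\<^sup>2"
      by (intro power_mono) auto
    then show ?thesis by simp
  qed
  have "(\<lambda>x. P (w x) - P x) \<in> borel_measurable (lebesgue_on {X..2 * X})"
    using meas by (intro measurable_restrict_space1 measurable_completion) auto
  moreover have "(\<lambda>x. L (w x) - L x) \<in> borel_measurable (lebesgue_on {X..2 * X})"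
    using Ic by (intro continuous_imp_measurable_on_sets_lebesgue) auto
  ultimately have "(\<lambda>x. ((P (w x) - P x) - (L (w x) - L x))\<^sup>2)
      \<in> borel_measurable (lebesgue_on {X..2 * X})"
    by measurable
  also have "?this \<longleftrightarrow> (\<lambda>x. (layer_fluctuation c x)\<^sup>2) \<in> borel_measurable (lebesgue_on {X..2 * X})"
    by (rule measurable_cong) (auto simp: layer_fluctuation_def N M)
  finally have "(\<lambda>x. (layer_fluctuation c x)\<^sup>2) \<in> borel_measurable (lebesgue_on {X..2 * X})" .
  moreover have "(\<lambda>_. (P (w (2 * X)) + B)\<^sup>2) integrable_on {X..2 * X}"
    by (rule integrable_const_ivl)
  ultimately show ?thesis
    using bound by (rule measurable_bounded_by_integrable_imp_integrable) (simp_all only: lborelD[OF borel_closed[OF closed_atLeastAtMost]] sets_completionI_sets)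
qed

end

theory Submission
  imports Defs "HOL-Number_Theory.Prime_Powers" "HOL-Probability.Probability"
    "HOL-Real_Asymp.Real_Asymp"
begin

text \<open>
  The variance of primes in short intervals is an \<open>L\<^sup>2\<close> statement, so no explicit formula is needed:
  it suffices to know the size of \<open>zeta' / zeta\<close> close to the critical line and to have one half of
  Plancherel's theorem.

  Let \<open>E x = psi x - (x - 1)\<close> be the error of Chebyshev's function and \<open>Z s = (s - 1) * zeta s\<close>. The
  Laplace transform of \<open>E (exp v)\<close> is \<open>- Z' s / Z s / s\<close>, and that of the increment
  \<open>E (exp (v + \<theta>)) - E (exp v)\<close> carries the further factor \<open>exp (s * \<theta>) - 1\<close>. Under the Riemann
  Hypothesis this transform is holomorphic for \<open>Re s > 1/2\<close>, and the bound
  \<open>|Z' s / Z s| \<le> A * ln (|Im s| + 3) / (Re s - 1/2)\<close> of \<open>reg_zeta_logderiv_bound\<close> holds there. It comes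
  from Jensen's idea: a holomorphic function of size \<open>exp M\<close> on a disc has \<open>O(M)\<close> zeros in a smaller
  disc, each of them contributes at most the inverse of its distance to the logarithmic derivative, and
  what is left after dividing them out contributes \<open>O(M)\<close> by the Borel-Caratheodory theorem
  (\<open>norm_logderiv_le\<close>).

  The integral that defines the transform converges absolutely for \<open>Re s > 1\<close>; nothing is known about
  it in the critical strip, so the line of integration has to be moved to the left before any mean square can be taken. This is done for
  Gaussian averages of the increment, whose transforms decay fast enough for all integrals to converge
  absolutely; a local inequality of Plancherel type and Fatou's lemma then remove the average
  (\<open>L2_bound_by_shifted_transform\<close>). On \<open>Re s = 1/2 + 1 / ln X\<close> with \<open>\<theta>\<close> of order \<open>1 / sqrt X\<close> the
  transform is square integrable with integral \<open>O((ln X)\<^sup>4 / sqrt X)\<close>, which bounds the mean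
  square of \<open>E (x * exp \<theta>) - E x\<close> over \<open>[X, 2 * X]\<close> by \<open>O(sqrt X * (ln X)\<^sup>4)\<close>
  (\<open>psi_window_mean_square_log\<close>).

  The layer \<open>(x, x + c * sqrt x]\<close> is not a window of constant ratio. Averaging over \<open>\<theta>\<close>, as Saffari and
  Vaughan do, writes its increment as a difference of two increments of constant ratio
  (\<open>psi_window_average\<close>). Finally the von Mangoldt weight is replaced by \<open>ln x\<close>, which divides the mean
  square by \<open>(ln X)\<^sup>2\<close>: the proper prime powers in a layer contribute only \<open>O((ln x)\<^sup>2)\<close> to the
  weighted count, since each exponent has a bounded number of powers there
  (\<open>layer_fluctuation_le\<close>).
\<close>

section \<open>The logarithmic derivative of a bounded holomorphic function\<close>

text \<open>
  The Cayley transform maps the right half-plane to the unit disc and \<open>p 0\<close> to the origin, so the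
  Schwarz lemma applies. The bound is sharp when \<open>p 0\<close> is real.
\<close>
lemma norm_le_of_Re_pos:
  fixes p :: "complex \<Rightarrow> complex"
  assumes hol: "p holomorphic_on ball 0 R" and R: "R > 0"
    and pos: "\<And>z. norm z < R \<Longrightarrow> Re (p z) > 0"
    and z: "norm z < R"
  shows "norm (p z) \<le> norm (p 0) * (R + norm z) / (R - norm z)"
proof -
  define a where "a = p 0"
  define q where "q w = p (of_real R * w)" for w
  define f where "f w = (q w - a) / (q w + cnj a)" for w
  have a: "Re a > 0" unfolding a_def using pos[of 0] R by simp
  have in_ball: "norm (of_real R * w) < R" if "norm w < 1" for w :: complex
    using that R by (simp add: norm_mult)
  have q: "Re (q w) > 0" if "norm w < 1" for w
    unfolding q_def using in_ball[OF that] by (rule pos)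
  have nz: "q w + cnj a \<noteq> 0" if "norm w < 1" for w
    using q[OF that] a by (auto simp: complex_eq_iff)
  have qhol: "q holomorphic_on ball 0 1"
  proof -
    have "(p \<circ> (\<lambda>w. of_real R * w)) holomorphic_on ball 0 1"
      by (rule holomorphic_on_compose_gen[OF _ hol]) (auto intro!: holomorphic_intros in_ball)
    then show ?thesis unfolding q_def o_def .
  qed
  have fhol: "f holomorphic_on ball 0 1"
    unfolding f_def by (intro holomorphic_intros qhol) (use nz in auto)
  have f0: "f 0 = 0" by (simp add: f_def q_def a_def)
  have less: "norm (f w) < 1" if w: "norm w < 1" for w
  proof -
    have "(norm (q w + cnj a))\<^sup>2 - (norm (q w - a))\<^sup>2 = 4 * Re (q w) * Re a"
      unfolding cmod_power2 by (simp add: power2_eq_square algebra_simps)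
    moreover have "4 * Re (q w) * Re a > 0" using q[OF w] a by simp
    ultimately have "(norm (q w - a))\<^sup>2 < (norm (q w + cnj a))\<^sup>2" by linarith
    then have "norm (q w - a) < norm (q w + cnj a)"
      by (rule power_less_imp_less_base) simp
    then show ?thesis using nz[OF w] by (simp add: f_def norm_divide)
  qed
  define w where "w = z / of_real R"
  have w: "norm w < 1" "norm w = norm z / R" using z R by (auto simp: w_def norm_divide)
  have fw: "norm (f w) \<le> norm w" by (rule Schwarz_Lemma(1)[OF fhol f0 less w(1)])
  have qw: "q w = p z" using R by (simp add: q_def w_def)
  have "q w * (1 - f w) = a + cnj a * f w"
    using nz[OF w(1)] by (simp add: f_def field_simps)
  then have "norm (q w) * norm (1 - f w) = norm (a + cnj a * f w)"
    by (metis norm_mult)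
  also have "\<dots> \<le> norm a + norm a * norm (f w)"
    by (metis norm_triangle_ineq norm_mult complex_mod_cnj)
  also have "\<dots> \<le> norm a * (1 + norm w)"
    using fw by (simp add: distrib_left mult_left_mono)
  finally have *: "norm (q w) * norm (1 - f w) \<le> norm a * (1 + norm w)" .
  have "1 - norm w \<le> norm (1 - f w)"
    using fw norm_triangle_ineq2[of 1 "f w"] by simp
  then have "norm (q w) * (1 - norm w) \<le> norm (q w) * norm (1 - f w)"
    by (intro mult_left_mono) auto
  with * have "norm (q w) * (1 - norm w) \<le> norm a * (1 + norm w)" by linarith
  then have "norm (q w) \<le> norm a * (1 + norm w) / (1 - norm w)"
    using w(1) by (simp add: field_simps)
  also have "\<dots> = norm a * (R + norm z) / (R - norm z)"
    unfolding w(2) using R z by (simp add: field_simps)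
  finally show ?thesis unfolding qw a_def .
qed

text \<open>
  Cauchy's inequality on the disc around \<open>z\<close> that reaches half-way to the boundary.
\<close>
lemma norm_deriv_le_of_Re_pos:
  fixes p :: "complex \<Rightarrow> complex"
  assumes hol: "p holomorphic_on ball 0 R" and R: "R > 0"
    and pos: "\<And>z. norm z < R \<Longrightarrow> Re (p z) > 0"
    and z: "norm z < R"
  shows "norm (deriv p z) \<le> norm (p 0) * (8 * R / (R - norm z)\<^sup>2)"
proof -
  define r where "r = (R - norm z) / 2"
  have r: "r > 0" using z by (simp add: r_def)
  have sub: "cball z r \<subseteq> ball 0 R"
  proof
    fix x assume "x \<in> cball z r"
    then have "norm (z - x) \<le> r" by (simp add: dist_norm)
    moreover have "norm x \<le> norm z + norm (z - x)"
      by (metis norm_minus_commute norm_triangle_sub)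
    ultimately show "x \<in> ball 0 R" using z by (simp add: r_def)
  qed
  have "norm ((deriv ^^ 1) p z) \<le> fact 1 * (norm (p 0) * (2 * R) / r) / r ^ 1"
  proof (rule Cauchy_inequality)
    show "p holomorphic_on ball z r"
      using sub by (intro holomorphic_on_subset[OF hol]) auto
    show "continuous_on (cball z r) p"
      using sub by (intro holomorphic_on_imp_continuous_on holomorphic_on_subset[OF hol]) auto
    show "r > 0" by fact
    fix x assume x: "norm (z - x) = r"
    have xn: "norm x \<le> norm z + r"
      using x by (metis norm_minus_commute norm_triangle_sub)
    have xR: "norm x < R" "R - norm x \<ge> r" using xn z by (auto simp: r_def field_simps)
    have "norm (p x) \<le> norm (p 0) * (R + norm x) / (R - norm x)"
      by (rule norm_le_of_Re_pos[OF hol R pos xR(1)])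
    also have "\<dots> \<le> norm (p 0) * (2 * R) / r"
      using xR r R by (intro frac_le mult_left_mono mult_nonneg_nonneg) auto
    finally show "norm (p x) \<le> norm (p 0) * (2 * R) / r" .
  qed
  also have "\<dots> = norm (p 0) * (8 * R / (R - norm z)\<^sup>2)"
    using r by (simp add: r_def power2_eq_square field_simps)
  finally show ?thesis by simp
qed

text \<open>
  The Borel-Caratheodory bound for \<open>- ln g\<close>, whose real part is nonnegative because \<open>g\<close> is
  bounded by 1. The constant 1 is added to make the real part positive, and the imaginary part at the
  origin is removed so that the value there is real.
\<close>
lemma norm_logderiv_le_of_zero_free:
  fixes g :: "complex \<Rightarrow> complex"
  assumes hol: "g holomorphic_on ball 0 R" and R: "R > 0"
    and le: "\<And>z. norm z < R \<Longrightarrow> norm (g z) \<le> 1"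
    and nz: "\<And>z. norm z < R \<Longrightarrow> g z \<noteq> 0"
    and z: "norm z < R"
  shows "norm (deriv g z / g z) \<le> (1 - ln (norm (g 0))) * (8 * R / (R - norm z)\<^sup>2)"
proof -
  have "simply_connected (ball (0::complex) R)"
    by (simp add: convex_imp_simply_connected)
  then obtain L where L: "L holomorphic_on ball 0 R" "\<And>z. z \<in> ball 0 R \<Longrightarrow> g z = exp (L z)"
    using simply_connected_eq_holomorphic_log[of "ball 0 R"] hol nz
    by (metis mem_ball_0 open_ball)
  define p where "p z = 1 - L z + \<i> * of_real (Im (L 0))" for z
  have phol: "p holomorphic_on ball 0 R" unfolding p_def by (intro holomorphic_intros L)
  have ReL: "Re (L z) = ln (norm (g z))" if "norm z < R" for z
    using L(2)[of z] that by simp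
  have Rp: "Re (p z) > 0" if "norm z < R" for z
  proof -
    have "ln (norm (g z)) \<le> 0" using le[OF that] nz[OF that] by simp
    then show ?thesis using ReL[OF that] by (simp add: p_def)
  qed
  have p0: "p 0 = of_real (1 - ln (norm (g 0)))"
    using ReL[of 0] R by (simp add: p_def complex_eq_iff)
  have p0': "norm (p 0) = 1 - ln (norm (g 0))"
  proof -
    have "1 - ln (norm (g 0)) \<ge> 0" using Rp[of 0] R unfolding p0 by simp
    then show ?thesis unfolding p0 norm_of_real by simp
  qed
  have zb: "z \<in> ball 0 R" using z by simp
  have dL: "(L has_field_derivative deriv L z) (at z)"
    using L(1) zb by (metis holomorphic_derivI open_ball)
  have "(p has_field_derivative - deriv L z) (at z)"
    unfolding p_def by (auto intro!: derivative_eq_intros dL)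
  then have dp: "deriv p z = - deriv L z" by (rule DERIV_imp_deriv)
  have "((\<lambda>w. exp (L w)) has_field_derivative exp (L z) * deriv L z) (at z)"
    by (auto intro!: derivative_eq_intros dL)
  then have "(g has_field_derivative exp (L z) * deriv L z) (at z)"
    by (rule has_field_derivative_transform_within_open[of _ _ _ "ball 0 R"]) (use zb L(2) in auto)
  then have "deriv g z = g z * deriv L z" using L(2)[OF zb] by (simp add: DERIV_imp_deriv)
  then have "deriv g z / g z = deriv L z" using nz[OF z] by simp
  then have "norm (deriv g z / g z) = norm (deriv p z)" by (simp add: dp)
  also have "\<dots> \<le> norm (p 0) * (8 * R / (R - norm z)\<^sup>2)"
    by (rule norm_deriv_le_of_Re_pos[OF phol R Rp z])
  finally show ?thesis unfolding p0' .
qed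

text \<open>
  Dividing a zero out by a Blaschke factor keeps the bound 1 on the unit disc: the function
  \<open>g\<close> composed with the Moebius map that moves \<open>a\<close> to the origin satisfies the Schwarz lemma.
\<close>
lemma divide_out_zero:
  fixes g :: "complex \<Rightarrow> complex"
  assumes hol: "g holomorphic_on ball 0 1" and le: "\<And>z. norm z < 1 \<Longrightarrow> norm (g z) \<le> 1"
    and a: "norm a < 1" "g a = 0"
  obtains h where "h holomorphic_on ball 0 1" "\<And>z. norm z < 1 \<Longrightarrow> norm (h z) \<le> 1"
    "\<And>z. norm z < 1 \<Longrightarrow> g z = (z - a) / (1 - cnj a * z) * h z"
proof -
  define k where "k z = (if z = a then deriv g a else (g z - g a) / (z - a))" for z
  define h where "h z = k z * (1 - cnj a * z)" for z
  have khol: "k holomorphic_on ball 0 1"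
    unfolding k_def by (rule pole_lemma_open[OF hol open_ball])
  have hhol: "h holomorphic_on ball 0 1" unfolding h_def by (intro holomorphic_intros khol)
  have den: "1 - cnj a * z \<noteq> 0" if "norm z < 1" for z
  proof
    assume "1 - cnj a * z = 0"
    then have "norm (cnj a * z) = 1" by (metis eq_iff_diff_eq_0 norm_one)
    moreover have "norm (cnj a * z) < 1"
      using a that by (metis complex_mod_cnj mult.right_neutral mult_strict_mono' norm_ge_zero norm_mult)
    ultimately show False by simp
  qed
  have gh: "g z = (z - a) / (1 - cnj a * z) * h z" if "norm z < 1" for z
    using den[OF that] a by (simp add: h_def k_def)
  have gm: "norm (g z) \<le> norm (Moebius_function 0 a z)" if z: "norm z < 1" for z
  proof (rule field_le_mult_one_interval)
    \<comment> \<open>The Schwarz lemma asks for strict inequality, hence the factor \<open>q < 1\<close>.\<close>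
    fix q :: real assume q: "0 < q" "q < 1"
    define f where "f w = of_real q * g (Moebius_function 0 (- a) w)" for w
    have Mb: "norm (Moebius_function 0 (- a) w) < 1" if "norm w < 1" for w
      using a that by (intro Moebius_function_norm_lt_1) auto
    have "(g \<circ> Moebius_function 0 (- a)) holomorphic_on ball 0 1"
      using a Mb by (intro holomorphic_on_compose_gen[OF _ hol] Moebius_function_holomorphic) auto
    then have fhol: "f holomorphic_on ball 0 1"
      unfolding f_def by (intro holomorphic_intros) (simp add: o_def)
    have f0: "f 0 = 0" by (simp add: f_def Moebius_function_of_zero a)
    have fl: "norm (f w) < 1" if "norm w < 1" for w
    proof -
      have "norm (f w) \<le> q * 1"
        unfolding f_def norm_mult norm_of_real using q le[OF Mb[OF that]] by (intro mult_mono) auto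
      then show ?thesis using q by simp
    qed
    have M: "norm (Moebius_function 0 a z) < 1"
      using a z by (intro Moebius_function_norm_lt_1)
    have "norm (f (Moebius_function 0 a z)) \<le> norm (Moebius_function 0 a z)"
      by (rule Schwarz_Lemma(1)[OF fhol f0 fl M])
    moreover have "Moebius_function 0 (- a) (Moebius_function 0 a z) = z"
      using a z by (intro Moebius_function_compose) auto
    ultimately show "q * norm (g z) \<le> norm (Moebius_function 0 a z)"
      using q by (simp add: f_def norm_mult)
  qed
  have h1: "norm (h z) \<le> 1" if z: "norm z < 1" "z \<noteq> a" for z
  proof -
    have "norm (Moebius_function 0 a z) * norm (h z) \<le> norm (Moebius_function 0 a z) * 1"
      using gm[OF z(1)] unfolding gh[OF z(1)] Moebius_function_simple norm_mult by simp
    moreover have "norm (Moebius_function 0 a z) > 0"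
      using z den[OF z(1)] by (simp add: Moebius_function_simple)
    ultimately show ?thesis by simp
  qed
  have h2: "norm (h z) \<le> 1" if z: "norm z < 1" for z
  proof (cases "z = a")
    case True
    have "isCont h a"
      using hhol a by (intro continuous_on_interior[of "ball 0 1"] holomorphic_on_imp_continuous_on)
        (auto simp: interior_open)
    then have "((\<lambda>w. norm (h w)) \<longlongrightarrow> norm (h a)) (at a)"
      by (intro tendsto_norm) (simp add: isCont_def)
    moreover have "eventually (\<lambda>w. norm (h w) \<le> 1) (at a)"
    proof -
      have "eventually (\<lambda>w. w \<in> ball 0 1 - {a}) (at a)"
        using a by (intro eventually_at_in_open) auto
      then show ?thesis by eventually_elim (use h1 in auto)
    qed
    ultimately have "norm (h a) \<le> 1" by (rule tendsto_upperbound) simp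
    then show ?thesis using True by simp
  qed (use h1 z in auto)
  show ?thesis by (rule that[OF hhol h2 gh])
qed

text \<open>
  Here \<open>k\<close> bounds the number of zeros in the disc of radius \<open>R\<close>. Each division by a
  Blaschke factor increases \<open>|g 0|\<close> by a factor of at least \<open>1 / R\<close> while the function stays bounded by
  1, so the process stops after at most \<open>k\<close> steps. The logarithmic derivative of one
  factor is at most \<open>1 / \<eta> + 1 / (1 - R)\<close>.
\<close>
lemma norm_logderiv_le_zeros:
  fixes g :: "complex \<Rightarrow> complex" and R \<eta> :: real
  assumes "g holomorphic_on ball 0 1" and "\<And>z. norm z < 1 \<Longrightarrow> norm (g z) \<le> 1"
    and R: "0 < R" "R < 1" and "g 0 \<noteq> 0" and "norm (g 0) \<ge> R ^ k"
    and z: "norm z < R" and \<eta>: "\<eta> > 0"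
    and "\<And>a. norm a < R \<Longrightarrow> g a = 0 \<Longrightarrow> norm (z - a) \<ge> \<eta>"
  shows "norm (deriv g z / g z)
     \<le> real k * (1 / \<eta> + 1 / (1 - R)) + (1 - ln (norm (g 0))) * (8 * R / (R - norm z)\<^sup>2)"
  using assms(1,2,5,6,9)
proof (induction k arbitrary: g)
  case 0
  note g = 0
  show ?case
  proof (cases "\<exists>a. norm a < R \<and> g a = 0")
    case False
    have "norm (deriv g z / g z) \<le> (1 - ln (norm (g 0))) * (8 * R / (R - norm z)\<^sup>2)"
      by (rule norm_logderiv_le_of_zero_free) (use False g R z in \<open>auto intro: holomorphic_on_subset\<close>)
    then show ?thesis by simp
  next
    case True
    then obtain a where a: "norm a < R" "g a = 0" by blast
    have a1: "norm a < 1" using a R by simp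
    obtain h where h: "h holomorphic_on ball 0 1" "\<And>z. norm z < 1 \<Longrightarrow> norm (h z) \<le> 1"
      "\<And>z. norm z < 1 \<Longrightarrow> g z = (z - a) / (1 - cnj a * z) * h z"
      using divide_out_zero[OF g(1,2) a1 a(2)] by blast
    have "norm (g 0) = norm a * norm (h 0)" using h(3)[of 0] by (simp add: norm_mult)
    also have "\<dots> \<le> norm a * 1" using h(2)[of 0] by (intro mult_left_mono) auto
    finally show ?thesis using g(4) a1 by simp
  qed
next
  case (Suc k)
  note g = Suc.prems
  show ?case
  proof (cases "\<exists>a. norm a < R \<and> g a = 0")
    case False
    have "norm (deriv g z / g z) \<le> (1 - ln (norm (g 0))) * (8 * R / (R - norm z)\<^sup>2)"
      by (rule norm_logderiv_le_of_zero_free) (use False g R z in \<open>auto intro: holomorphic_on_subset\<close>)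
    also have "\<dots> \<le> real (Suc k) * (1 / \<eta> + 1 / (1 - R)) + (1 - ln (norm (g 0))) * (8 * R / (R - norm z)\<^sup>2)"
      using \<eta> R by simp
    finally show ?thesis .
  next
    case True
    then obtain a where a: "norm a < R" "g a = 0" by blast
    have a1: "norm a < 1" using a R by simp
    obtain h where h: "h holomorphic_on ball 0 1" "\<And>z. norm z < 1 \<Longrightarrow> norm (h z) \<le> 1"
      "\<And>z. norm z < 1 \<Longrightarrow> g z = (z - a) / (1 - cnj a * z) * h z"
      using divide_out_zero[OF g(1,2) a1 a(2)] by blast
    have g0: "norm (g 0) = norm a * norm (h 0)" using h(3)[of 0] by (simp add: norm_mult)
    have h0: "h 0 \<noteq> 0" "a \<noteq> 0" using g0 g(3) by auto
    have "R * norm (h 0) \<ge> norm a * norm (h 0)" using a by (intro mult_right_mono) auto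
    then have "R * R ^ k \<le> R * norm (h 0)" using g(4) g0 by simp
    then have hk: "norm (h 0) \<ge> R ^ k" using R by simp
    have gh0: "norm (g 0) \<le> norm (h 0)" unfolding g0 using a1 by (simp add: mult_left_le_one_le)
    have hz: "norm (z - b) \<ge> \<eta>" if b: "norm b < R" "h b = 0" for b
      using g(5)[of b] b h(3)[of b] R by simp
    have IH: "norm (deriv h z / h z)
       \<le> real k * (1 / \<eta> + 1 / (1 - R)) + (1 - ln (norm (h 0))) * (8 * R / (R - norm z)\<^sup>2)"
      by (rule Suc.IH[OF h(1,2) h0(1) hk hz])
    have hnz: "h z \<noteq> 0" using hz[of z] z \<eta> by auto
    have za: "norm (z - a) \<ge> \<eta>" by (rule g(5)[OF a])
    have zb: "z \<in> ball 0 1" using z R by simp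
    have den: "norm (1 - cnj a * z) \<ge> 1 - R"
    proof -
      have "norm (cnj a * z) \<le> 1 * R"
        unfolding norm_mult using a1 z by (intro mult_mono) auto
      then show ?thesis using norm_triangle_ineq2[of 1 "cnj a * z"] by simp
    qed
    then have dnz: "1 - cnj a * z \<noteq> 0" using R by auto
    have dh: "(h has_field_derivative deriv h z) (at z)"
      using h(1) zb by (metis holomorphic_derivI open_ball)
    have "((\<lambda>w. (w - a) / (1 - cnj a * w) * h w) has_field_derivative
        ((1 - cnj a * z) + (z - a) * cnj a) / (1 - cnj a * z)\<^sup>2 * h z
        + (z - a) / (1 - cnj a * z) * deriv h z) (at z)"
      by (rule derivative_eq_intros dh refl dnz)+ (simp add: power2_eq_square algebra_simps)
    then have "(g has_field_derivative
        ((1 - cnj a * z) + (z - a) * cnj a) / (1 - cnj a * z)\<^sup>2 * h z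
        + (z - a) / (1 - cnj a * z) * deriv h z) (at z)"
      by (rule has_field_derivative_transform_within_open[of _ _ _ "ball 0 1"]) (use zb h(3) in auto)
    then have dg: "deriv g z = ((1 - cnj a * z) + (z - a) * cnj a) / (1 - cnj a * z)\<^sup>2 * h z
        + (z - a) / (1 - cnj a * z) * deriv h z" by (rule DERIV_imp_deriv)
    have zna: "z - a \<noteq> 0" using za \<eta> by auto
    have "deriv g z / g z = 1 / (z - a) + cnj a / (1 - cnj a * z) + deriv h z / h z"
    proof -
      have gz: "g z = (z - a) / (1 - cnj a * z) * h z" using h(3)[of z] zb by simp
      have "deriv g z = (1 / (z - a) + cnj a / (1 - cnj a * z) + deriv h z / h z) * g z"
      proof -
        have eq: "((1 - cnj a * z) + (z - a) * cnj a) / (1 - cnj a * z)\<^sup>2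
          = (1 / (z - a) + cnj a / (1 - cnj a * z)) * ((z - a) / (1 - cnj a * z))"
          using dnz zna by (simp add: power2_eq_square distrib_right) (simp add: add_divide_distrib mult.commute)
        have alg: "X * A * y + A * d = (X + d / y) * (A * y)" if "y \<noteq> 0" for X A y d :: complex
          using that by (simp add: field_simps)
        show ?thesis unfolding dg gz eq by (rule alg[OF hnz])
      qed
      moreover have "g z \<noteq> 0" unfolding gz using zna dnz hnz by simp
      ultimately show ?thesis by simp
    qed
    then have "norm (deriv g z / g z) \<le> norm (1 / (z - a) + cnj a / (1 - cnj a * z)) + norm (deriv h z / h z)"
      by (metis norm_triangle_ineq)
    also have "norm (1 / (z - a) + cnj a / (1 - cnj a * z)) \<le> norm (1 / (z - a)) + norm (cnj a / (1 - cnj a * z))"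
      by (rule norm_triangle_ineq)
    also have "norm (1 / (z - a)) \<le> 1 / \<eta>"
      using za \<eta> by (simp add: norm_divide frac_le)
    also have "norm (cnj a / (1 - cnj a * z)) \<le> 1 / (1 - R)"
      unfolding norm_divide using den R a1 by (intro frac_le) auto
    finally have "norm (deriv g z / g z) \<le> 1 / \<eta> + 1 / (1 - R) + norm (deriv h z / h z)" by simp
    also have "\<dots> \<le> 1 / \<eta> + 1 / (1 - R) + (real k * (1 / \<eta> + 1 / (1 - R)) + (1 - ln (norm (h 0))) * (8 * R / (R - norm z)\<^sup>2))"
      using IH by simp
    also have "(1 - ln (norm (h 0))) * (8 * R / (R - norm z)\<^sup>2) \<le> (1 - ln (norm (g 0))) * (8 * R / (R - norm z)\<^sup>2)"
      using gh0 g(3) R h0(1) by (intro mult_right_mono) (auto simp: ln_le_cancel_iff)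
    finally show ?thesis by (simp add: distrib_right)
  qed
qed

text \<open>
  The previous bound in a disc of any centre and radius. Only the relative size
  \<open>exp M\<close> of \<open>f\<close> enters: \<open>M / ln (1 / q')\<close> is Jensen's bound for the number of zeros in the
  disc of radius \<open>q' * R\<close>.
\<close>
lemma norm_logderiv_le:
  fixes f :: "complex \<Rightarrow> complex" and R q M \<eta> :: real
  assumes hol: "f holomorphic_on ball c R" and R: "R > 0" and q: "0 < q" "q < q'" "q' < 1"
    and le: "\<And>w. norm (w - c) < R \<Longrightarrow> norm (f w) \<le> exp M * norm (f c)" and c: "f c \<noteq> 0"
    and z: "norm (z - c) \<le> q * R" and \<eta>: "\<eta> > 0"
    and zeros: "\<And>a. norm (a - c) < R \<Longrightarrow> f a = 0 \<Longrightarrow> norm (z - a) \<ge> \<eta>"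
  shows "norm (deriv f z / f z)
     \<le> (M / ln (1 / q') + 1) * (1 / \<eta> + 1 / (R * (1 - q'))) + (1 + M) * (8 * q' / (q' - q)\<^sup>2) / R"
proof -
  define g where "g w = f (c + of_real R * w) / (of_real (exp M) * f c)" for w
  have "norm (f c) \<le> exp M * norm (f c)" using le[of c] R by simp
  then have M: "M \<ge> 0" using c by simp
  \<comment> \<open>The least \<open>k\<close> with \<open>q' ^ k \<le> exp (- M) = |g 0|\<close>.\<close>
  define k where "k = nat \<lceil>M / ln (1 / q')\<rceil>"
  have l: "ln (1 / q') > 0" using q by (intro ln_gt_zero) (auto simp: field_simps)
  have nb: "norm ((c + of_real R * w) - c) < R" if "norm w < 1" for w
    using that R by (simp add: norm_mult)
  have ghol: "g holomorphic_on ball 0 1"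
  proof -
    have "(f \<circ> (\<lambda>w. c + of_real R * w)) holomorphic_on ball 0 1"
      by (rule holomorphic_on_compose_gen[OF _ hol])
        (use nb in \<open>auto intro!: holomorphic_intros simp: dist_norm norm_minus_commute\<close>)
    then show ?thesis unfolding g_def o_def by (intro holomorphic_intros) (use c in auto)
  qed
  have gle: "norm (g w) \<le> 1" if "norm w < 1" for w
    using le[OF nb[OF that]] c by (simp add: g_def norm_divide norm_mult divide_le_eq)
  have g0: "g 0 = of_real (exp (- M))" using c by (simp add: g_def exp_minus field_simps flip: exp_of_real)
  then have ng0: "norm (g 0) = exp (- M)" by (metis abs_exp_cancel norm_of_real)
  have gk: "norm (g 0) \<ge> q' ^ k"
  proof -
    have "M / ln (1 / q') \<le> real k" unfolding k_def by linarith
    then have "M \<le> real k * ln (1 / q')" using l by (simp add: field_simps)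
    then have "real k * ln q' \<le> - M" using q by (simp add: ln_div)
    then have "exp (real k * ln q') \<le> exp (- M)" by simp
    then show ?thesis unfolding ng0 using q by (simp add: exp_of_nat_mult)
  qed
  define w where "w = (z - c) / of_real R"
  have w: "norm w \<le> q" using z R by (simp add: w_def norm_divide divide_le_eq)
  have zw: "z = c + of_real R * w" using R by (simp add: w_def)
  have "norm (deriv g w / g w)
     \<le> real k * (1 / (\<eta> / R) + 1 / (1 - q')) + (1 - ln (norm (g 0))) * (8 * q' / (q' - norm w)\<^sup>2)"
  proof (rule norm_logderiv_le_zeros[OF ghol gle])
    show "0 < q'" "q' < 1" "norm w < q'" using q w by auto
    show "g 0 \<noteq> 0" using g0 by simp
    show "\<eta> / R > 0" using \<eta> R by simp
    fix a assume a: "norm a < q'" "g a = 0"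
    then have "f (c + of_real R * a) = 0" using c by (simp add: g_def)
    then have "norm (z - (c + of_real R * a)) \<ge> \<eta>"
      using a q R by (intro zeros) (auto simp: norm_mult)
    also have "z - (c + of_real R * a) = of_real R * (w - a)" by (simp add: zw algebra_simps)
    finally have "\<eta> \<le> R * norm (w - a)" using R by (simp only: norm_mult norm_of_real abs_of_pos)
    then show "\<eta> / R \<le> norm (w - a)" using R by (simp add: divide_le_eq mult.commute)
  qed (use gk in auto)
  also have "\<dots> \<le> (M / ln (1 / q') + 1) * (1 / (\<eta> / R) + 1 / (1 - q')) + (1 + M) * (8 * q' / (q' - q)\<^sup>2)"
  proof (intro add_mono mult_mono)
    show "real k \<le> M / ln (1 / q') + 1"
      unfolding k_def using M l by simp
    show "1 - ln (norm (g 0)) \<le> 1 + M" unfolding ng0 by simp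
    show "8 * q' / (q' - norm w)\<^sup>2 \<le> 8 * q' / (q' - q)\<^sup>2"
      using w q by (intro divide_left_mono power_mono mult_pos_pos) auto
  qed (use M l q \<eta> R in auto)
  finally have gb: "norm (deriv g w / g w) \<le> (M / ln (1 / q') + 1) * (1 / (\<eta> / R) + 1 / (1 - q'))
      + (1 + M) * (8 * q' / (q' - q)\<^sup>2)" .
  have zin: "z \<in> ball c R"
  proof -
    have "q * R < 1 * R" using q R by (intro mult_strict_right_mono) auto
    then show ?thesis using z by (simp add: dist_norm norm_minus_commute)
  qed
  have df: "(f has_field_derivative deriv f z) (at (c + of_real R * w))"
    using hol zin unfolding zw[symmetric] by (metis holomorphic_derivI open_ball)
  have "((\<lambda>w. f (c + of_real R * w)) has_field_derivative deriv f z * of_real R) (at w)"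
    by (rule DERIV_chain2[where f = f and g = "\<lambda>w. c + of_real R * w", OF df]) (auto intro!: derivative_eq_intros)
  then have "(g has_field_derivative deriv f z * of_real R / (of_real (exp M) * f c)) (at w)"
    unfolding g_def by (intro DERIV_cdivide)
  then have "deriv g w = deriv f z * of_real R / (of_real (exp M) * f c)"
    by (rule DERIV_imp_deriv)
  then have "deriv g w / g w = of_real R * (deriv f z / f z)"
    using c by (simp add: g_def flip: zw)
  then have "norm (deriv g w / g w) = R * norm (deriv f z / f z)"
    using R by (simp only: norm_mult norm_of_real abs_of_pos)
  then have "norm (deriv f z / f z) = norm (deriv g w / g w) / R"
    using R by simp
  also have "\<dots> \<le> ((M / ln (1 / q') + 1) * (1 / (\<eta> / R) + 1 / (1 - q'))
      + (1 + M) * (8 * q' / (q' - q)\<^sup>2)) / R"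
    using gb R by (intro divide_right_mono) auto
  also have "\<dots> = (M / ln (1 / q') + 1) * (1 / \<eta> + 1 / (R * (1 - q'))) + (1 + M) * (8 * q' / (q' - q)\<^sup>2) / R"
  proof -
    have "(1 / (\<eta> / R) + 1 / (1 - q')) / R = 1 / \<eta> + 1 / (R * (1 - q'))"
      using R \<eta> q by (simp add: add_divide_distrib)
    then show ?thesis by (simp add: add_divide_distrib flip: times_divide_eq_right)
  qed
  finally show ?thesis .
qed

section \<open>Integrals along vertical lines\<close>

lemma integrable_inverse_1_plus_square_real: "integrable lborel (\<lambda>x::real. 1 / (1 + x\<^sup>2))"
  using integrable_inverse_1_plus_square
  by (simp add: set_integrable_def inverse_eq_divide)

text \<open>
  A primitive of the integrand turns the integral over a vertical segment into a difference of two
  values; this and the convergence of the whole integral are used for both lines below.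
\<close>
lemma vertical_line_integral:
  fixes \<Phi> :: "complex \<Rightarrow> complex"
  assumes hol: "\<Phi> holomorphic_on {s. Re s > \<alpha>}" and a: "\<alpha> < a"
    and bound: "\<And>t. norm (\<Phi> (Complex a t)) \<le> B / (1 + t\<^sup>2)"
    and P: "\<And>s. Re s > \<alpha> \<Longrightarrow> (P has_field_derivative \<Phi> s) (at s)"
  shows "integrable lborel (\<lambda>t. \<Phi> (Complex a t))"
    and "(\<lambda>n. - \<i> * (P (Complex a (real n)) - P (Complex a (- real n)))) \<longlonglongrightarrow> (\<integral>t. \<Phi> (Complex a t) \<partial>lborel)"
proof -
  have cont: "continuous_on UNIV (\<lambda>t. \<Phi> (Complex a t))"
    by (rule continuous_on_compose2[OF holomorphic_on_imp_continuous_on[OF hol]])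
      (use a in \<open>auto simp: Complex_eq intro!: continuous_intros\<close>)
  have meas [measurable]: "(\<lambda>t. \<Phi> (Complex a t)) \<in> borel_measurable borel"
    using cont by (rule borel_measurable_continuous_onI)
  have dom: "integrable lborel (\<lambda>t::real. B / (1 + t\<^sup>2))"
    using integrable_mult_right[OF integrable_inverse_1_plus_square_real, of B] by simp
  show int: "integrable lborel (\<lambda>t. \<Phi> (Complex a t))"
    by (rule Bochner_Integration.integrable_bound[OF dom])
      (auto intro!: AE_I2 order_trans[OF bound] divide_right_mono)
  have ftc: "(\<integral>t. indicator {- real n..real n} t *\<^sub>R \<Phi> (Complex a t) \<partial>lborel)
      = - \<i> * (P (Complex a (real n)) - P (Complex a (- real n)))" for n
  proof -
    have "(\<integral>t. indicator {- real n..real n} t *\<^sub>R \<Phi> (Complex a t) \<partial>lborel)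
      = - \<i> * P (Complex a (real n)) - - \<i> * P (Complex a (- real n))"
    proof (rule integral_FTC_Icc)
      fix t :: real
      have "((\<lambda>t. Complex a t) has_vector_derivative \<i>) (at t)"
        unfolding Complex_eq by (auto intro!: derivative_eq_intros)
      then have "((P \<circ> (\<lambda>t. Complex a t)) has_vector_derivative \<i> * \<Phi> (Complex a t)) (at t)"
        by (rule field_vector_diff_chain_at) (use a in \<open>auto intro!: P\<close>)
      from has_vector_derivative_mult_right[OF this, of "- \<i>"]
      have "((\<lambda>t. - \<i> * P (Complex a t)) has_vector_derivative \<Phi> (Complex a t)) (at t)"
        by (simp add: o_def mult.assoc[symmetric])
      then show "((\<lambda>t. - \<i> * P (Complex a t)) has_vector_derivative \<Phi> (Complex a t))
          (at t within {- real n..real n})"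
        by (rule has_vector_derivative_at_within)
    qed (auto intro: continuous_on_subset[OF cont])
    then show ?thesis by (simp add: algebra_simps)
  qed
  show "(\<lambda>n. - \<i> * (P (Complex a (real n)) - P (Complex a (- real n)))) \<longlonglongrightarrow> (\<integral>t. \<Phi> (Complex a t) \<partial>lborel)"
    unfolding ftc[symmetric]
  proof (rule integral_dominated_convergence[OF _ _ dom])
    show "AE t in lborel. (\<lambda>n. indicator {- real n..real n} t *\<^sub>R \<Phi> (Complex a t)) \<longlonglongrightarrow> \<Phi> (Complex a t)"
    proof (intro AE_I2)
      fix t :: real
      obtain N :: nat where N: "\<bar>t\<bar> \<le> real N" using real_arch_simple by blast
      have "eventually (\<lambda>n. indicator {- real n..real n} t *\<^sub>R \<Phi> (Complex a t) = \<Phi> (Complex a t)) sequentially"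
        using eventually_ge_at_top[of N]
      proof eventually_elim
        case (elim n)
        then have "t \<in> {- real n..real n}" using N by auto
        then show ?case by simp
      qed
      then show "(\<lambda>n. indicator {- real n..real n} t *\<^sub>R \<Phi> (Complex a t)) \<longlonglongrightarrow> \<Phi> (Complex a t)"
        by (rule tendsto_eventually)
    qed
    show "AE t in lborel. norm (indicator {- real n..real n} t *\<^sub>R \<Phi> (Complex a t)) \<le> B / (1 + t\<^sup>2)" for n
    proof (intro AE_I2)
      fix t :: real
      have "norm (indicator {- real n..real n} t *\<^sub>R \<Phi> (Complex a t)) \<le> norm (\<Phi> (Complex a t))"
        by (simp add: indicator_def)
      then show "norm (indicator {- real n..real n} t *\<^sub>R \<Phi> (Complex a t)) \<le> B / (1 + t\<^sup>2)"
        using bound[of t] by linarith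
    qed
  qed auto
qed

text \<open>
  The difference of the integrals over the two segments \<open>|Im s| \<le> n\<close> equals the increments of a
  primitive along the two horizontal sides, which tend to 0 as the integrand decays.
\<close>
lemma vertical_line_integral_shift:
  fixes \<Phi> :: "complex \<Rightarrow> complex"
  assumes hol: "\<Phi> holomorphic_on {s. Re s > \<alpha>}" and ab: "\<alpha> < a" "a \<le> b"
    and bound: "\<And>s. a \<le> Re s \<Longrightarrow> Re s \<le> b \<Longrightarrow> norm (\<Phi> s) \<le> B / (1 + (Im s)\<^sup>2)"
  shows "(\<integral>t. \<Phi> (Complex a t) \<partial>lborel) = (\<integral>t. \<Phi> (Complex b t) \<partial>lborel)"
proof -
  have op: "open {s. Re s > \<alpha>}" by (rule open_halfspace_Re_gt)
  have fd: "\<Phi> field_differentiable at x" if "x \<in> interior {s. Re s > \<alpha>} - {}" for x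
    using that holomorphic_on_imp_differentiable_at[OF hol op] by (simp add: interior_open[OF op])
  obtain P where P': "\<And>s. s \<in> {s. Re s > \<alpha>} \<Longrightarrow> (P has_field_derivative \<Phi> s) (at s within {s. Re s > \<alpha>})"
    by (rule holomorphic_convex_primitive[OF convex_halfspace_Re_gt finite.emptyI
        holomorphic_on_imp_continuous_on[OF hol] fd]) (assumption, rule that)
  have P: "(P has_field_derivative \<Phi> s) (at s)" if "Re s > \<alpha>" for s
    proof -
    have s: "s \<in> {s. Re s > \<alpha>}" using that by simp
    show ?thesis using P'[OF s] unfolding at_within_open[OF s op] .
  qed
  have B: "B \<ge> 0"
  proof -
    have "0 \<le> norm (\<Phi> (Complex a 0))" by simp
    also have "\<dots> \<le> B / (1 + 0\<^sup>2)" using bound[of "Complex a 0"] ab by simp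
    finally show ?thesis by simp
  qed
  have ba: "norm (\<Phi> (Complex a t)) \<le> B / (1 + t\<^sup>2)" for t using bound[of "Complex a t"] ab by simp
  have bb: "norm (\<Phi> (Complex b t)) \<le> B / (1 + t\<^sup>2)" for t using bound[of "Complex b t"] ab by simp
  have ab': "\<alpha> < b" using ab by simp
  note la = vertical_line_integral(2)[OF hol ab(1) ba P]
  note lb = vertical_line_integral(2)[OF hol ab' bb P]
  have diff: "norm (P (Complex b t) - P (Complex a t)) \<le> B / (1 + t\<^sup>2) * (b - a)" for t
  proof -
    have "norm (P (Complex b t) - P (Complex a t)) \<le> B / (1 + t\<^sup>2) * norm (Complex b t - Complex a t)"
    proof (rule field_differentiable_bound[where f = P and f' = \<Phi> and S = "closed_segment (Complex a t) (Complex b t)"])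
      show "convex (closed_segment (Complex a t) (Complex b t))" by simp
      have seg: "closed_segment (Complex a t) (Complex b t) = {z. Im z = t \<and> a \<le> Re z \<and> Re z \<le> b}"
        using closed_segment_same_Im[of "Complex a t" "Complex b t"] ab
        by (simp add: closed_segment_eq_real_ivl)
      fix z assume "z \<in> closed_segment (Complex a t) (Complex b t)"
      then have z: "Im z = t" "a \<le> Re z" "Re z \<le> b" unfolding seg by auto
      show "(P has_field_derivative \<Phi> z) (at z within closed_segment (Complex a t) (Complex b t))"
        using z ab by (intro has_field_derivative_at_within[OF P]) auto
      show "norm (\<Phi> z) \<le> B / (1 + t\<^sup>2)" using bound[of z] z by simp
    qed simp_all
    also have "norm (Complex b t - Complex a t) = b - a"
      using ab by (simp add: cmod_def)
    finally show ?thesis .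
  qed
  have lim0: "(\<lambda>n. B / (1 + (real n)\<^sup>2) * (b - a) + B / (1 + (- real n)\<^sup>2) * (b - a)) \<longlonglongrightarrow> 0"
    by real_asymp
  have "(\<lambda>n. - \<i> * (P (Complex b (real n)) - P (Complex b (- real n)))
      - - \<i> * (P (Complex a (real n)) - P (Complex a (- real n)))) \<longlonglongrightarrow> 0"
  proof (rule Lim_null_comparison[OF always_eventually lim0], intro allI)
    fix n
    have "- \<i> * (P (Complex b (real n)) - P (Complex b (- real n)))
      - - \<i> * (P (Complex a (real n)) - P (Complex a (- real n)))
      = - \<i> * ((P (Complex b (real n)) - P (Complex a (real n)))
           - (P (Complex b (- real n)) - P (Complex a (- real n))))"
      by (simp add: algebra_simps)
    also have "norm \<dots> = norm ((P (Complex b (real n)) - P (Complex a (real n)))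
           - (P (Complex b (- real n)) - P (Complex a (- real n))))"
      unfolding norm_mult by simp
    also have "\<dots> \<le> norm (P (Complex b (real n)) - P (Complex a (real n)))
           + norm (P (Complex b (- real n)) - P (Complex a (- real n)))"
      by (rule norm_triangle_ineq4)
    also have "\<dots> \<le> B / (1 + (real n)\<^sup>2) * (b - a) + B / (1 + (- real n)\<^sup>2) * (b - a)"
      by (intro add_mono diff)
    finally show "norm (- \<i> * (P (Complex b (real n)) - P (Complex b (- real n)))
      - - \<i> * (P (Complex a (real n)) - P (Complex a (- real n))))
      \<le> B / (1 + (real n)\<^sup>2) * (b - a) + B / (1 + (- real n)\<^sup>2) * (b - a)" .
  qed
  moreover have "(\<lambda>n. - \<i> * (P (Complex b (real n)) - P (Complex b (- real n)))
      - - \<i> * (P (Complex a (real n)) - P (Complex a (- real n))))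
    \<longlonglongrightarrow> (\<integral>t. \<Phi> (Complex b t) \<partial>lborel) - (\<integral>t. \<Phi> (Complex a t) \<partial>lborel)"
    by (intro tendsto_diff la lb)
  ultimately have "(\<integral>t. \<Phi> (Complex b t) \<partial>lborel) - (\<integral>t. \<Phi> (Complex a t) \<partial>lborel) = 0"
    by (rule LIMSEQ_unique[rotated])
  then show ?thesis by simp
qed

section \<open>Gaussian Fourier analysis\<close>

lemma std_normal_fourier:
  "integrable lborel (\<lambda>x. complex_of_real (std_normal_density x) * cis (s * x))"
  "(\<integral>x. complex_of_real (std_normal_density x) * cis (s * x) \<partial>lborel) = of_real (exp (- s\<^sup>2 / 2))"
proof -
  have [measurable]: "(\<lambda>x. cis (s * x)) \<in> borel_measurable borel"
    by (intro borel_measurable_continuous_onI continuous_intros)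
  show "integrable lborel (\<lambda>x. complex_of_real (std_normal_density x) * cis (s * x))"
  proof (rule Bochner_Integration.integrable_bound)
    show "integrable lborel std_normal_density" by simp
  qed (auto simp: norm_mult)
  have "of_real (exp (- s\<^sup>2 / 2)) = char std_normal_distribution s"
    by (simp add: char_std_normal_distribution)
  also have "\<dots> = (\<integral>x. std_normal_density x *\<^sub>R cis (s * x) \<partial>lborel)"
    unfolding char_def cis_conv_exp[symmetric] by (subst integral_density) auto
  finally show "(\<integral>x. complex_of_real (std_normal_density x) * cis (s * x) \<partial>lborel) = of_real (exp (- s\<^sup>2 / 2))"
    by (simp add: scaleR_conv_of_real)
qed

text \<open>
  The Fourier transform of a Gaussian, from the characteristic function of the normal
  distribution.
\<close>
lemma gauss_fourier:
  assumes \<tau>: "\<tau> > 0"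
  shows "integrable lborel (\<lambda>t. complex_of_real (exp (- (\<tau> * t)\<^sup>2 / 2)) * cis (t * w))"
    and "(\<integral>t. complex_of_real (exp (- (\<tau> * t)\<^sup>2 / 2)) * cis (t * w) \<partial>lborel)
      = of_real (2 * pi / \<tau> * std_normal_density (w / \<tau>))"
proof -
  have eq: "complex_of_real (exp (- (\<tau> * t)\<^sup>2 / 2)) * cis (t * w)
      = of_real (sqrt (2 * pi)) * (complex_of_real (std_normal_density (0 + \<tau> * t)) * cis (w / \<tau> * (0 + \<tau> * t)))" for t
    using \<tau> by (simp add: std_normal_density_def mult.commute flip: of_real_mult)
  show "integrable lborel (\<lambda>t. complex_of_real (exp (- (\<tau> * t)\<^sup>2 / 2)) * cis (t * w))"
    unfolding eq using \<tau> std_normal_fourier(1)[of "w / \<tau>"]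
    by (intro integrable_mult_right lborel_integrable_real_affine) auto
  have "(\<integral>t. complex_of_real (exp (- (\<tau> * t)\<^sup>2 / 2)) * cis (t * w) \<partial>lborel)
     = of_real (sqrt (2 * pi)) * (\<integral>t. (complex_of_real (std_normal_density (0 + \<tau> * t)) * cis (w / \<tau> * (0 + \<tau> * t))) \<partial>lborel)"
    unfolding eq by (rule integral_mult_right_zero)
  also have "(\<integral>t. (complex_of_real (std_normal_density (0 + \<tau> * t)) * cis (w / \<tau> * (0 + \<tau> * t))) \<partial>lborel)
      = of_real (exp (- (w / \<tau>)\<^sup>2 / 2)) / of_real \<tau>"
    using lborel_integral_real_affine[of \<tau> "\<lambda>x. complex_of_real (std_normal_density x) * cis (w / \<tau> * x)" 0] \<tau>
      std_normal_fourier(2)[of "w / \<tau>"]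
    by (simp add: scaleR_conv_of_real field_simps)
  moreover have pi2: "2 * pi * x / (\<tau> * sqrt (2 * pi)) = sqrt (2 * pi) * x / \<tau>" for x
  proof -
    have "2 * pi * x / (\<tau> * sqrt (2 * pi)) = 2 * pi / sqrt (2 * pi) * x / \<tau>" by simp
    then show ?thesis by (simp only: real_div_sqrt[of "2 * pi"] mult_nonneg_nonneg pi_ge_zero zero_le_numeral)
  qed
  ultimately show "(\<integral>t. complex_of_real (exp (- (\<tau> * t)\<^sup>2 / 2)) * cis (t * w) \<partial>lborel)
      = of_real (2 * pi / \<tau> * std_normal_density (w / \<tau>))"
    using pi2 by (simp add: std_normal_density_def flip: of_real_mult of_real_divide)
qed

lemma (in pair_sigma_finite) integrable_prod_bounded:
  fixes f :: "'a \<Rightarrow> complex" and g :: "'b \<Rightarrow> complex"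
  assumes f: "integrable M1 f" and g: "integrable M2 g"
    and k [measurable]: "case_prod k \<in> borel_measurable (M1 \<Otimes>\<^sub>M M2)"
    and bound: "\<And>x y. norm (k x y) \<le> 1"
  shows "integrable (M1 \<Otimes>\<^sub>M M2) (\<lambda>(x, y). f x * g y * (k x y :: complex))"
proof (rule Fubini_integrable)
  have [measurable]: "f \<in> borel_measurable M1" "g \<in> borel_measurable M2" using f g by auto
  show meas: "(\<lambda>(x, y). f x * g y * k x y) \<in> borel_measurable (M1 \<Otimes>\<^sub>M M2)" by measurable
  have km: "k x \<in> borel_measurable M2" if "x \<in> space M1" for x
    using measurable_Pair2[OF k that] by simp
  have le: "norm (f x * g y * k x y) \<le> norm (f x * g y)" for x y
    using bound[of x y] unfolding norm_mult by (simp add: mult_left_le)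
  have int: "integrable M2 (\<lambda>y. f x * g y * k x y)" if "x \<in> space M1" for x
    using km[OF that] by (intro Bochner_Integration.integrable_bound[OF integrable_mult_right[OF g, of "f x"]])
      (auto intro!: le)
  then show "AE x in M1. integrable M2 (\<lambda>y. case (x, y) of (x, y) \<Rightarrow> f x * g y * k x y)"
    by (intro AE_I2) simp
  show "integrable M1 (\<lambda>x. \<integral>y. norm (case (x, y) of (x, y) \<Rightarrow> f x * g y * k x y) \<partial>M2)"
  proof (rule Bochner_Integration.integrable_bound[of _ "\<lambda>x. norm (f x) * (\<integral>y. norm (g y) \<partial>M2)"])
    show "integrable M1 (\<lambda>x. norm (f x) * (\<integral>y. norm (g y) \<partial>M2))"
      using f by (intro integrable_mult_left integrable_norm)
    show "(\<lambda>x. \<integral>y. norm (case (x, y) of (x, y) \<Rightarrow> f x * g y * k x y) \<partial>M2) \<in> borel_measurable M1"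
      using meas by (intro M2.borel_measurable_lebesgue_integral) (simp add: split_beta')
    show "AE x in M1. norm (\<integral>y. norm (case (x, y) of (x, y) \<Rightarrow> f x * g y * k x y) \<partial>M2)
        \<le> norm (norm (f x) * (\<integral>y. norm (g y) \<partial>M2))"
    proof (rule AE_I2)
      fix x assume x: "x \<in> space M1"
      have "(\<integral>y. norm (f x * g y * k x y) \<partial>M2) \<le> (\<integral>y. norm (f x * g y) \<partial>M2)"
        using int[OF x] g le by (intro integral_mono integrable_norm integrable_mult_right) auto
      also have "\<dots> = norm (f x) * (\<integral>y. norm (g y) \<partial>M2)" by (simp add: norm_mult)
      finally show "norm (\<integral>y. norm (case (x, y) of (x, y) \<Rightarrow> f x * g y * k x y) \<partial>M2)
        \<le> norm (norm (f x) * (\<integral>y. norm (g y) \<partial>M2))" by simp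
    qed
  qed
qed

lemma borel_measurable_cis [measurable]: "cis \<in> borel_measurable borel"
  by (intro borel_measurable_continuous_onI continuous_intros)

lemma borel_measurable_cnj [measurable]: "cnj \<in> borel_measurable borel"
  by (intro borel_measurable_continuous_onI continuous_intros)

lemma borel_measurable_fourier:
  fixes H :: "real \<Rightarrow> complex"
  assumes [measurable]: "H \<in> borel_measurable borel"
  shows "(\<lambda>u. \<integral>t. H t * cis (t * u) \<partial>lborel) \<in> borel_measurable borel"
  using lborel.borel_measurable_lebesgue_integral[of "\<lambda>u t. H t * cis (t * u)" lborel] by simp

lemma nn_integral_std_normal_density:
  "(\<integral>\<^sup>+x. ennreal (std_normal_density x) \<partial>lborel) = 1"
proof -
  interpret prob_space std_normal_distribution by (rule prob_space_normal_density) simp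
  show ?thesis using emeasure_space_1 by (simp add: emeasure_density)
qed

lemma nn_integral_std_normal_density_shift:
  "(\<integral>\<^sup>+x. ennreal (std_normal_density (t - x)) \<partial>lborel) = 1"
  using nn_integral_real_affine[of "\<lambda>x. ennreal (std_normal_density x)" "-1" t]
  by (simp add: nn_integral_std_normal_density)

lemma std_normal_density_minus: "std_normal_density (x - y) = std_normal_density (y - x)"
  by (simp add: std_normal_density_def power2_commute)

text \<open>
  A convolution form with a kernel of mass 1 is bounded by the \<open>L\<^sup>2\<close> norm: by the inequality of
  the means it is at most the average of two integrals, in each of which the kernel integrates to 1.
\<close>
lemma std_normal_convolution_form_le:
  fixes h :: "real \<Rightarrow> real"
  assumes [measurable]: "h \<in> borel_measurable borel" and h: "\<And>t. h t \<ge> 0"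
  shows "(\<integral>\<^sup>+t. \<integral>\<^sup>+t'. ennreal (h t * h t' * std_normal_density (t - t')) \<partial>lborel \<partial>lborel)
      \<le> (\<integral>\<^sup>+t. ennreal ((h t)\<^sup>2) \<partial>lborel)"
proof -
  let ?K = "\<lambda>t t'. ennreal (std_normal_density (t - t'))"
  let ?I = "\<integral>\<^sup>+t. ennreal ((h t)\<^sup>2) \<partial>lborel"
  have 1: "(\<integral>\<^sup>+t. \<integral>\<^sup>+t'. ennreal ((h t)\<^sup>2 / 2) * ?K t t' \<partial>lborel \<partial>lborel) = (\<integral>\<^sup>+t. ennreal ((h t)\<^sup>2 / 2) \<partial>lborel)"
    by (simp add: nn_integral_cmult nn_integral_std_normal_density_shift)
  have 2: "(\<integral>\<^sup>+t. \<integral>\<^sup>+t'. ennreal ((h t')\<^sup>2 / 2) * ?K t t' \<partial>lborel \<partial>lborel) = (\<integral>\<^sup>+t. ennreal ((h t)\<^sup>2 / 2) \<partial>lborel)"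
  proof -
    have "(\<integral>\<^sup>+t. \<integral>\<^sup>+t'. ennreal ((h t')\<^sup>2 / 2) * ?K t t' \<partial>lborel \<partial>lborel)
        = (\<integral>\<^sup>+t'. \<integral>\<^sup>+t. ennreal ((h t')\<^sup>2 / 2) * ?K t t' \<partial>lborel \<partial>lborel)"
      by (rule lborel_pair.Fubini') measurable
    also have "\<dots> = (\<integral>\<^sup>+t'. \<integral>\<^sup>+t. ennreal ((h t')\<^sup>2 / 2) * ?K t' t \<partial>lborel \<partial>lborel)"
      by (subst std_normal_density_minus) (rule refl)
    finally show ?thesis unfolding 1 .
  qed
  have "(\<integral>\<^sup>+t. \<integral>\<^sup>+t'. ennreal (h t * h t' * std_normal_density (t - t')) \<partial>lborel \<partial>lborel)
     \<le> (\<integral>\<^sup>+t. \<integral>\<^sup>+t'. ennreal ((h t)\<^sup>2 / 2) * ?K t t' + ennreal ((h t')\<^sup>2 / 2) * ?K t t' \<partial>lborel \<partial>lborel)"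
  proof (intro nn_integral_mono)
    fix t t' :: real
    have "h t * h t' \<le> (h t)\<^sup>2 / 2 + (h t')\<^sup>2 / 2"
      using sum_squares_bound[of "h t" "h t'"] by simp
    then have "h t * h t' * std_normal_density (t - t') \<le> ((h t)\<^sup>2 / 2 + (h t')\<^sup>2 / 2) * std_normal_density (t - t')"
      by (intro mult_right_mono) auto
    also have "ennreal \<dots> = ennreal ((h t)\<^sup>2 / 2) * ?K t t' + ennreal ((h t')\<^sup>2 / 2) * ?K t t'"
      by (subst distrib_right, subst ennreal_plus) (auto simp: ennreal_mult simp del: times_divide_eq_left)
    finally show "ennreal (h t * h t' * std_normal_density (t - t')) \<le> ennreal ((h t)\<^sup>2 / 2) * ?K t t' + ennreal ((h t')\<^sup>2 / 2) * ?K t t'"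
      by (simp add: ennreal_leI)
  qed
  also have "\<dots> = (\<integral>\<^sup>+t. ennreal ((h t)\<^sup>2 / 2) \<partial>lborel) + (\<integral>\<^sup>+t. ennreal ((h t)\<^sup>2 / 2) \<partial>lborel)"
    unfolding 1[symmetric] by (subst (2) 1, subst 2[symmetric]) (simp add: nn_integral_add)
  also have "\<dots> = (\<integral>\<^sup>+t. ennreal ((h t)\<^sup>2 / 2) + ennreal ((h t)\<^sup>2 / 2) \<partial>lborel)"
    by (simp add: nn_integral_add)
  also have "\<dots> = ?I" by (simp flip: ennreal_plus)
  finally show ?thesis .
qed

text \<open>
  Plancherel's inequality against a Gaussian weight. Opening the square and
  integrating over \<open>u\<close> first replaces the weight by its own Fourier transform, again a Gaussian, so
  the left side becomes a convolution form in \<open>H\<close>.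
\<close>
lemma fourier_L2_gauss:
  fixes H :: "real \<Rightarrow> complex"
  assumes H: "integrable lborel H"
  defines "G \<equiv> (\<lambda>u. \<integral>t. H t * cis (t * u) \<partial>lborel)"
  shows "(\<integral>\<^sup>+u. ennreal (std_normal_density u * (norm (G u))\<^sup>2) \<partial>lborel)
     \<le> ennreal (sqrt (2 * pi)) * (\<integral>\<^sup>+t. ennreal ((norm (H t))\<^sup>2) \<partial>lborel)"
proof -
  have [measurable]: "H \<in> borel_measurable borel" using H by auto
  have cm: "(\<lambda>(t, u). cis (t * u)) \<in> borel_measurable (lborel \<Otimes>\<^sub>M lborel)"
    by measurable
  have cm3: "(\<lambda>(u, t'). cis ((t - t') * u)) \<in> borel_measurable (lborel \<Otimes>\<^sub>M lborel)" for t
    by measurable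
  have [measurable]: "G \<in> borel_measurable borel"
    unfolding G_def by (rule borel_measurable_fourier) measurable
  define A where "A = (\<integral>t. norm (H t) \<partial>lborel)"
  have GA: "norm (G u) \<le> A" for u
    unfolding G_def A_def
    by (rule order_trans[OF integral_norm_bound]) (simp add: norm_mult)
  define g where "g u = complex_of_real (std_normal_density u) * cnj (G u)" for u
  have gint: "integrable lborel g"
  proof (rule Bochner_Integration.integrable_bound)
    show "integrable lborel (\<lambda>u. A * std_normal_density u)" by simp
    show "g \<in> borel_measurable lborel" unfolding g_def by measurable
    show "AE u in lborel. norm (g u) \<le> norm (A * std_normal_density u)"
    proof (intro AE_I2)
      fix u
      have "norm (g u) = norm (G u) * std_normal_density u" by (simp add: g_def norm_mult)
      also have "\<dots> \<le> A * std_normal_density u" by (intro mult_right_mono GA) auto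
      finally show "norm (g u) \<le> norm (A * std_normal_density u)" by simp
    qed
  qed
  define q where "q t = (\<integral>u. g u * cis (t * u) \<partial>lborel)" for t
  have q: "q t = (\<integral>t'. cnj (H t') * of_real (exp (- (t - t')\<^sup>2 / 2)) \<partial>lborel)" for t
  proof -
    have "q t = (\<integral>u. (\<integral>t'. complex_of_real (std_normal_density u) * cnj (H t') * cis ((t - t') * u) \<partial>lborel) \<partial>lborel)"
    proof -
      have "g u * cis (t * u) = (\<integral>t'. complex_of_real (std_normal_density u) * cnj (H t') * cis ((t - t') * u) \<partial>lborel)" for u
      proof -
        have "cnj (G u) = (\<integral>t'. cnj (H t' * cis (t' * u)) \<partial>lborel)"
          unfolding G_def by (simp only: Bochner_Integration.integral_cnj)
        then have "g u * cis (t * u) = complex_of_real (std_normal_density u) * (\<integral>t'. cnj (H t' * cis (t' * u)) \<partial>lborel) * cis (t * u)"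
          by (simp add: g_def)
        also have "\<dots> = (\<integral>t'. complex_of_real (std_normal_density u) * cnj (H t' * cis (t' * u)) * cis (t * u) \<partial>lborel)"
          by simp
        also have "\<dots> = (\<integral>t'. complex_of_real (std_normal_density u) * cnj (H t') * cis ((t - t') * u) \<partial>lborel)"
          by (intro Bochner_Integration.integral_cong refl) (simp add: cis_cnj cis_mult left_diff_distrib)
        finally show ?thesis .
      qed
      then show ?thesis by (simp add: q_def)
    qed
    also have "\<dots> = (\<integral>t'. (\<integral>u. complex_of_real (std_normal_density u) * cnj (H t') * cis ((t - t') * u) \<partial>lborel) \<partial>lborel)"
      by (rule lborel_pair.Fubini_integral[symmetric], rule lborel_pair.integrable_prod_bounded)
        (use H cm3 in auto)
    also have "\<dots> = (\<integral>t'. cnj (H t') * of_real (exp (- (t - t')\<^sup>2 / 2)) \<partial>lborel)"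
    proof (intro Bochner_Integration.integral_cong refl)
      fix t'
      have "(\<integral>u. complex_of_real (std_normal_density u) * cnj (H t') * cis ((t - t') * u) \<partial>lborel)
         = (\<integral>u. cnj (H t') * (complex_of_real (std_normal_density u) * cis ((t - t') * u)) \<partial>lborel)"
        by (simp add: mult_ac)
      also have "\<dots> = cnj (H t') * of_real (exp (- (t - t')\<^sup>2 / 2))"
        by (simp only: integral_mult_right_zero std_normal_fourier)
      finally show "(\<integral>u. complex_of_real (std_normal_density u) * cnj (H t') * cis ((t - t') * u) \<partial>lborel)
         = cnj (H t') * of_real (exp (- (t - t')\<^sup>2 / 2))" .
    qed
    finally show ?thesis .
  qed
  have nq: "ennreal (norm (q t)) \<le> (\<integral>\<^sup>+t'. ennreal (sqrt (2 * pi) * (norm (H t') * std_normal_density (t - t'))) \<partial>lborel)" for t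
  proof -
    have "integrable lborel (\<lambda>t'. cnj (H t') * complex_of_real (exp (- (t - t')\<^sup>2 / 2)))"
      using H by (intro Bochner_Integration.integrable_bound[of _ H "\<lambda>t'. cnj (H t') * complex_of_real (exp (- (t - t')\<^sup>2 / 2))"])
        (auto simp: norm_mult mult_left_le)
    then have "ennreal (norm (q t)) \<le> (\<integral>\<^sup>+t'. ennreal (norm (cnj (H t') * complex_of_real (exp (- (t - t')\<^sup>2 / 2)))) \<partial>lborel)"
      unfolding q by (rule integral_norm_bound_ennreal)
    also have "\<dots> = (\<integral>\<^sup>+t'. ennreal (sqrt (2 * pi) * (norm (H t') * std_normal_density (t - t'))) \<partial>lborel)"
      by (intro nn_integral_cong) (simp add: norm_mult std_normal_density_def)
    finally show ?thesis .
  qed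
  define S where "S = (\<integral>u. std_normal_density u * (norm (G u))\<^sup>2 \<partial>lborel)"
  have Sint: "integrable lborel (\<lambda>u. std_normal_density u * (norm (G u))\<^sup>2)"
  proof (rule Bochner_Integration.integrable_bound[of _ "\<lambda>u. std_normal_density u * A\<^sup>2"])
    show "integrable lborel (\<lambda>u. std_normal_density u * A\<^sup>2)" by simp
    show "AE u in lborel. norm (std_normal_density u * (norm (G u))\<^sup>2) \<le> norm (std_normal_density u * A\<^sup>2)"
      using GA by (intro AE_I2) (auto simp: abs_mult intro!: mult_left_mono power_mono)
  qed auto
  have "complex_of_real S = (\<integral>u. complex_of_real (std_normal_density u * (norm (G u))\<^sup>2) \<partial>lborel)"
    unfolding S_def using Sint by (simp only: integral_of_real)
  also have "\<dots> = (\<integral>u. (\<integral>t. H t * g u * cis (t * u) \<partial>lborel) \<partial>lborel)"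
  proof (intro Bochner_Integration.integral_cong refl)
    fix u
    have "complex_of_real (std_normal_density u * (norm (G u))\<^sup>2) = g u * G u"
      using complex_norm_square[of "G u"] by (simp add: g_def mult_ac)
    also have "\<dots> = (\<integral>t. g u * (H t * cis (t * u)) \<partial>lborel)" unfolding G_def by simp
    finally show "complex_of_real (std_normal_density u * (norm (G u))\<^sup>2) = (\<integral>t. H t * g u * cis (t * u) \<partial>lborel)"
      by (simp add: mult_ac)
  qed
  also have "\<dots> = (\<integral>t. (\<integral>u. H t * g u * cis (t * u) \<partial>lborel) \<partial>lborel)"
    by (rule lborel_pair.Fubini_integral, rule lborel_pair.integrable_prod_bounded) (use H gint cm in auto)
  also have "\<dots> = (\<integral>t. H t * q t \<partial>lborel)"
    by (simp add: q_def mult.assoc)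
  finally have S_eq: "complex_of_real S = (\<integral>t. H t * q t \<partial>lborel)" .
  have Hq: "integrable lborel (\<lambda>t. H t * q t)"
  proof -
    have "integrable lborel (\<lambda>t. \<integral>u. H t * g u * cis (t * u) \<partial>lborel)"
      by (rule lborel_pair.integrable_fst, rule lborel_pair.integrable_prod_bounded) (use H gint cm in auto)
    then show ?thesis by (simp add: q_def mult.assoc)
  qed
  have S0: "S \<ge> 0" unfolding S_def by (intro integral_nonneg_AE AE_I2) auto
  have "(\<integral>\<^sup>+u. ennreal (std_normal_density u * (norm (G u))\<^sup>2) \<partial>lborel) = ennreal S"
    unfolding S_def by (rule nn_integral_eq_integral[OF Sint]) auto
  also have "\<dots> = ennreal (norm (complex_of_real S))" using S0 by simp
  also have "\<dots> \<le> (\<integral>\<^sup>+t. ennreal (norm (H t * q t)) \<partial>lborel)"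
    unfolding S_eq by (rule integral_norm_bound_ennreal[OF Hq])
  also have "\<dots> \<le> (\<integral>\<^sup>+t. \<integral>\<^sup>+t'. ennreal (sqrt (2 * pi)) * ennreal (norm (H t) * norm (H t') * std_normal_density (t - t')) \<partial>lborel \<partial>lborel)"
  proof (intro nn_integral_mono)
    fix t
    have "ennreal (norm (H t * q t)) = ennreal (norm (H t)) * ennreal (norm (q t))"
      by (simp add: norm_mult ennreal_mult')
    also have "\<dots> \<le> ennreal (norm (H t)) * (\<integral>\<^sup>+t'. ennreal (sqrt (2 * pi) * (norm (H t') * std_normal_density (t - t'))) \<partial>lborel)"
      by (intro mult_left_mono nq) auto
    also have "\<dots> = (\<integral>\<^sup>+t'. ennreal (norm (H t)) * ennreal (sqrt (2 * pi) * (norm (H t') * std_normal_density (t - t'))) \<partial>lborel)"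
      by (rule nn_integral_cmult[symmetric]) simp
    also have "\<dots> = (\<integral>\<^sup>+t'. ennreal (sqrt (2 * pi)) * ennreal (norm (H t) * norm (H t') * std_normal_density (t - t')) \<partial>lborel)"
      by (intro nn_integral_cong) (simp add: ennreal_mult'[symmetric] mult_ac)
    finally show "ennreal (norm (H t * q t)) \<le> (\<integral>\<^sup>+t'. ennreal (sqrt (2 * pi)) * ennreal (norm (H t) * norm (H t') * std_normal_density (t - t')) \<partial>lborel)" .
  qed
  also have "\<dots> = ennreal (sqrt (2 * pi)) * (\<integral>\<^sup>+t. \<integral>\<^sup>+t'. ennreal (norm (H t) * norm (H t') * std_normal_density (t - t')) \<partial>lborel \<partial>lborel)"
    by (simp add: nn_integral_cmult)
  also have "\<dots> \<le> ennreal (sqrt (2 * pi)) * (\<integral>\<^sup>+t. ennreal ((norm (H t))\<^sup>2) \<partial>lborel)"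
    by (intro mult_left_mono std_normal_convolution_form_le) auto
  finally show ?thesis .
qed

text \<open>
  On the unit interval the Gaussian weight is bounded below; a translation by \<open>U\<close> only
  multiplies \<open>H\<close> by a factor of modulus 1, so the constant does not depend on \<open>U\<close>.
\<close>
lemma fourier_L2_unit_interval:
  fixes H :: "real \<Rightarrow> complex"
  assumes H: "integrable lborel H"
  shows "(\<integral>\<^sup>+u. ennreal ((norm (\<integral>t. H t * cis (t * u) \<partial>lborel))\<^sup>2) * indicator {U..U+1} u \<partial>lborel)
     \<le> ennreal (2 * pi * exp (1/2)) * (\<integral>\<^sup>+t. ennreal ((norm (H t))\<^sup>2) \<partial>lborel)"
proof -
  have [measurable]: "H \<in> borel_measurable borel" using H by auto
  define G where "G u = (\<integral>t. H t * cis (t * u) \<partial>lborel)" for u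
  have [measurable]: "G \<in> borel_measurable borel"
    unfolding G_def by (rule borel_measurable_fourier) measurable
  define H' where "H' t = H t * cis (t * U)" for t
  have cU [measurable]: "(\<lambda>t. cis (t * U)) \<in> borel_measurable borel"
    by (intro borel_measurable_continuous_onI continuous_intros)
  have [measurable]: "H' \<in> borel_measurable borel" unfolding H'_def by measurable
  have H': "integrable lborel H'"
    by (rule Bochner_Integration.integrable_bound[OF H]) (auto simp: H'_def norm_mult)
  have G': "(\<integral>t. H' t * cis (t * u) \<partial>lborel) = G (U + u)" for u
    unfolding G_def H'_def
    by (intro Bochner_Integration.integral_cong refl) (simp add: cis_mult distrib_left mult.assoc)
  have dens: "1 \<le> sqrt (2 * pi) * exp (1/2) * std_normal_density u" if "u \<in> {0..1}" for u
  proof -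
    have "u\<^sup>2 \<le> 1" using that by (simp add: power_le_one)
    then have "exp 0 \<le> exp (1/2 - u\<^sup>2 / 2)" by (intro iffD2[OF exp_le_cancel_iff]) simp
    then show ?thesis by (simp add: std_normal_density_def exp_diff exp_minus field_simps)
  qed
  have "(\<integral>\<^sup>+u. ennreal ((norm (G u))\<^sup>2) * indicator {U..U+1} u \<partial>lborel)
     = (\<integral>\<^sup>+u. ennreal ((norm (G (U + u)))\<^sup>2) * indicator {U..U+1} (U + u) \<partial>lborel)"
    by (subst nn_integral_real_affine[where c = 1 and t = U]) auto
  also have "\<dots> \<le> (\<integral>\<^sup>+u. ennreal (sqrt (2 * pi) * exp (1/2)) * ennreal (std_normal_density u * (norm (G (U + u)))\<^sup>2) \<partial>lborel)"
  proof (intro nn_integral_mono)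
    fix u
    show "ennreal ((norm (G (U + u)))\<^sup>2) * indicator {U..U+1} (U + u)
      \<le> ennreal (sqrt (2 * pi) * exp (1/2)) * ennreal (std_normal_density u * (norm (G (U + u)))\<^sup>2)"
    proof (cases "u \<in> {0..1}")
      case True
      have "1 * (norm (G (U + u)))\<^sup>2 \<le> sqrt (2 * pi) * exp (1/2) * std_normal_density u * (norm (G (U + u)))\<^sup>2"
        by (intro mult_right_mono dens True) auto
      then show ?thesis using True by (simp add: ennreal_mult'[symmetric] mult_ac ennreal_leI)
    qed (auto simp: indicator_def)
  qed
  also have "\<dots> = ennreal (sqrt (2 * pi) * exp (1/2)) * (\<integral>\<^sup>+u. ennreal (std_normal_density u * (norm (G (U + u)))\<^sup>2) \<partial>lborel)"
    by (rule nn_integral_cmult) simp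
  also have "\<dots> \<le> ennreal (sqrt (2 * pi) * exp (1/2)) * (ennreal (sqrt (2 * pi)) * (\<integral>\<^sup>+t. ennreal ((norm (H' t))\<^sup>2) \<partial>lborel))"
    using fourier_L2_gauss[OF H'] unfolding G' by (intro mult_left_mono) auto
  also have "\<dots> = ennreal (2 * pi * exp (1/2)) * (\<integral>\<^sup>+t. ennreal ((norm (H t))\<^sup>2) \<partial>lborel)"
  proof -
    have "sqrt (2 * pi) * exp (1/2) * sqrt (2 * pi) = (sqrt (2 * pi) * sqrt (2 * pi)) * exp (1/2)"
      by (simp only: mult_ac)
    also have "sqrt (2 * pi) * sqrt (2 * pi) = 2 * pi" unfolding real_sqrt_mult_self by simp
    finally have "ennreal (sqrt (2 * pi) * exp (1/2)) * ennreal (sqrt (2 * pi)) = ennreal (2 * pi * exp (1/2))"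
      by (subst ennreal_mult[symmetric]) auto
    moreover have "norm (H' t) = norm (H t)" for t by (simp add: H'_def norm_mult)
    ultimately show ?thesis by (simp only: mult.assoc[symmetric])
  qed
  finally show ?thesis unfolding G_def .
qed

text \<open>
  Fourier inversion with a Gaussian summation factor. It recovers the average of \<open>f\<close>
  over a normal distribution of standard deviation \<open>\<tau>\<close> around \<open>u\<close>.
\<close>
lemma gauss_summation:
  fixes f :: "real \<Rightarrow> complex"
  assumes f: "integrable lborel f" and \<tau>: "\<tau> > 0"
  shows "(\<integral>t. (\<integral>v. f v * cis (- (t * v)) \<partial>lborel) * of_real (exp (- (\<tau> * t)\<^sup>2 / 2)) * cis (t * u) \<partial>lborel)
     = 2 * of_real pi * (\<integral>z. of_real (std_normal_density z) * f (u + \<tau> * z) \<partial>lborel)"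
proof -
  let ?g = "\<lambda>t. complex_of_real (exp (- (\<tau> * t)\<^sup>2 / 2))"
  have g: "integrable lborel ?g" using gauss_fourier(1)[OF \<tau>, of 0] by simp
  have cm: "(\<lambda>(v, t). cis (t * (u - v))) \<in> borel_measurable (lborel \<Otimes>\<^sub>M lborel)"
    by measurable
  have "(\<integral>t. (\<integral>v. f v * cis (- (t * v)) \<partial>lborel) * ?g t * cis (t * u) \<partial>lborel)
     = (\<integral>t. (\<integral>v. f v * ?g t * cis (t * (u - v)) \<partial>lborel) \<partial>lborel)"
  proof (intro Bochner_Integration.integral_cong refl)
    fix t
    have "(\<integral>v. f v * cis (- (t * v)) \<partial>lborel) * ?g t * cis (t * u) = (\<integral>v. f v * cis (- (t * v)) * ?g t * cis (t * u) \<partial>lborel)"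
      by simp
    also have "\<dots> = (\<integral>v. f v * ?g t * cis (t * (u - v)) \<partial>lborel)"
    proof (intro Bochner_Integration.integral_cong refl)
      fix v
      have "cis (- (t * v)) * cis (t * u) = cis (t * (u - v))" by (simp add: cis_mult algebra_simps)
      from this[symmetric] show "f v * cis (- (t * v)) * ?g t * cis (t * u) = f v * ?g t * cis (t * (u - v))"
        by (simp only: mult_ac)
    qed
    finally show "(\<integral>v. f v * cis (- (t * v)) \<partial>lborel) * ?g t * cis (t * u) = (\<integral>v. f v * ?g t * cis (t * (u - v)) \<partial>lborel)" .
  qed
  also have "\<dots> = (\<integral>v. (\<integral>t. f v * ?g t * cis (t * (u - v)) \<partial>lborel) \<partial>lborel)"
    by (rule lborel_pair.Fubini_integral, rule lborel_pair.integrable_prod_bounded[OF f g cm]) simp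
  also have "\<dots> = (\<integral>v. f v * of_real (2 * pi / \<tau> * std_normal_density ((u - v) / \<tau>)) \<partial>lborel)"
    by (simp only: mult.assoc integral_mult_right_zero gauss_fourier(2)[OF \<tau>])
  also have "\<dots> = \<bar>\<tau>\<bar> *\<^sub>R (\<integral>z. f (u + \<tau> * z) * of_real (2 * pi / \<tau> * std_normal_density ((u - (u + \<tau> * z)) / \<tau>)) \<partial>lborel)"
    using \<tau> by (intro lborel_integral_real_affine) auto
  also have "\<dots> = of_real \<tau> * (\<integral>z. of_real (2 * pi / \<tau>) * (of_real (std_normal_density z) * f (u + \<tau> * z)) \<partial>lborel)"
  proof -
    have "std_normal_density ((u - (u + \<tau> * z)) / \<tau>) = std_normal_density z" for z
      using \<tau> by (simp add: std_normal_density_def)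
    then show ?thesis using \<tau> by (simp add: scaleR_conv_of_real mult_ac)
  qed
  also have "\<dots> = 2 * of_real pi * (\<integral>z. of_real (std_normal_density z) * f (u + \<tau> * z) \<partial>lborel)"
    using \<tau> by (simp only: integral_mult_right_zero) simp
  finally show ?thesis .
qed

lemma gauss_smoothing_tendsto:
  fixes f :: "real \<Rightarrow> complex"
  assumes [measurable]: "f \<in> borel_measurable borel" and B: "\<And>v. norm (f v) \<le> B"
    and cont: "isCont f u" and \<tau>: "\<tau> \<longlonglongrightarrow> 0"
  shows "(\<lambda>n. \<integral>z. of_real (std_normal_density z) * f (u + \<tau> n * z) \<partial>lborel) \<longlonglongrightarrow> f u"
proof -
  have one: "(\<integral>z. of_real (std_normal_density z) * f u \<partial>lborel) = f u"
    using std_normal_fourier(2)[of 0] by simp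
  have "(\<lambda>n. \<integral>z. of_real (std_normal_density z) * f (u + \<tau> n * z) \<partial>lborel)
     \<longlonglongrightarrow> (\<integral>z. of_real (std_normal_density z) * f u \<partial>lborel)"
  proof (rule integral_dominated_convergence)
    show "integrable lborel (\<lambda>z. std_normal_density z * B)" by simp
    show "AE z in lborel. (\<lambda>n. of_real (std_normal_density z) * f (u + \<tau> n * z)) \<longlonglongrightarrow> of_real (std_normal_density z) * f u"
    proof (intro AE_I2 tendsto_intros)
      fix z
      have "(\<lambda>n. u + \<tau> n * z) \<longlonglongrightarrow> u + 0 * z" by (intro tendsto_intros \<tau>)
      then show "(\<lambda>n. f (u + \<tau> n * z)) \<longlonglongrightarrow> f u" by (intro isCont_tendsto_compose[OF cont]) simp
    qed
    show "AE z in lborel. norm (of_real (std_normal_density z) * f (u + \<tau> n * z)) \<le> std_normal_density z * B" for n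
      using B by (intro AE_I2) (simp add: norm_mult mult_left_mono)
  qed auto
  then show ?thesis unfolding one .
qed

section \<open>Mean squares from a transform on a vertical line\<close>

text \<open>
  A Gaussian beats the linear growth of the transform; the right side has the form that
  \<open>vertical_line_integral_shift\<close> asks for.
\<close>
lemma gauss_poly_bound:
  fixes \<kappa> t :: real
  assumes \<kappa>: "\<kappa> > 0"
  shows "(\<bar>t\<bar> + 3) * exp (- \<kappa> * t\<^sup>2) \<le> 4 * (2 + 4 / \<kappa>\<^sup>2) / (1 + t\<^sup>2)"
proof -
  \<comment> \<open>In terms of \<open>y\<close>, the estimate \<open>y\<^sup>2 / 2 \<le> exp y\<close> controls the fourth power of \<open>t\<close>.\<close>
  define y where "y = \<kappa> * t\<^sup>2"
  have y: "y \<ge> 0" using \<kappa> by (simp add: y_def)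
  have "(1 + t\<^sup>2)\<^sup>2 \<le> 2 + 2 * (t\<^sup>2)\<^sup>2"
    using sum_squares_bound[of 1 "t\<^sup>2"] by (simp add: power2_eq_square algebra_simps)
  also have "\<dots> = 2 + 4 / \<kappa>\<^sup>2 * (y\<^sup>2 / 2)" using \<kappa> by (simp add: y_def power_mult_distrib)
  also have "\<dots> \<le> (2 + 4 / \<kappa>\<^sup>2) * exp y"
  proof -
    have "y\<^sup>2 / 2 \<le> exp y" using exp_lower_Taylor_quadratic[OF y] y by simp
    then have "4 / \<kappa>\<^sup>2 * (y\<^sup>2 / 2) \<le> 4 / \<kappa>\<^sup>2 * exp y" by (intro mult_left_mono) auto
    moreover have "2 * 1 \<le> 2 * exp y" using y by (intro mult_left_mono) auto
    ultimately show ?thesis unfolding distrib_right by linarith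
  qed
  finally have 1: "(1 + t\<^sup>2)\<^sup>2 \<le> (2 + 4 / \<kappa>\<^sup>2) * exp y" .
  have 2: "\<bar>t\<bar> + 3 \<le> 4 * (1 + t\<^sup>2)"
  proof -
    have "\<bar>t\<bar> \<le> 1 + t\<^sup>2" using sum_squares_bound[of 1 "\<bar>t\<bar>"] by simp
    moreover have "1 + t\<^sup>2 + 3 \<le> 4 * (1 + t\<^sup>2)" by simp
    ultimately show ?thesis by linarith
  qed
  have "(\<bar>t\<bar> + 3) * (1 + t\<^sup>2) \<le> 4 * (1 + t\<^sup>2) * (1 + t\<^sup>2)"
    by (intro mult_right_mono 2) auto
  also have "\<dots> = 4 * (1 + t\<^sup>2)\<^sup>2" by (simp add: power2_eq_square)
  also have "\<dots> \<le> 4 * ((2 + 4 / \<kappa>\<^sup>2) * exp y)" by (rule mult_left_mono[OF 1]) simp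
  finally have le: "(\<bar>t\<bar> + 3) * (1 + t\<^sup>2) \<le> 4 * ((2 + 4 / \<kappa>\<^sup>2) * exp y)" .
  have pos: "1 + t\<^sup>2 > 0" by (intro add_pos_nonneg) auto
  have "(\<bar>t\<bar> + 3) * exp (- \<kappa> * t\<^sup>2) * (1 + t\<^sup>2) = (\<bar>t\<bar> + 3) * (1 + t\<^sup>2) * exp (- y)"
    by (simp add: y_def)
  also have "\<dots> \<le> 4 * ((2 + 4 / \<kappa>\<^sup>2) * exp y) * exp (- y)" by (intro mult_right_mono le) simp
  also have "\<dots> = 4 * (2 + 4 / \<kappa>\<^sup>2)" by (simp add: mult.assoc flip: exp_add)
  finally show ?thesis unfolding pos_le_divide_eq[OF pos] .
qed

text \<open>
  Half of Plancherel's theorem on a line \<open>Re s = \<sigma>\<close> on which the integral defining the transform of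
  \<open>D\<close> need not converge. The factor \<open>exp (\<tau>\<^sup>2 / 2 * (s - 2)\<^sup>2)\<close> is entire, decays fast in
  vertical strips, and is on the line \<open>Re s = 2\<close> the Gaussian summation factor. Hence the
  Gaussian averages of \<open>D v * exp (- 2 * v)\<close> can be written as integrals over the line
  \<open>Re s = \<sigma>\<close>, where \<open>fourier_L2_unit_interval\<close> bounds their mean squares uniformly in
  \<open>\<tau>\<close>. As \<open>\<tau>\<close> tends to 0 they converge at every point of continuity of \<open>D\<close>, and Fatou's lemma
  concludes.
\<close>
lemma L2_bound_by_shifted_transform:
  fixes D :: "real \<Rightarrow> real" and Q :: "complex \<Rightarrow> complex"
  assumes D_meas [measurable]: "D \<in> borel_measurable borel"
    and D_bdd: "\<And>v. \<bar>D v * exp (- 2 * v)\<bar> \<le> B"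
    and D_int: "integrable lborel (\<lambda>v. D v * exp (- 2 * v))"
    and D_cont: "AE u in lborel. isCont D u"
    and trans: "\<And>t. (\<integral>v. of_real (D v) * exp (- Complex 2 t * of_real v) \<partial>lborel) = Q (Complex 2 t)"
    and Q_hol: "Q holomorphic_on {s. Re s > \<alpha>}" and \<sigma>: "\<alpha> < \<sigma>" "0 \<le> \<sigma>" "\<sigma> \<le> 2"
    and Q_growth: "\<And>s. \<sigma> \<le> Re s \<Longrightarrow> Re s \<le> 2 \<Longrightarrow> norm (Q s) \<le> C * (\<bar>Im s\<bar> + 3)"
  shows "(\<integral>\<^sup>+u. ennreal ((D u)\<^sup>2 * exp (- 2 * \<sigma> * u)) * indicator {U..U+1} u \<partial>lborel)
     \<le> ennreal (exp 5) * (\<integral>\<^sup>+t. ennreal ((norm (Q (Complex \<sigma> t)))\<^sup>2) \<partial>lborel)"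
proof -
  define f where "f v = complex_of_real (D v * exp (- 2 * v))" for v
  define \<tau> where "\<tau> n = 1 / (real n + 1)" for n
  have \<tau>: "\<tau> n > 0" "\<tau> n \<le> 1" for n by (auto simp: \<tau>_def)
  define g where "g n u = (\<integral>z. of_real (std_normal_density z) * f (u + \<tau> n * z) \<partial>lborel)" for n u
  define \<Phi> where "\<Phi> n u s = Q s * exp (of_real ((\<tau> n)\<^sup>2 / 2) * (s - 2)\<^sup>2) * exp (s * of_real u)" for n u s
  define H where "H n t = \<Phi> n 0 (Complex \<sigma> t)" for n t
  have f_meas [measurable]: "f \<in> borel_measurable borel" unfolding f_def by measurable
  have f_int: "integrable lborel f"
    unfolding f_def using D_int by (rule integrable_of_real)
  have f_bdd: "norm (f v) \<le> B" for v unfolding f_def norm_of_real by (rule D_bdd)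
  have C: "C \<ge> 0"
  proof -
    have "0 \<le> norm (Q (Complex 2 0))" by simp
    also have "\<dots> \<le> C * (0 + 3)" using Q_growth[of "Complex 2 0"] \<sigma> by simp
    finally show ?thesis by simp
  qed
  have \<Phi>_hol: "\<Phi> n u holomorphic_on {s. Re s > \<alpha>}" for n u
    unfolding \<Phi>_def by (intro holomorphic_intros Q_hol)
  have \<Phi>_bound: "\<exists>B'. \<forall>s. \<sigma> \<le> Re s \<longrightarrow> Re s \<le> 2 \<longrightarrow> norm (\<Phi> n u s) \<le> B' / (1 + (Im s)\<^sup>2)" for n u
  proof -
    define \<kappa> where "\<kappa> = (\<tau> n)\<^sup>2 / 2"
    have \<kappa>: "\<kappa> > 0" "\<kappa> \<le> 1" using \<tau>[of n] power_le_one[of "\<tau> n" 2] by (auto simp: \<kappa>_def)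
    define B' where "B' = C * exp 4 * exp (2 * \<bar>u\<bar>) * (4 * (2 + 4 / \<kappa>\<^sup>2))"
    have "norm (\<Phi> n u s) \<le> B' / (1 + (Im s)\<^sup>2)" if s: "\<sigma> \<le> Re s" "Re s \<le> 2" for s
    proof -
      have e1: "norm (exp (of_real \<kappa> * (s - 2)\<^sup>2)) \<le> exp 4 * exp (- \<kappa> * (Im s)\<^sup>2)"
      proof -
        have "Re (of_real \<kappa> * (s - 2)\<^sup>2) = \<kappa> * (Re s - 2)\<^sup>2 - \<kappa> * (Im s)\<^sup>2"
          by (simp add: power2_eq_square right_diff_distrib)
        moreover have "\<kappa> * (Re s - 2)\<^sup>2 \<le> 1 * 2\<^sup>2"
        proof (intro mult_mono)
          have "\<bar>Re s - 2\<bar> \<le> 2" using s \<sigma> by auto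
          then show "(Re s - 2)\<^sup>2 \<le> 2\<^sup>2" by (rule power2_le_iff_abs_le[THEN iffD2, rotated]) simp
        qed (use \<kappa> in auto)
        ultimately show ?thesis by (simp add: norm_exp_eq_Re flip: exp_add)
      qed
      have e2: "norm (exp (s * of_real u)) \<le> exp (2 * \<bar>u\<bar>)"
      proof -
        have "Re s * u \<le> Re s * \<bar>u\<bar>" using s \<sigma> by (intro mult_left_mono) auto
        also have "\<dots> \<le> 2 * \<bar>u\<bar>" using s by (intro mult_right_mono) auto
        finally show ?thesis by (simp add: norm_exp_eq_Re)
      qed
      have "norm (\<Phi> n u s) = norm (Q s) * norm (exp (of_real \<kappa> * (s - 2)\<^sup>2)) * norm (exp (s * of_real u))"
        unfolding \<Phi>_def \<kappa>_def by (simp only: norm_mult)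
      also have "\<dots> \<le> (C * (\<bar>Im s\<bar> + 3)) * (exp 4 * exp (- \<kappa> * (Im s)\<^sup>2)) * exp (2 * \<bar>u\<bar>)"
        using C by (intro mult_mono e1 e2 Q_growth s) auto
      also have "\<dots> = (C * exp 4 * exp (2 * \<bar>u\<bar>)) * ((\<bar>Im s\<bar> + 3) * exp (- \<kappa> * (Im s)\<^sup>2))" by simp
      also have "\<dots> \<le> (C * exp 4 * exp (2 * \<bar>u\<bar>)) * (4 * (2 + 4 / \<kappa>\<^sup>2) / (1 + (Im s)\<^sup>2))"
        using C by (intro mult_left_mono gauss_poly_bound \<kappa>) auto
      also have "\<dots> = B' / (1 + (Im s)\<^sup>2)" by (simp add: B'_def)
      finally show ?thesis .
    qed
    then show ?thesis by blast
  qed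
  have shift: "(\<integral>t. \<Phi> n u (Complex \<sigma> t) \<partial>lborel) = (\<integral>t. \<Phi> n u (Complex 2 t) \<partial>lborel)" for n u
  proof -
    obtain B' where "\<forall>s. \<sigma> \<le> Re s \<longrightarrow> Re s \<le> 2 \<longrightarrow> norm (\<Phi> n u s) \<le> B' / (1 + (Im s)\<^sup>2)"
      using \<Phi>_bound[of n u] ..
    then show ?thesis by (intro vertical_line_integral_shift[OF \<Phi>_hol \<sigma>(1,3), where B = B']) simp
  qed
  have H_int: "integrable lborel (H n)" for n
  proof -
    obtain B' where B': "\<forall>s. \<sigma> \<le> Re s \<longrightarrow> Re s \<le> 2 \<longrightarrow> norm (\<Phi> n 0 s) \<le> B' / (1 + (Im s)\<^sup>2)"
      using \<Phi>_bound[of n 0] ..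
    have "continuous_on UNIV (\<lambda>t. \<Phi> n 0 (Complex \<sigma> t))"
      by (rule continuous_on_compose2[OF holomorphic_on_imp_continuous_on[OF \<Phi>_hol[of n 0]]])
        (use \<sigma> in \<open>auto simp: Complex_eq intro!: continuous_intros\<close>)
    then have [measurable]: "(\<lambda>t. \<Phi> n 0 (Complex \<sigma> t)) \<in> borel_measurable borel"
      by (rule borel_measurable_continuous_onI)
    have "integrable lborel (\<lambda>t::real. \<bar>B'\<bar> * (1 / (1 + t\<^sup>2)))"
      by (rule integrable_mult_right[OF integrable_inverse_1_plus_square_real])
    then have "integrable lborel (\<lambda>t. \<Phi> n 0 (Complex \<sigma> t))"
    proof (rule Bochner_Integration.integrable_bound)
      show "AE t in lborel. norm (\<Phi> n 0 (Complex \<sigma> t)) \<le> norm (\<bar>B'\<bar> * (1 / (1 + t\<^sup>2)))"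
      proof (intro AE_I2)
        fix t :: real
        have "norm (\<Phi> n 0 (Complex \<sigma> t)) \<le> B' / (1 + t\<^sup>2)" using B'[rule_format, of "Complex \<sigma> t"] \<sigma> by simp
        also have "\<dots> \<le> norm (\<bar>B'\<bar> * (1 / (1 + t\<^sup>2)))" by (simp add: divide_right_mono)
        finally show "norm (\<Phi> n 0 (Complex \<sigma> t)) \<le> norm (\<bar>B'\<bar> * (1 / (1 + t\<^sup>2)))" .
      qed
    qed simp
    then show ?thesis unfolding H_def .
  qed
  have g_eq: "2 * of_real pi * g n u * of_real (exp ((2 - \<sigma>) * u)) = (\<integral>t. H n t * cis (t * u) \<partial>lborel)" for n u
  proof -
    have F: "(\<integral>v. f v * cis (- (t * v)) \<partial>lborel) = Q (Complex 2 t)" for t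
    proof -
      have "f v * cis (- (t * v)) = of_real (D v) * exp (- Complex 2 t * of_real v)" for v
        by (simp add: f_def cis_conv_exp Complex_eq exp_of_real[symmetric] exp_add[symmetric] algebra_simps del: exp_of_real)
      then show ?thesis using trans[of t] by simp
    qed
    have "2 * of_real pi * g n u
        = (\<integral>t. Q (Complex 2 t) * of_real (exp (- (\<tau> n * t)\<^sup>2 / 2)) * cis (t * u) \<partial>lborel)"
      using gauss_summation[OF f_int \<tau>(1)[of n], of u] unfolding F g_def by simp
    also have "\<dots> = (\<integral>t. \<Phi> n u (Complex 2 t) * of_real (exp (- 2 * u)) \<partial>lborel)"
    proof (intro Bochner_Integration.integral_cong refl)
      fix t
      have "Complex 2 t - 2 = \<i> * of_real t" by (simp add: complex_eq_iff)
      then have 1: "exp (of_real ((\<tau> n)\<^sup>2 / 2) * (Complex 2 t - 2)\<^sup>2) = of_real (exp (- (\<tau> n * t)\<^sup>2 / 2))"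
        by (simp add: power_mult_distrib exp_of_real[symmetric] del: exp_of_real)
      have 2: "exp (Complex 2 t * of_real u) * of_real (exp (- 2 * u)) = cis (t * u)"
        by (simp add: cis_conv_exp Complex_eq exp_of_real[symmetric] exp_add[symmetric] algebra_simps del: exp_of_real)
      show "Q (Complex 2 t) * of_real (exp (- (\<tau> n * t)\<^sup>2 / 2)) * cis (t * u)
          = \<Phi> n u (Complex 2 t) * of_real (exp (- 2 * u))"
        unfolding \<Phi>_def 1 2[symmetric] by simp
    qed
    also have "\<dots> = (\<integral>t. \<Phi> n u (Complex \<sigma> t) \<partial>lborel) * of_real (exp (- 2 * u))"
      unfolding shift by simp
    finally have "2 * of_real pi * g n u * of_real (exp ((2 - \<sigma>) * u))
        = (\<integral>t. \<Phi> n u (Complex \<sigma> t) \<partial>lborel) * (of_real (exp (- 2 * u)) * of_real (exp ((2 - \<sigma>) * u)))"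
      by simp
    also have "of_real (exp (- 2 * u)) * of_real (exp ((2 - \<sigma>) * u)) = complex_of_real (exp (- (\<sigma> * u)))"
      by (simp add: algebra_simps flip: of_real_mult exp_add)
    also have "(\<integral>t. \<Phi> n u (Complex \<sigma> t) \<partial>lborel) * of_real (exp (- (\<sigma> * u)))
        = (\<integral>t. \<Phi> n u (Complex \<sigma> t) * of_real (exp (- (\<sigma> * u))) \<partial>lborel)" by simp
    also have "\<dots> = (\<integral>t. H n t * cis (t * u) \<partial>lborel)"
    proof (intro Bochner_Integration.integral_cong refl)
      fix t
      have "exp (Complex \<sigma> t * of_real u) * of_real (exp (- (\<sigma> * u))) = cis (t * u)"
        by (simp add: cis_conv_exp Complex_eq exp_of_real[symmetric] exp_add[symmetric] algebra_simps del: exp_of_real)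
      then show "\<Phi> n u (Complex \<sigma> t) * of_real (exp (- (\<sigma> * u))) = H n t * cis (t * u)"
        by (simp add: H_def \<Phi>_def)
    qed
    finally show ?thesis .
  qed
  have Re_sq: "Re (of_real k * (s - 2)\<^sup>2) = k * (Re s - 2)\<^sup>2 - k * (Im s)\<^sup>2" for k s
    by (simp add: power2_eq_square right_diff_distrib)
  have H_le: "(norm (H n t))\<^sup>2 \<le> exp 4 * (norm (Q (Complex \<sigma> t)))\<^sup>2" for n t
  proof -
    have "Re (of_real ((\<tau> n)\<^sup>2 / 2) * (Complex \<sigma> t - 2)\<^sup>2) = (\<tau> n)\<^sup>2 / 2 * (\<sigma> - 2)\<^sup>2 - (\<tau> n)\<^sup>2 / 2 * t\<^sup>2"
      by (simp only: Re_sq complex.sel)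
    also have "\<dots> \<le> (\<tau> n)\<^sup>2 / 2 * (\<sigma> - 2)\<^sup>2" by simp
    also have "\<dots> \<le> 1 / 2 * 2\<^sup>2"
    proof (intro mult_mono)
      have "\<bar>\<sigma> - 2\<bar> \<le> 2" using \<sigma> by auto
      then show "(\<sigma> - 2)\<^sup>2 \<le> 2\<^sup>2" by (rule power2_le_iff_abs_le[THEN iffD2, rotated]) simp
      show "(\<tau> n)\<^sup>2 / 2 \<le> 1 / 2" using \<tau>[of n] by (simp add: power_le_one)
    qed auto
    finally have "norm (exp (of_real ((\<tau> n)\<^sup>2 / 2) * (Complex \<sigma> t - 2)\<^sup>2)) \<le> exp 2"
      by (simp add: norm_exp_eq_Re)
    then have "norm (H n t) \<le> norm (Q (Complex \<sigma> t)) * exp 2"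
      by (simp add: H_def \<Phi>_def norm_mult mult_left_mono)
    then have "(norm (H n t))\<^sup>2 \<le> (norm (Q (Complex \<sigma> t)) * exp 2)\<^sup>2" by (intro power_mono) auto
    also have "\<dots> = exp 4 * (norm (Q (Complex \<sigma> t)))\<^sup>2"
      by (simp add: power_mult_distrib exp_double[symmetric])
    finally show ?thesis .
  qed
  let ?I = "\<integral>\<^sup>+t. ennreal ((norm (Q (Complex \<sigma> t)))\<^sup>2) \<partial>lborel"
  have Q_meas [measurable]: "(\<lambda>t. Q (Complex \<sigma> t)) \<in> borel_measurable borel"
    by (intro borel_measurable_continuous_onI continuous_on_compose2[OF holomorphic_on_imp_continuous_on[OF Q_hol]])
      (use \<sigma> in \<open>auto simp: Complex_eq intro!: continuous_intros\<close>)
  define h where "h n u = ennreal ((norm (\<integral>t. H n t * cis (t * u) \<partial>lborel))\<^sup>2) * indicator {U..U+1} u" for n u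
  have h_eq: "h n u = ennreal ((2 * pi * norm (g n u) * exp ((2 - \<sigma>) * u))\<^sup>2) * indicator {U..U+1} u" for n u
    unfolding h_def g_eq[symmetric] by (simp add: norm_mult)
  have h_meas: "h n \<in> borel_measurable borel" for n
  proof -
    have "(\<lambda>(u, z). of_real (std_normal_density z) * f (u + \<tau> n * z)) \<in> borel_measurable (lborel \<Otimes>\<^sub>M lborel)"
      by measurable
    then have "g n \<in> borel_measurable borel" unfolding g_def
      using lborel.borel_measurable_lebesgue_integral[of "\<lambda>u z. of_real (std_normal_density z) * f (u + \<tau> n * z)" lborel]
      by simp
    then show ?thesis unfolding h_eq by measurable
  qed
  have h_le: "(\<integral>\<^sup>+u. h n u \<partial>lborel) \<le> ennreal (2 * pi * exp (1/2)) * (ennreal (exp 4) * ?I)" for n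
  proof -
    have "(\<integral>\<^sup>+u. h n u \<partial>lborel) \<le> ennreal (2 * pi * exp (1/2)) * (\<integral>\<^sup>+t. ennreal ((norm (H n t))\<^sup>2) \<partial>lborel)"
      unfolding h_def by (rule fourier_L2_unit_interval[OF H_int])
    also have "(\<integral>\<^sup>+t. ennreal ((norm (H n t))\<^sup>2) \<partial>lborel) \<le> (\<integral>\<^sup>+t. ennreal (exp 4) * ennreal ((norm (Q (Complex \<sigma> t)))\<^sup>2) \<partial>lborel)"
      using H_le by (intro nn_integral_mono) (simp add: ennreal_mult'[symmetric] ennreal_leI)
    also have "\<dots> = ennreal (exp 4) * ?I" by (rule nn_integral_cmult) measurable
    finally show ?thesis by (simp add: mult_left_mono)
  qed
  have \<tau>0: "\<tau> \<longlonglongrightarrow> 0" unfolding \<tau>_def by real_asymp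
  let ?L = "\<lambda>u. ennreal ((2 * pi)\<^sup>2 * ((D u)\<^sup>2 * exp (- 2 * \<sigma> * u))) * indicator {U..U+1} u"
  have AE: "AE u in lborel. ?L u \<le> liminf (\<lambda>n. h n u)"
    using D_cont
  proof eventually_elim
    case (elim u)
    have "isCont f u" unfolding f_def using elim by (intro continuous_intros) auto
    then have "(\<lambda>n. g n u) \<longlonglongrightarrow> f u"
      unfolding g_def by (intro gauss_smoothing_tendsto[where B = B] f_bdd \<tau>0) auto
    then have "(\<lambda>n. (2 * pi * norm (g n u) * exp ((2 - \<sigma>) * u))\<^sup>2) \<longlonglongrightarrow> (2 * pi * norm (f u) * exp ((2 - \<sigma>) * u))\<^sup>2"
      by (intro tendsto_intros)
    also have "(2 * pi * norm (f u) * exp ((2 - \<sigma>) * u))\<^sup>2 = (2 * pi)\<^sup>2 * ((D u)\<^sup>2 * exp (- 2 * \<sigma> * u))"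
    proof -
      have 1: "norm (f u) = \<bar>D u\<bar> * exp (- 2 * u)" unfolding f_def norm_of_real by (simp add: abs_mult)
      have 2: "(exp (- 2 * u))\<^sup>2 * (exp ((2 - \<sigma>) * u))\<^sup>2 = exp (- 2 * \<sigma> * u)"
        by (simp add: algebra_simps flip: exp_add exp_double)
      show ?thesis unfolding 1 power_mult_distrib by (simp add: mult.assoc 2[simplified])
    qed
    finally have "(\<lambda>n. ennreal ((2 * pi * norm (g n u) * exp ((2 - \<sigma>) * u))\<^sup>2)) \<longlonglongrightarrow> ennreal ((2 * pi)\<^sup>2 * ((D u)\<^sup>2 * exp (- 2 * \<sigma> * u)))"
      by (rule tendsto_ennrealI)
    then have "(\<lambda>n. h n u) \<longlonglongrightarrow> ?L u"
      unfolding h_eq by (cases "u \<in> {U..U+1}") auto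
    then have "liminf (\<lambda>n. h n u) = ?L u" by (intro lim_imp_Liminf) auto
    then show ?case by simp
  qed
  have "(\<integral>\<^sup>+u. ?L u \<partial>lborel) \<le> (\<integral>\<^sup>+u. liminf (\<lambda>n. h n u) \<partial>lborel)"
    by (rule nn_integral_mono_AE[OF AE])
  also have "\<dots> \<le> liminf (\<lambda>n. \<integral>\<^sup>+u. h n u \<partial>lborel)"
    using h_meas by (intro nn_integral_liminf) simp
  also have "\<dots> \<le> ennreal (2 * pi * exp (1/2)) * (ennreal (exp 4) * ?I)"
    by (rule order_trans[OF Liminf_mono[OF always_eventually[OF allI[OF h_le]]]]) (simp add: Liminf_const)
  also have "\<dots> \<le> ennreal ((2 * pi)\<^sup>2) * (ennreal (exp 5) * ?I)"
  proof -
    \<comment> \<open>Any absolute constant will do; \<open>exp 5\<close> is a short one.\<close>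
    have "2 * pi * exp (1/2) * exp 4 \<le> (2 * pi)\<^sup>2 * exp 5"
    proof -
      have "exp (1/2) * exp 4 \<le> exp (5::real)" by (simp flip: exp_add)
      moreover have "2 * pi \<le> (2 * pi)\<^sup>2" using pi_ge_two by (intro self_le_power) auto
      ultimately have "2 * pi * (exp (1/2) * exp 4) \<le> (2 * pi)\<^sup>2 * exp 5" by (intro mult_mono) auto
      then show ?thesis by simp
    qed
    then have "ennreal (2 * pi * exp (1/2) * exp 4) * ?I \<le> ennreal ((2 * pi)\<^sup>2 * exp 5) * ?I"
      by (intro mult_right_mono ennreal_leI) auto
    then show ?thesis by (simp add: ennreal_mult mult.assoc)
  qed
  finally have fin: "(\<integral>\<^sup>+u. ?L u \<partial>lborel) \<le> ennreal ((2 * pi)\<^sup>2) * (ennreal (exp 5) * ?I)" .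
  have "(\<integral>\<^sup>+u. ?L u \<partial>lborel) = (\<integral>\<^sup>+u. ennreal ((2 * pi)\<^sup>2) * (ennreal ((D u)\<^sup>2 * exp (- 2 * \<sigma> * u)) * indicator {U..U+1} u) \<partial>lborel)"
    by (intro nn_integral_cong) (simp only: ennreal_mult zero_le_power2 mult_nonneg_nonneg exp_ge_zero mult.assoc)
  also have "\<dots> = ennreal ((2 * pi)\<^sup>2) * (\<integral>\<^sup>+u. ennreal ((D u)\<^sup>2 * exp (- 2 * \<sigma> * u)) * indicator {U..U+1} u \<partial>lborel)"
    by (rule nn_integral_cmult) measurable
  finally have eq: "ennreal ((2 * pi)\<^sup>2) * (\<integral>\<^sup>+u. ennreal ((D u)\<^sup>2 * exp (- 2 * \<sigma> * u)) * indicator {U..U+1} u \<partial>lborel)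
      \<le> ennreal ((2 * pi)\<^sup>2) * (ennreal (exp 5) * ?I)" using fin by simp
  have "ennreal (1 / (2 * pi)\<^sup>2) * (ennreal ((2 * pi)\<^sup>2) * x) = x" for x
    by (subst mult.assoc[symmetric], subst ennreal_mult[symmetric]) auto
  with mult_left_mono[OF eq, of "ennreal (1 / (2 * pi)\<^sup>2)"] show ?thesis by simp
qed

section \<open>The regularised zeta function and the von Mangoldt series\<close>

text \<open>
  \<open>(s - 1) * zeta s\<close> for \<open>Re s > 0\<close>, as an explicit series: one step of Taylor
  expansion reaches beyond the critical line and makes polynomial bounds evident.
\<close>
definition reg_zeta :: "complex \<Rightarrow> complex" where
  "reg_zeta s = 1 + (\<Sum>n. zeta_rem 1 n s)"

lemma reg_zeta_holomorphic: "reg_zeta holomorphic_on {s. Re s > 0}"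
  unfolding reg_zeta_def using zeta_rem_series(1)[of 1] by (intro holomorphic_intros) simp

lemma reg_zeta_eq_series: "Re s > 1 \<Longrightarrow> reg_zeta s = (s - 1) * zeta_series s"
  unfolding reg_zeta_def by (subst zeta_rem_sum) (simp_all add: zeta_fall_def algebra_simps)

lemma riemann_zeta_eq_series: "Re s > 1 \<Longrightarrow> riemann_zeta s = zeta_series s"
  using is_zeta_riemann_zeta zeta_series_sums sums_unique2 unfolding is_zeta_def by blast

lemma reg_zeta_eq:
  assumes "Re s > 0" "s \<noteq> 1"
  shows "reg_zeta s = (s - 1) * riemann_zeta s"
proof (rule analytic_continuation_open[of "{s. Re s > 1}" "{s. Re s > 0} - {1}" reg_zeta "\<lambda>s. (s - 1) * riemann_zeta s"])
  show "{s. Re s > 1} \<noteq> {}" by (auto intro!: exI[of _ 2])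
  show "connected ({s. Re s > 0} - {1})"
    by (intro connected_open_delete convex_connected convex_halfspace_Re_gt open_halfspace_Re_gt) auto
  show "(\<lambda>s. (s - 1) * riemann_zeta s) holomorphic_on {s. Re s > 0} - {1}"
    using is_zeta_riemann_zeta unfolding is_zeta_def
    by (intro holomorphic_intros) (auto elim: holomorphic_on_subset)
  show "reg_zeta holomorphic_on {s. Re s > 0} - {1}"
    by (rule holomorphic_on_subset[OF reg_zeta_holomorphic]) auto
qed (use assms in \<open>auto simp: open_halfspace_Re_gt reg_zeta_eq_series riemann_zeta_eq_series\<close>)

lemma reg_zeta_1: "reg_zeta 1 = 1"
proof -
  have "zeta_rem 1 n 1 = 0" for n by (simp add: zeta_rem_def zeta_fall_def del: of_nat_Suc)
  then show ?thesis by (simp add: reg_zeta_def)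
qed

lemma reg_zeta_bound:
  "\<exists>C>0. \<forall>s. Re s \<ge> 1 / 10 \<longrightarrow> norm (reg_zeta s) \<le> C * (1 + norm s)\<^sup>2"
proof -
  define K where "K = (\<Sum>n. real (Suc n) powr (- 11 / 10))"
  have sm: "summable (\<lambda>n. real (Suc n) powr (- 11 / 10))"
    by (subst summable_Suc_iff, subst summable_real_powr_iff) simp
  have K0: "K \<ge> 0" unfolding K_def by (intro suminf_nonneg sm) auto
  have "norm (reg_zeta s) \<le> (1 + K) * (1 + norm s)\<^sup>2" if s: "Re s \<ge> 1 / 10" for s
  proof -
    define B where "B = norm (1 - s) * norm s"
    have f2: "norm (zeta_fall (Suc 1) s) = B"
      unfolding B_def zeta_fall_def by (simp add: norm_mult)
    have le: "norm (zeta_rem 1 n s) \<le> B * real (Suc n) powr (- 11 / 10)" for n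
    proof -
      have "norm (zeta_rem 1 n s) \<le> B * real (Suc n) powr (1 - real 1 - 1 - Re s)"
        using zeta_rem_bound[of 1 s n] s unfolding f2 by simp
      also have "\<dots> \<le> B * real (Suc n) powr (- 11 / 10)"
        using s by (intro mult_left_mono powr_mono) (auto simp: B_def)
      finally show ?thesis .
    qed
    have sB: "summable (\<lambda>n. B * real (Suc n) powr (- 11 / 10))" by (intro summable_mult sm)
    have "norm (\<Sum>n. zeta_rem 1 n s) \<le> (\<Sum>n. B * real (Suc n) powr (- 11 / 10))"
      by (rule norm_suminf_le[OF le sB])
    also have "\<dots> = B * K" unfolding K_def by (rule suminf_mult[OF sm])
    finally have 1: "norm (reg_zeta s) \<le> 1 + B * K"
      unfolding reg_zeta_def using norm_triangle_ineq[of 1 "\<Sum>n. zeta_rem 1 n s"] by simp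
    have "norm (1 - s) \<le> 1 + norm s" using norm_triangle_ineq4[of 1 s] by simp
    then have "B \<le> (1 + norm s) * (1 + norm s)" unfolding B_def by (intro mult_mono) auto
    then have "B * K \<le> (1 + norm s)\<^sup>2 * K" using K0 by (intro mult_right_mono) (auto simp: power2_eq_square)
    moreover have "1 \<le> (1 + norm s)\<^sup>2" by simp
    ultimately have "1 + B * K \<le> (1 + norm s)\<^sup>2 + (1 + norm s)\<^sup>2 * K" by linarith
    with 1 show ?thesis by (simp add: algebra_simps)
  qed
  then show ?thesis using K0 by (intro exI[of _ "1 + K"]) auto
qed

text \<open>
  Here \<open>|zeta s - 1| \<le> 1/2\<close>, by comparing \<open>1 / (n + 1) ^ 3\<close> with the telescoping series of
  \<open>1 / (2 * n * (n + 1))\<close>.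
\<close>
lemma norm_reg_zeta_3: "norm (reg_zeta (Complex 3 t)) \<ge> 1"
proof -
  define s where "s = Complex 3 t"
  have s: "Re s = 3" by (simp add: s_def)
  have "(\<lambda>n. of_nat (Suc n) powr (- s)) sums zeta_series s"
    by (rule zeta_series_sums) (simp add: s)
  then have "(\<lambda>n. of_nat (Suc (Suc n)) powr (- s)) sums (zeta_series s - of_nat (Suc 0) powr (- s))"
    using sums_Suc_iff[of "\<lambda>n. of_nat (Suc n) powr (- s)" "zeta_series s - of_nat (Suc 0) powr (- s)"]
    by (simp del: of_nat_Suc)
  then have sums: "(\<lambda>n. of_nat (Suc (Suc n)) powr (- s)) sums (zeta_series s - 1)" by simp
  have tele: "(\<lambda>n. (1/2) * (1 / real (Suc n) - 1 / real (Suc (Suc n)))) sums (1 / 2 * (1 / real (Suc 0) - 0))"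
    by (intro sums_mult telescope_sums') real_asymp
  have le: "norm (of_nat (Suc (Suc n)) powr (- s)) \<le> (1/2) * (1 / real (Suc n) - 1 / real (Suc (Suc n)))" for n
  proof -
    have "norm (of_nat (Suc (Suc n)) powr (- s)) = real (Suc (Suc n)) powr - 3"
      using norm_nat_powr[of "Suc n" "- s"] s by simp
    also have "\<dots> = 1 / real (Suc (Suc n)) ^ 3" by (simp add: powr_minus_divide)
    also have "\<dots> \<le> 1 / (2 * (real (Suc n) * real (Suc (Suc n))))"
      by (intro divide_left_mono) (auto simp: power3_eq_cube algebra_simps intro!: add_pos_nonneg)
    also have "\<dots> = (1/2) * (1 / real (Suc n) - 1 / real (Suc (Suc n)))"
      by (simp add: divide_simps)
    finally show ?thesis .
  qed
  have "norm (zeta_series s - 1) \<le> (\<Sum>n. (1/2) * (1 / real (Suc n) - 1 / real (Suc (Suc n))))"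
    unfolding sums_unique[OF sums] by (rule norm_suminf_le[OF le sums_summable[OF tele]])
  also have "\<dots> = 1 / 2" using sums_unique[OF tele] by simp
  finally have "norm (zeta_series s - 1) \<le> 1 / 2" .
  then have z: "norm (zeta_series s) \<ge> 1 / 2"
    using norm_triangle_ineq2[of 1 "1 - zeta_series s"] by (simp add: norm_minus_commute)
  have "norm (s - 1) \<ge> 2" using complex_Re_le_cmod[of "s - 1"] s by simp
  then have "2 * (1 / 2) \<le> norm (s - 1) * norm (zeta_series s)" using z by (intro mult_mono) auto
  moreover have "reg_zeta s = (s - 1) * zeta_series s" by (rule reg_zeta_eq_series) (simp add: s)
  ultimately show ?thesis unfolding s_def by (simp add: norm_mult)
qed

definition mangoldt_series :: "complex \<Rightarrow> complex" where
  "mangoldt_series s = (\<Sum>n. mangoldt (Suc n) * of_nat (Suc n) powr (- s))"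

lemma mangoldt_le_ln: "n > 0 \<Longrightarrow> (mangoldt n :: real) \<le> ln (real n)"
  using mangoldt_sum[of n, where 'a = real] member_le_sum[of n "{d. d dvd n}" "mangoldt :: nat \<Rightarrow> real"]
  by (simp add: mangoldt_nonneg)

lemma ln_le_powr:
  fixes x e :: real assumes "x \<ge> 1" "e > 0" shows "ln x \<le> x powr e / e"
  using ln_le_minus_one[of "x powr e"] assms by (simp add: ln_powr field_simps)

text \<open>
  An arbitrarily small power of \<open>n\<close> absorbs the logarithm.
\<close>
lemma norm_mangoldt_term_le:
  assumes "e > 0"
  shows "norm (mangoldt (Suc n) * of_nat (Suc n) powr (- s) :: complex) \<le> 1 / e * real (Suc n) powr (e - Re s)"
proof -
  have "norm (mangoldt (Suc n) * of_nat (Suc n) powr (- s) :: complex) = mangoldt (Suc n) * real (Suc n) powr (- Re s)"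
    using norm_nat_powr[of n "- s"] by (simp add: norm_mult)
  also have "\<dots> \<le> (real (Suc n) powr e / e) * real (Suc n) powr (- Re s)"
    using mangoldt_le_ln[of "Suc n"] ln_le_powr[of "real (Suc n)" e] assms by (intro mult_right_mono) auto
  also have "\<dots> = 1 / e * (real (Suc n) powr e * real (Suc n) powr (- Re s))" by simp
  also have "real (Suc n) powr e * real (Suc n) powr (- Re s) = real (Suc n) powr (e - Re s)"
    by (simp flip: powr_add)
  finally show ?thesis .
qed

lemma mangoldt_series_aux:
  assumes "e > 0"
  shows "mangoldt_series holomorphic_on {s. Re s > 1 + e}"
    and "Re s > 1 + e \<Longrightarrow> summable (\<lambda>n. mangoldt (Suc n) * of_nat (Suc n) powr (- s) :: complex)"
proof -
  have h: "(\<lambda>s. mangoldt (Suc n) * of_nat (Suc n) powr (- s) :: complex) holomorphic_on {s. Re s > 1 + e}" for n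
    by (intro holomorphic_intros)
  have b: "norm (mangoldt (Suc n) * of_nat (Suc n) powr (- s) :: complex) \<le> 1 / e * real (Suc n) powr ((1 + e) - 1 - Re s)" for n s
    using norm_mangoldt_term_le[OF assms] by simp
  have c: "continuous_on UNIV (\<lambda>s::complex. 1 / e)" by simp
  show "mangoldt_series holomorphic_on {s. Re s > 1 + e}"
    unfolding mangoldt_series_def by (rule halfplane_series(1)[OF h c b])
  show "Re s > 1 + e \<Longrightarrow> summable (\<lambda>n. mangoldt (Suc n) * of_nat (Suc n) powr (- s) :: complex)"
    by (rule halfplane_series(2)[OF h c b])
qed

lemma mangoldt_series_sums:
  "Re s > 1 \<Longrightarrow> (\<lambda>n. mangoldt (Suc n) * of_nat (Suc n) powr (- s)) sums mangoldt_series s"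
  unfolding mangoldt_series_def
  by (intro summable_sums mangoldt_series_aux(2)[of "(Re s - 1) / 2"]) (auto simp: field_simps)

lemma summable_norm_mangoldt_term:
  assumes "Re s > 1"
  shows "summable (\<lambda>n. norm (mangoldt (Suc n) * of_nat (Suc n) powr (- s) :: complex))"
proof (rule summable_comparison_test')
  define e where "e = (Re s - 1) / 2"
  have e: "e > 0" using assms by (simp add: e_def)
  have "summable (\<lambda>n. real (Suc n) powr (e - Re s))"
    using assms by (subst summable_Suc_iff, subst summable_real_powr_iff) (auto simp: e_def field_simps)
  then show "summable (\<lambda>n. 1 / e * real (Suc n) powr (e - Re s))" by (rule summable_mult)
  show "norm (norm (mangoldt (Suc n) * of_nat (Suc n) powr (- s) :: complex)) \<le> 1 / e * real (Suc n) powr (e - Re s)"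
    if "n \<ge> 0" for n using norm_mangoldt_term_le[OF e] by simp
qed

lemma summable_norm_zeta_term:
  assumes "Re s > 1"
  shows "summable (\<lambda>n. norm (of_nat (Suc n) powr (- s) :: complex))"
  unfolding norm_nat_powr using assms by (subst summable_Suc_iff, subst summable_real_powr_iff) auto

lemma Ln_of_nat_Suc: "Ln (of_nat (Suc n)) = of_real (ln (real (Suc n)))"
  using Ln_of_real[of "real (Suc n)"] by (simp del: of_nat_Suc add: of_real_of_nat_eq)

lemma deriv_zeta_series:
  assumes s: "Re s > 1"
  obtains D where "(zeta_series has_field_derivative - D) (at s)"
    "(\<lambda>n. of_real (ln (real (Suc n))) * of_nat (Suc n) powr (- s)) sums D"
proof -
  let ?S = "{s. Re s > 1}"
  have "\<exists>g g'. \<forall>x\<in>?S. ((\<lambda>n. of_nat (Suc n) powr (- x)) sums g x)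
      \<and> ((\<lambda>n. - of_real (ln (real (Suc n))) * of_nat (Suc n) powr (- x)) sums g' x)
      \<and> (g has_field_derivative g' x) (at x)"
  proof (rule series_and_derivative_comparison_complex)
    show "open ?S" by (rule open_halfspace_Re_gt)
    show "((\<lambda>x. of_nat (Suc n) powr (- x)) has_field_derivative
        - of_real (ln (real (Suc n))) * of_nat (Suc n) powr (- x)) (at x)" for n and x :: complex
    proof -
      have D: "((\<lambda>x. of_nat (Suc n) powr (- x)) has_field_derivative
        Ln (of_nat (Suc n)) * of_nat (Suc n) powr (- x) * (- 1)) (at x)"
        by (rule DERIV_chain2[where f = "\<lambda>z. of_nat (Suc n) powr z" and g = uminus,
              OF has_field_derivative_powr_right])
          (auto intro!: derivative_eq_intros simp del: of_nat_Suc)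
      show ?thesis by (rule DERIV_cong[OF D]) (simp add: Ln_of_nat_Suc del: of_nat_Suc)
    qed
    fix x assume x: "x \<in> ?S"
    \<comment> \<open>On the ball of radius \<open>d\<close> the real part stays above \<open>1 + d\<close>.\<close>
    define d where "d = (Re x - 1) / 2"
    have d: "d > 0" using x by (simp add: d_def)
    have "summable (\<lambda>n. real (Suc n) powr (- 1 - d))"
      using d by (subst summable_Suc_iff, subst summable_real_powr_iff) auto
    then have "summable (\<lambda>n. complex_of_real (real (Suc n) powr (- 1 - d)))" by (rule summable_of_real)
    moreover have "norm (of_nat (Suc n) powr (- y) :: complex) \<le> norm (complex_of_real (real (Suc n) powr (- 1 - d)))"
      if y: "y \<in> ball x d \<inter> ?S" for y n
    proof -
      have "Re x - Re y \<le> norm (x - y)" using complex_Re_le_cmod[of "x - y"] by simp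
      then have "Re y \<ge> 1 + d" using y by (auto simp: dist_norm d_def field_simps)
      then have "real (Suc n) powr (- Re y) \<le> real (Suc n) powr (- 1 - d)" by (intro powr_mono) auto
      then show ?thesis using norm_nat_powr[of n "- y"] by simp
    qed
    ultimately show "\<exists>d h. 0 < d \<and> summable (h :: nat \<Rightarrow> complex) \<and> range h \<subseteq> \<real>\<^sub>\<ge>\<^sub>0 \<and>
      (\<forall>\<^sub>F n in sequentially. \<forall>y\<in>ball x d \<inter> ?S. norm (of_nat (Suc n) powr (- y) :: complex) \<le> norm (h n))"
      using d by (intro exI[of _ d] exI[of _ "\<lambda>n. complex_of_real (real (Suc n) powr (- 1 - d))"] conjI)
        (auto simp del: of_nat_Suc)
  qed
  then obtain g g' where g: "\<And>x. Re x > 1 \<Longrightarrow> (\<lambda>n. of_nat (Suc n) powr (- x)) sums g x"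
    "\<And>x. Re x > 1 \<Longrightarrow> (\<lambda>n. - of_real (ln (real (Suc n))) * of_nat (Suc n) powr (- x)) sums g' x"
    "\<And>x. Re x > 1 \<Longrightarrow> (g has_field_derivative g' x) (at x)" by blast
  have "(zeta_series has_field_derivative g' s) (at s)"
    by (rule has_field_derivative_transform_within_open[OF g(3)[OF s], of ?S])
      (use s sums_unique2[OF g(1) zeta_series_sums] in \<open>auto simp: open_halfspace_Re_gt\<close>)
  moreover have "(\<lambda>n. of_real (ln (real (Suc n))) * of_nat (Suc n) powr (- s)) sums (- g' s)"
    using sums_minus[OF g(2)[OF s]] by simp
  ultimately show ?thesis by (intro that[of "- g' s"]) simp_all
qed

lemma summable_on_product:
  fixes a b :: "nat \<Rightarrow> complex"
  assumes a: "summable (\<lambda>n. norm (a n))" and b: "summable (\<lambda>n. norm (b n))"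
  shows "(\<lambda>(i, j). a i * b j) summable_on UNIV \<times> UNIV"
proof -
  have b': "(\<lambda>n. norm (b n)) summable_on UNIV"
    using norm_summable_imp_summable_on[of "\<lambda>n. norm (b n)"] b by simp
  have a': "(\<lambda>n. norm (a n)) summable_on UNIV"
    using norm_summable_imp_summable_on[of "\<lambda>n. norm (a n)"] a by simp
  have "(\<lambda>p. norm (a (fst p) * b (snd p))) summable_on (SIGMA i:UNIV. UNIV)"
  proof (rule summable_on_SigmaI)
    show "((\<lambda>j. norm (a (fst (i, j)) * b (snd (i, j)))) has_sum norm (a i) * infsum (\<lambda>j. norm (b j)) UNIV) UNIV" for i
      using has_sum_cmult_right[OF has_sum_infsum[OF b'], of "norm (a i)"] by (simp add: norm_mult)
    show "(\<lambda>i. norm (a i) * infsum (\<lambda>j. norm (b j)) UNIV) summable_on UNIV"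
      by (rule summable_on_cmult_left[OF a'])
  qed simp
  then have "(\<lambda>p. a (fst p) * b (snd p)) summable_on UNIV \<times> UNIV"
    by (rule Infinite_Sum.abs_summable_summable)
  then show ?thesis by (simp add: case_prod_beta')
qed

text \<open>
  Grouping the double series by the product \<open>n\<close> of the two indices leaves the sum of
  \<open>mangoldt d\<close> over the divisors of \<open>n\<close>, which is \<open>ln n\<close>.
\<close>
lemma mangoldt_series_times_zeta_series:
  assumes s: "Re s > 1"
  shows "(\<lambda>n. of_real (ln (real (Suc n))) * of_nat (Suc n) powr (- s)) sums (mangoldt_series s * zeta_series s)"
proof -
  define a :: "nat \<Rightarrow> complex" where "a = (\<lambda>n. mangoldt (Suc n) * of_nat (Suc n) powr (- s))"
  define b :: "nat \<Rightarrow> complex" where "b = (\<lambda>n. of_nat (Suc n) powr (- s))"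
  define h :: "nat \<times> nat \<Rightarrow> complex" where "h = (\<lambda>(n, d). mangoldt d * of_nat n powr (- s))"
  have a: "summable (\<lambda>n. norm (a n))" "(a has_sum mangoldt_series s) UNIV"
    using summable_norm_mangoldt_term[OF s] mangoldt_series_sums[OF s]
    by (auto simp: a_def intro!: norm_summable_imp_has_sum simp del: of_nat_Suc)
  have b: "summable (\<lambda>n. norm (b n))" "(b has_sum zeta_series s) UNIV"
    using summable_norm_zeta_term[OF s] zeta_series_sums[OF s]
    by (auto simp: b_def intro!: norm_summable_imp_has_sum simp del: of_nat_Suc)
  have "((\<lambda>(i, j). a i * b j) has_sum (mangoldt_series s * zeta_series s)) (UNIV \<times> UNIV)"
  proof (rule has_sum_SigmaI)
    show "((\<lambda>y. case (i, y) of (i, j) \<Rightarrow> a i * b j) has_sum a i * zeta_series s) UNIV" for i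
      using has_sum_cmult_right[OF b(2), of "a i"] by simp
    show "((\<lambda>i. a i * zeta_series s) has_sum mangoldt_series s * zeta_series s) UNIV"
      by (rule has_sum_cmult_left[OF a(2)])
  qed (rule summable_on_product[OF a(1) b(1)])
  also have "?this \<longleftrightarrow> (h has_sum (mangoldt_series s * zeta_series s)) (Sigma {0<..} (\<lambda>n. {d. d dvd n}))"
  proof (rule has_sum_reindex_bij_witness[of _ "\<lambda>(n, d). (d - 1, n div d - 1)" "\<lambda>(i, j). (Suc i * Suc j, Suc i)"])
    fix x :: "nat \<times> nat"
    obtain i j where x: "x = (i, j)" by (cases x)
    show "(case case x of (i, j) \<Rightarrow> (Suc i * Suc j, Suc i) of (n, d) \<Rightarrow> (d - 1, n div d - 1)) = x"
      by (simp add: x del: mult_Suc mult_Suc_right)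
    show "(case x of (i, j) \<Rightarrow> (Suc i * Suc j, Suc i)) \<in> Sigma {0<..} (\<lambda>n. {d. d dvd n})"
      by (simp add: x del: mult_Suc mult_Suc_right)
    have "(of_nat (Suc i * Suc j) :: complex) powr (- s) = of_nat (Suc i) powr (- s) * of_nat (Suc j) powr (- s)"
      using powr_times_real[of "of_nat (Suc i)" "of_nat (Suc j)" "- s"] by (simp del: of_nat_Suc mult_Suc mult_Suc_right)
    then show "h (case x of (i, j) \<Rightarrow> (Suc i * Suc j, Suc i)) = (case x of (i, j) \<Rightarrow> a i * b j)"
      by (simp add: x h_def a_def b_def del: of_nat_Suc mult_Suc mult_Suc_right)
  next
    fix y :: "nat \<times> nat" assume y: "y \<in> Sigma {0<..} (\<lambda>n. {d. d dvd n})"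
    then obtain d k where "y = (d * k, d)" "d > 0" "k > 0" by auto
    then show "(case case y of (n, d) \<Rightarrow> (d - 1, n div d - 1) of (i, j) \<Rightarrow> (Suc i * Suc j, Suc i)) = y"
      by (auto simp: algebra_simps)
  qed auto
  finally have "((\<lambda>n. of_real (ln (real n)) * of_nat n powr (- s)) has_sum (mangoldt_series s * zeta_series s)) {0<..}"
  proof (rule has_sum_SigmaD)
    fix n :: nat assume n: "n \<in> {0<..}"
    have "((\<lambda>d. h (n, d)) has_sum (\<Sum>d | d dvd n. h (n, d))) {d. d dvd n}"
      using n by (intro has_sum_finite) auto
    also have "(\<Sum>d | d dvd n. h (n, d)) = of_real (ln (real n)) * of_nat n powr (- s)"
      using n mangoldt_sum[of n, where 'a = complex] by (simp add: h_def flip: sum_distrib_right)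
    finally show "((\<lambda>d. h (n, d)) has_sum of_real (ln (real n)) * of_nat n powr (- s)) {d. d dvd n}" .
  qed
  moreover have "{0<..} = range Suc" by (auto simp: image_iff gr0_conv_Suc)
  ultimately have "((\<lambda>n. of_real (ln (real (Suc n))) * of_nat (Suc n) powr (- s)) has_sum (mangoldt_series s * zeta_series s)) UNIV"
    by (simp add: has_sum_reindex o_def)
  then show ?thesis by (rule has_sum_imp_sums)
qed

lemma zeta_series_deriv:
  assumes s: "Re s > 1"
  shows "(zeta_series has_field_derivative - (mangoldt_series s * zeta_series s)) (at s)"
proof -
  obtain D where "(zeta_series has_field_derivative - D) (at s)"
    "(\<lambda>n. of_real (ln (real (Suc n))) * of_nat (Suc n) powr (- s)) sums D"
    using deriv_zeta_series[OF s] .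
  with sums_unique2[OF this(2) mangoldt_series_times_zeta_series[OF s]] show ?thesis by simp
qed

text \<open>
  If \<open>W\<close> is a primitive of the von Mangoldt series, then \<open>zeta * exp W\<close> is constant; a zero
  would make it vanish identically.
\<close>
lemma zeta_series_nonzero:
  assumes s: "Re s > 1"
  shows "zeta_series s \<noteq> 0"
proof
  assume 0: "zeta_series s = 0"
  \<comment> \<open>The half-plane \<open>Re z > 1 + e\<close> contains both \<open>s\<close> and the point 3.\<close>
  define e where "e = min 1 ((Re s - 1) / 2)"
  have e: "e > 0" "e \<le> 1" "Re s > 1 + e" using s by (auto simp: e_def min_def field_simps)
  let ?S = "{s. Re s > 1 + e}"
  have op: "open ?S" by (rule open_halfspace_Re_gt)
  have hol: "mangoldt_series holomorphic_on ?S" by (rule mangoldt_series_aux(1)[OF e(1)])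
  have fd: "mangoldt_series field_differentiable at x" if "x \<in> interior ?S - {}" for x
    using that holomorphic_on_imp_differentiable_at[OF hol op] by (simp add: interior_open[OF op])
  obtain W where W: "\<And>x. x \<in> ?S \<Longrightarrow> (W has_field_derivative mangoldt_series x) (at x within ?S)"
    by (rule holomorphic_convex_primitive[OF convex_halfspace_Re_gt finite.emptyI
        holomorphic_on_imp_continuous_on[OF hol] fd]) (assumption, rule that)
  have "\<exists>c. \<forall>x\<in>?S. zeta_series x * exp (W x) = c"
  proof (rule has_field_derivative_zero_constant)
    show "convex ?S" by (rule convex_halfspace_Re_gt)
    fix x assume x: "x \<in> ?S"
    then have x1: "Re x > 1" using e by simp
    have Z: "(zeta_series has_field_derivative - (mangoldt_series x * zeta_series x)) (at x within ?S)"
      by (rule has_field_derivative_at_within[OF zeta_series_deriv[OF x1]])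
    show "((\<lambda>x. zeta_series x * exp (W x)) has_field_derivative 0) (at x within ?S)"
      by (rule derivative_eq_intros Z W[OF x] refl)+ (simp add: algebra_simps)
  qed
  then obtain c where c: "\<And>x. x \<in> ?S \<Longrightarrow> zeta_series x * exp (W x) = c" by blast
  have "c = 0" using c[of s] 0 e by simp
  then have "zeta_series (Complex 3 0) = 0" using c[of "Complex 3 0"] e by simp
  then show False
    using norm_reg_zeta_3[of 0] reg_zeta_eq_series[of "Complex 3 0"] by simp
qed

lemma reg_zeta_logderiv_eq:
  assumes s: "Re s > 1"
  shows "deriv reg_zeta s / reg_zeta s = 1 / (s - 1) - mangoldt_series s"
proof -
  have s1: "s - 1 \<noteq> 0" using s by auto
  have "((\<lambda>s. (s - 1) * zeta_series s) has_field_derivative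
      zeta_series s + (s - 1) * (- (mangoldt_series s * zeta_series s))) (at s)"
    by (rule derivative_eq_intros zeta_series_deriv[OF s] refl)+ simp
  then have "(reg_zeta has_field_derivative
      zeta_series s + (s - 1) * (- (mangoldt_series s * zeta_series s))) (at s)"
    by (rule has_field_derivative_transform_within_open[of _ _ _ "{s. Re s > 1}"])
      (use s in \<open>auto simp: open_halfspace_Re_gt reg_zeta_eq_series\<close>)
  then have "deriv reg_zeta s = zeta_series s + (s - 1) * (- (mangoldt_series s * zeta_series s))"
    by (rule DERIV_imp_deriv)
  moreover have "(z + x * (- (v * z))) / (x * z) = 1 / x - v" if "x \<noteq> 0" "z \<noteq> 0" for x z v :: complex
    using that by (simp add: field_simps)
  ultimately show ?thesis
    using s1 zeta_series_nonzero[OF s] unfolding reg_zeta_eq_series[OF s] by presburger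
qed

section \<open>Zeros of zeta on and to the right of the line Re s = 1\<close>

text \<open>
  The limit is the order of vanishing of \<open>f\<close> at \<open>z0\<close>.
\<close>
lemma tendsto_logderiv_along_ray:
  fixes f :: "complex \<Rightarrow> complex"
  assumes hol: "f holomorphic_on S" and S: "open S" "connected S" "z0 \<in> S"
    and nz: "\<beta> \<in> S" "f \<beta> \<noteq> 0"
  shows "\<exists>m::nat. (m = 0 \<longleftrightarrow> f z0 \<noteq> 0) \<and>
    ((\<lambda>x. of_real x * (deriv f (z0 + of_real x) / f (z0 + of_real x))) \<longlongrightarrow> of_nat m) (at_right 0)"
proof -
  have lim0: "((\<lambda>x. complex_of_real x) \<longlongrightarrow> 0) (at_right 0)"
    using tendsto_of_real[OF tendsto_ident_at, of 0 "{0<..}"] by simp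
  have lim: "((\<lambda>x. z0 + of_real x) \<longlongrightarrow> z0) (at_right (0::real))"
    using tendsto_add[OF tendsto_const lim0, of z0] by simp
  have aux: "((\<lambda>x. of_real x * (deriv g (z0 + of_real x) / g (z0 + of_real x))) \<longlongrightarrow> 0) (at_right 0)"
    if g: "g holomorphic_on T" "open T" "z0 \<in> T" "g z0 \<noteq> 0" for g T
  proof -
    have "isCont (deriv g) z0" "isCont g z0"
      using holomorphic_on_imp_continuous_on[OF g(1)] g(2,3)
        holomorphic_on_imp_continuous_on[OF holomorphic_deriv[OF g(1,2)]]
      by (simp_all add: continuous_on_eq_continuous_at)
    from this[THEN isCont_tendsto_compose, OF lim] have "((\<lambda>x. of_real x * (deriv g (z0 + of_real x) / g (z0 + of_real x))) \<longlongrightarrow> 0 * (deriv g z0 / g z0)) (at_right 0)"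
      by (intro tendsto_mult tendsto_divide lim0 g(4))
    then show ?thesis by simp
  qed
  show ?thesis
  proof (cases "f z0 = 0")
    case False
    then show ?thesis using aux[OF hol S(1,3)] by (intro exI[of _ 0]) auto
  next
    case True
    have nc: "\<not> f constant_on S" using True nz S(3) unfolding constant_on_def by metis
    obtain g r n where n: "0 < n" "0 < r" "ball z0 r \<subseteq> S" "g holomorphic_on ball z0 r"
      "\<And>w. w \<in> ball z0 r \<Longrightarrow> f w = (w - z0) ^ n * g w" "\<And>w. w \<in> ball z0 r \<Longrightarrow> g w \<noteq> 0"
      by (rule holomorphic_factor_zero_nonconstant[OF hol S True nc], rule that; simp)
    have "((\<lambda>x. of_nat n + of_real x * (deriv g (z0 + of_real x) / g (z0 + of_real x))) \<longlongrightarrow> of_nat n + 0) (at_right 0)"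
      using n by (intro tendsto_add tendsto_const aux[of g "ball z0 r"]) auto
    moreover have "eventually (\<lambda>x. of_nat n + of_real x * (deriv g (z0 + of_real x) / g (z0 + of_real x))
        = of_real x * (deriv f (z0 + of_real x) / f (z0 + of_real x))) (at_right 0)"
      using eventually_at_right_less[of 0] eventually_at_right_real[OF n(2)]
    proof eventually_elim
      case (elim x)
      define w where "w = z0 + of_real x"
      have w: "w \<in> ball z0 r" "w - z0 = of_real x" "w - z0 \<noteq> 0" using elim by (auto simp: w_def dist_norm)
      have dg: "(g has_field_derivative deriv g w) (at w)"
        using n(4) w by (metis holomorphic_derivI open_ball)
      obtain k where k: "n = Suc k" using n(1) by (cases n) auto
      have "((\<lambda>w. (w - z0) ^ n * g w) has_field_derivative
          of_nat n * (w - z0) ^ k * g w + (w - z0) ^ n * deriv g w) (at w)"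
        by (rule derivative_eq_intros dg refl)+ (simp add: k)
      then have "(f has_field_derivative of_nat n * (w - z0) ^ k * g w + (w - z0) ^ n * deriv g w) (at w)"
        by (rule has_field_derivative_transform_within_open[of _ _ _ "ball z0 r"]) (use w n in auto)
      then have "deriv f w = of_nat n * (w - z0) ^ k * g w + (w - z0) ^ n * deriv g w"
        by (rule DERIV_imp_deriv)
      then have "(w - z0) * (deriv f w / f w) = of_nat n + (w - z0) * (deriv g w / g w)"
      proof -
        have "y * ((N * y ^ k * u + y ^ Suc k * v) / (y ^ Suc k * u)) = N + y * (v / u)"
          if "y \<noteq> 0" "u \<noteq> 0" for y u v N :: complex
          using that by (simp add: field_simps)
        from this[OF w(3) n(6)[OF w(1)]] show ?thesis
          using \<open>deriv f w = _\<close> n(5)[OF w(1)] by (simp only: k)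
      qed
      then show ?case unfolding w(2) by (simp add: w_def)
    qed
    ultimately have "((\<lambda>x. of_real x * (deriv f (z0 + of_real x) / f (z0 + of_real x))) \<longlongrightarrow> of_nat n + 0) (at_right 0)"
      by (rule Lim_transform_eventually)
    then have "((\<lambda>x. of_real x * (deriv f (z0 + of_real x) / f (z0 + of_real x))) \<longlongrightarrow> of_nat n) (at_right 0)"
      by simp
    then show ?thesis using n(1) True by (intro exI[of _ n]) auto
  qed
qed

lemma Re_nat_powr: "Re (of_nat (Suc n) powr (- s)) = real (Suc n) powr (- Re s) * cos (Im s * ln (real (Suc n)))"
  by (simp add: powr_def Re_exp Ln_of_nat_Suc del: of_nat_Suc)

text \<open>
  Term by term, as \<open>3 + 4 * cos x + cos (2 * x) = 2 * (1 + cos x)\<^sup>2\<close>.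
\<close>
lemma mangoldt_series_3_4_1:
  assumes "\<sigma> > 1"
  shows "3 * Re (mangoldt_series (Complex \<sigma> 0)) + 4 * Re (mangoldt_series (Complex \<sigma> t))
     + Re (mangoldt_series (Complex \<sigma> (2 * t))) \<ge> 0"
proof -
  have S: "(\<lambda>n. mangoldt (Suc n) * (real (Suc n) powr - \<sigma> * cos (y * ln (real (Suc n)))))
      sums Re (mangoldt_series (Complex \<sigma> y))" for y
  proof -
    have *: "(\<lambda>n. Re (mangoldt (Suc n) * of_nat (Suc n) powr (- Complex \<sigma> y))) sums Re (mangoldt_series (Complex \<sigma> y))"
      using assms by (intro sums_Re mangoldt_series_sums) simp
    have **: "Re (mangoldt (Suc n) * of_nat (Suc n) powr (- Complex \<sigma> y))
        = mangoldt (Suc n) * (real (Suc n) powr - \<sigma> * cos (y * ln (real (Suc n))))" for n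
      using Re_nat_powr[of n "Complex \<sigma> y"] by (simp del: of_nat_Suc)
    show ?thesis using * unfolding ** .
  qed
  have total: "(\<lambda>n. 3 * (mangoldt (Suc n) * (real (Suc n) powr - \<sigma> * cos (0 * ln (real (Suc n)))))
      + 4 * (mangoldt (Suc n) * (real (Suc n) powr - \<sigma> * cos (t * ln (real (Suc n)))))
      + mangoldt (Suc n) * (real (Suc n) powr - \<sigma> * cos (2 * t * ln (real (Suc n)))))
     sums (3 * Re (mangoldt_series (Complex \<sigma> 0)) + 4 * Re (mangoldt_series (Complex \<sigma> t))
     + Re (mangoldt_series (Complex \<sigma> (2 * t))))"
    by (intro sums_add sums_mult S)
  have nonneg: "3 * (mangoldt (Suc n) * (real (Suc n) powr - \<sigma> * cos (0 * ln (real (Suc n)))))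
      + 4 * (mangoldt (Suc n) * (real (Suc n) powr - \<sigma> * cos (t * ln (real (Suc n)))))
      + mangoldt (Suc n) * (real (Suc n) powr - \<sigma> * cos (2 * t * ln (real (Suc n)))) \<ge> 0" for n
  proof -
    define x where "x = t * ln (real (Suc n))"
    have eq: "3 + 4 * cos x + cos (2 * x) = 2 * (1 + cos x)\<^sup>2"
      unfolding cos_double_cos by (simp add: power2_eq_square algebra_simps)
    have "0 \<le> 3 + 4 * cos x + cos (2 * x)" unfolding eq by simp
    then have "0 \<le> mangoldt (Suc n) * real (Suc n) powr - \<sigma> * (3 + 4 * cos x + cos (2 * x))"
      by (intro mult_nonneg_nonneg mangoldt_nonneg) auto
    then show ?thesis by (simp add: x_def algebra_simps del: of_nat_Suc)
  qed
  show ?thesis by (rule sums_le[OF nonneg sums_zero total])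
qed

text \<open>
  Multiplying the inequality above by \<open>\<sigma> - 1\<close> and letting \<open>\<sigma>\<close> tend to 1 gives
  \<open>3 - 4 * m1 - m2 \<ge> 0\<close> for the orders of vanishing at \<open>1 + i t\<close> and \<open>1 + 2 i t\<close>; so \<open>m1 = 0\<close>.
\<close>
lemma reg_zeta_nonzero_on_line_1: "reg_zeta (Complex 1 t) \<noteq> 0"
proof
  assume 0: "reg_zeta (Complex 1 t) = 0"
  have one: "Complex 1 0 = 1" by (simp add: complex_eq_iff)
  have t: "t \<noteq> 0" using 0 reg_zeta_1 one by (intro notI) simp
  let ?S = "{s. Re s > 0}"
  let ?L = "\<lambda>z0 x. of_real x * (deriv reg_zeta (z0 + of_real x) / reg_zeta (z0 + of_real x))"
  have S: "open ?S" "connected ?S"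
    by (auto intro: open_halfspace_Re_gt convex_connected convex_halfspace_Re_gt)
  have ord: "\<exists>m::nat. (m = 0 \<longleftrightarrow> reg_zeta (Complex 1 y) \<noteq> 0) \<and> (?L (Complex 1 y) \<longlongrightarrow> of_nat m) (at_right 0)" for y
  proof -
    have "Complex 1 y \<in> ?S" "1 \<in> ?S" "reg_zeta 1 \<noteq> 0" by (simp_all add: reg_zeta_1)
    from tendsto_logderiv_along_ray[OF reg_zeta_holomorphic S this] show ?thesis .
  qed
  obtain m0 where m0': "(m0 = 0 \<longleftrightarrow> reg_zeta (Complex 1 0) \<noteq> 0) \<and> (?L (Complex 1 0) \<longlongrightarrow> of_nat m0) (at_right 0)"
    using ord[of 0] ..
  obtain m1 where m1': "(m1 = 0 \<longleftrightarrow> reg_zeta (Complex 1 t) \<noteq> 0) \<and> (?L (Complex 1 t) \<longlongrightarrow> of_nat m1) (at_right 0)"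
    using ord[of t] ..
  obtain m2 where m2': "(m2 = 0 \<longleftrightarrow> reg_zeta (Complex 1 (2 * t)) \<noteq> 0) \<and> (?L (Complex 1 (2 * t)) \<longlongrightarrow> of_nat m2) (at_right 0)"
    using ord[of "2 * t"] ..
  note m0 = conjunct1[OF m0'] conjunct2[OF m0'] and m1 = conjunct1[OF m1'] conjunct2[OF m1']
    and m2 = conjunct2[OF m2']
  have m: "m0 = 0" "m1 \<ge> 1" using m0 m1 0 reg_zeta_1 one by auto
  have V: "eventually (\<lambda>x. of_real x * mangoldt_series (Complex (1 + x) y)
      = of_real x / (Complex x y) - ?L (Complex 1 y) x) (at_right 0)" for y
    using eventually_at_right_less[of 0]
  proof eventually_elim
    case (elim x)
    have e: "Complex 1 y + of_real x = Complex (1 + x) y" "Complex (1 + x) y - 1 = Complex x y"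
      by (auto simp: complex_eq_iff)
    have "deriv reg_zeta (Complex (1 + x) y) / reg_zeta (Complex (1 + x) y)
        = 1 / (Complex (1 + x) y - 1) - mangoldt_series (Complex (1 + x) y)"
      using elim by (intro reg_zeta_logderiv_eq) simp
    then show ?case unfolding e by (simp add: right_diff_distrib)
  qed
  have lim: "((\<lambda>x. of_real x * mangoldt_series (Complex (1 + x) y)) \<longlongrightarrow> l - of_nat k) (at_right 0)"
    if "((\<lambda>x. of_real x / Complex x y) \<longlongrightarrow> l) (at_right 0)" "(?L (Complex 1 y) \<longlongrightarrow> of_nat k) (at_right 0)" for y l k
    unfolding tendsto_cong[OF V] by (intro tendsto_diff that)
  have l0: "((\<lambda>x. of_real x / Complex x 0) \<longlongrightarrow> 1) (at_right 0)"
  proof (rule tendsto_eventually)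
    show "eventually (\<lambda>x. of_real x / Complex x 0 = 1) (at_right 0)"
      using eventually_at_right_less[of 0] by eventually_elim (auto simp: complex_of_real_def[symmetric])
  qed
  have ly: "((\<lambda>x. of_real x / Complex x y) \<longlongrightarrow> 0) (at_right 0)" if "y \<noteq> 0" for y
  proof -
    have "((\<lambda>x. of_real x / Complex x y) \<longlongrightarrow> of_real 0 / (of_real 0 + \<i> * of_real y)) (at_right 0)"
      unfolding Complex_eq using that by (intro tendsto_intros) auto
    then show ?thesis by simp
  qed
  have "((\<lambda>x. 3 * Re (of_real x * mangoldt_series (Complex (1 + x) 0))
      + 4 * Re (of_real x * mangoldt_series (Complex (1 + x) t))
      + Re (of_real x * mangoldt_series (Complex (1 + x) (2 * t))))
     \<longlongrightarrow> 3 * Re (1 - of_nat m0) + 4 * Re (0 - of_nat m1) + Re (0 - of_nat m2)) (at_right 0)"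
    using t by (intro tendsto_intros lim l0 ly m0 m1 m2) auto
  moreover have "eventually (\<lambda>x. 3 * Re (of_real x * mangoldt_series (Complex (1 + x) 0))
      + 4 * Re (of_real x * mangoldt_series (Complex (1 + x) t))
      + Re (of_real x * mangoldt_series (Complex (1 + x) (2 * t))) \<ge> 0) (at_right 0)"
    using eventually_at_right_less[of 0]
  proof eventually_elim
    case (elim x)
    then have "0 \<le> x * (3 * Re (mangoldt_series (Complex (1 + x) 0)) + 4 * Re (mangoldt_series (Complex (1 + x) t))
     + Re (mangoldt_series (Complex (1 + x) (2 * t))))"
      by (intro mult_nonneg_nonneg mangoldt_series_3_4_1) auto
    then show ?case by (simp add: algebra_simps)
  qed
  ultimately have "0 \<le> 3 * Re (1 - of_nat m0) + 4 * Re (0 - of_nat m1) + Re (0 - of_nat m2)"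
    by (rule tendsto_lowerbound) simp
  then have "4 * real m1 + real m2 \<le> 3" using m by simp
  moreover have "real m1 \<ge> 1" "real m2 \<ge> 0" using m by auto
  ultimately show False by linarith
qed

section \<open>The logarithmic derivative of zeta under the Riemann Hypothesis\<close>

text \<open>
  The hypothesis speaks of the open strip; the half-plane to its right has just been shown to be free
  of zeros.
\<close>
lemma Re_reg_zeta_zero:
  assumes RH: "riemann_hypothesis" and s: "Re s > 0" "reg_zeta s = 0"
  shows "Re s = 1 / 2"
proof -
  have "\<not> Re s > 1"
  proof
    assume "Re s > 1"
    then have "zeta_series s \<noteq> 0" "s \<noteq> 1" "reg_zeta s = (s - 1) * zeta_series s"
      by (auto simp: zeta_series_nonzero reg_zeta_eq_series)
    then show False using s by simp
  qed
  moreover have "Re s \<noteq> 1"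
  proof
    assume "Re s = 1"
    then have "s = Complex 1 (Im s)" by (simp add: complex_eq_iff)
    then show False using reg_zeta_nonzero_on_line_1[of "Im s"] s by simp
  qed
  ultimately have 1: "Re s < 1" by simp
  then have "s \<noteq> 1" by auto
  then have "riemann_zeta s = 0" using reg_zeta_eq[OF s(1)] s(2) by simp
  then show ?thesis using RH s(1) 1 by (simp add: riemann_hypothesis_def)
qed

lemma ln_3_ge_1: "ln (3::real) \<ge> 1"
  using exp_le by (simp add: ln_ge_iff)

text \<open>
  Apply \<open>norm_logderiv_le\<close> in the disc of radius 29/10 around \<open>3 + i t\<close>. It stays in
  \<open>Re s \<ge> 1/10\<close>, where \<open>reg_zeta\<close> is polynomially bounded, and the concentric disc of radius 5/2
  contains all points of height \<open>t\<close> with \<open>1/2 < Re s \<le> 2\<close>. Under the Riemann Hypothesis all zeros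
  have real part 1/2, so their distance from \<open>s\<close> is at least \<open>Re s - 1/2\<close>.
\<close>
lemma reg_zeta_logderiv_bound:
  assumes RH: "riemann_hypothesis"
  obtains A where "A > 0"
    "\<And>s. 1 / 2 < Re s \<Longrightarrow> Re s \<le> 2 \<Longrightarrow>
       norm (deriv reg_zeta s / reg_zeta s) \<le> A * ln (\<bar>Im s\<bar> + 3) / (Re s - 1 / 2)"
proof -
  obtain C where C: "C > 0" "\<And>s. Re s \<ge> 1 / 10 \<Longrightarrow> norm (reg_zeta s) \<le> C * (1 + norm s)\<^sup>2"
    using reg_zeta_bound by blast
  define D where "D = max 1 C"
  have D: "D \<ge> 1" "C \<le> D" by (auto simp: D_def)
  define q :: real where "q = 25 / 29"
  define q' :: real where "q' = 27 / 29"
  define a1 where "a1 = 1 / ln (1 / q')"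
  define a2 where "a2 = 8 * q' / (q' - q)\<^sup>2 / (29 / 10)"
  have a: "a1 > 0" "a2 > 0" by (auto simp: a1_def a2_def q_def q'_def)
  define E where "E = ln D + 4"
  have E: "E \<ge> 4" using D by (simp add: E_def)
  define A where "A = (a1 * E + 1) * 9 + (1 + E) * a2 * 2"
  have A: "A > 0" using a E by (auto simp: A_def intro!: add_pos_nonneg)
  have "norm (deriv reg_zeta s / reg_zeta s) \<le> A * ln (\<bar>Im s\<bar> + 3) / (Re s - 1 / 2)"
    if s: "1 / 2 < Re s" "Re s \<le> 2" for s
  proof -
    define t where "t = Im s"
    define \<eta> where "\<eta> = Re s - 1 / 2"
    have \<eta>: "0 < \<eta>" "\<eta> \<le> 3 / 2" using s by (auto simp: \<eta>_def)
    define c where "c = Complex 3 t"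
    define L where "L = ln (\<bar>t\<bar> + 3)"
    have L: "L \<ge> 1" unfolding L_def using ln_3_ge_1 ln_le_cancel_iff[of 3 "\<bar>t\<bar> + 3"] by linarith
    define M where "M = ln (D * (7 + \<bar>t\<bar>)\<^sup>2)"
    have M_exp: "exp M = D * (7 + \<bar>t\<bar>)\<^sup>2" unfolding M_def using D by (intro exp_ln) (auto intro!: mult_pos_pos)
    have c1: "norm (reg_zeta c) \<ge> 1" unfolding c_def by (rule norm_reg_zeta_3)
    have M: "M \<le> E * L"
    proof -
      have "7 + \<bar>t\<bar> \<le> (\<bar>t\<bar> + 3)\<^sup>2" by (simp add: power2_eq_square algebra_simps)
      then have "ln (7 + \<bar>t\<bar>) \<le> ln ((\<bar>t\<bar> + 3)\<^sup>2)" by (intro ln_mono) auto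
      also have "\<dots> = 2 * L" unfolding L_def by (subst ln_realpow) auto
      finally have *: "ln (7 + \<bar>t\<bar>) \<le> 2 * L" .
      have "M = ln D + 2 * ln (7 + \<bar>t\<bar>)"
        unfolding M_def using D by (subst ln_mult) (auto simp: ln_realpow)
      also have "\<dots> \<le> ln D * L + 4 * L" using * L D mult_left_mono[of 1 L "ln D"] by simp
      finally show ?thesis by (simp add: E_def algebra_simps)
    qed
    have Reball: "Re w > 1 / 10" "norm w < 6 + \<bar>t\<bar>" if "norm (w - c) < 29 / 10" for w
    proof -
      have "\<bar>Re w - 3\<bar> \<le> norm (w - c)" using abs_Re_le_cmod[of "w - c"] by (simp add: c_def)
      then show "Re w > 1 / 10" using that by linarith
      have "norm c \<le> 3 + \<bar>t\<bar>" using cmod_le[of c] by (simp add: c_def)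
      then show "norm w < 6 + \<bar>t\<bar>" using that norm_triangle_sub[of w c] by linarith
    qed
    have "norm (deriv reg_zeta s / reg_zeta s)
      \<le> (M / ln (1 / q') + 1) * (1 / \<eta> + 1 / ((29 / 10) * (1 - q'))) + (1 + M) * (8 * q' / (q' - q)\<^sup>2) / (29 / 10)"
    proof (rule norm_logderiv_le[where c = c and R = "29 / 10" and q = q and q' = q' and M = M and \<eta> = \<eta> and f = reg_zeta and z = s])
      show "reg_zeta holomorphic_on ball c (29 / 10)"
      proof (rule holomorphic_on_subset[OF reg_zeta_holomorphic], rule subsetI)
        fix w assume "w \<in> ball c (29 / 10)"
        then have "norm (w - c) < 29 / 10" by (simp add: dist_norm norm_minus_commute)
        then show "w \<in> {s. 0 < Re s}" using Reball(1)[of w] by simp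
      qed
      show "norm (reg_zeta w) \<le> exp M * norm (reg_zeta c)" if w: "norm (w - c) < 29 / 10" for w
      proof -
        have "norm (reg_zeta w) \<le> C * (1 + norm w)\<^sup>2" using Reball[OF w] by (intro C) auto
        also have "\<dots> \<le> D * (7 + \<bar>t\<bar>)\<^sup>2"
          using Reball[OF w] C D by (intro mult_mono power_mono) auto
        also have "\<dots> \<le> exp M * norm (reg_zeta c)"
          unfolding M_exp using mult_left_mono[OF c1, of "D * (7 + \<bar>t\<bar>)\<^sup>2"] D by simp
        finally show ?thesis .
      qed
      show "reg_zeta c \<noteq> 0" using c1 by auto
      have "s - c = of_real (Re s - 3)" by (simp add: c_def t_def complex_eq_iff)
      then have "norm (s - c) = \<bar>Re s - 3\<bar>" by (simp only: norm_of_real)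
      then show "norm (s - c) \<le> q * (29 / 10)" using s by (simp add: q_def)
      show "\<eta> \<le> norm (s - b)" if b: "norm (b - c) < 29 / 10" "reg_zeta b = 0" for b
      proof -
        have "Re b = 1 / 2" using Reball(1)[OF b(1)] b(2) by (intro Re_reg_zeta_zero[OF RH]) auto
        then show ?thesis using complex_Re_le_cmod[of "s - b"] by (simp add: \<eta>_def)
      qed
    qed (use \<eta> in \<open>auto simp: q_def q'_def\<close>)
    also have "\<dots> = (a1 * M + 1) * (1 / \<eta> + 5) + (1 + M) * a2"
      by (simp add: a1_def a2_def q_def q'_def)
    also have "\<dots> \<le> (a1 * E + 1) * L * (9 / \<eta>) + (1 + E) * L * a2 * (2 / \<eta>)"
    proof -
      have 1: "a1 * M + 1 \<le> (a1 * E + 1) * L"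
      proof -
        have "a1 * M \<le> a1 * (E * L)" using M a by (intro mult_left_mono) auto
        then show ?thesis using L by (simp add: algebra_simps)
      qed
      have 2: "1 / \<eta> + 5 \<le> 9 / \<eta>" using \<eta> by (simp add: field_simps)
      have "1 + M \<le> (1 + E) * L" using M L by (simp add: algebra_simps)
      then have "(1 + M) * a2 \<le> (1 + E) * L * a2" using a by (intro mult_right_mono) auto
      also have "\<dots> \<le> (1 + E) * L * a2 * (2 / \<eta>)"
      proof -
        have "(1 + E) * L * a2 * 1 \<le> (1 + E) * L * a2 * (2 / \<eta>)"
          using \<eta> E L a by (intro mult_left_mono) auto
        then show ?thesis by simp
      qed
      finally have 3: "(1 + M) * a2 \<le> (1 + E) * L * a2 * (2 / \<eta>)" .
      have "(a1 * M + 1) * (1 / \<eta> + 5) \<le> (a1 * E + 1) * L * (9 / \<eta>)"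
        using 1 2 \<eta> a E L by (intro mult_mono) auto
      with 3 show ?thesis by simp
    qed
    also have "\<dots> = A * L / \<eta>"
      by (simp add: A_def add_divide_distrib[symmetric]) (simp add: algebra_simps)
    finally show ?thesis by (simp add: L_def t_def \<eta>_def)
  qed
  then show ?thesis using A by (intro that[of A]) auto
qed

section \<open>The Laplace transform of Chebyshev's function\<close>

lemma exp_tail_integral:
  fixes s :: complex
  assumes s: "Re s > 0"
  shows "integrable lborel (\<lambda>v. indicator {a..} v *\<^sub>R exp (- s * of_real v))"
    and "(\<integral>v. indicator {a..} v *\<^sub>R exp (- s * of_real v) \<partial>lborel) = exp (- s * of_real a) / s"
    and "(\<integral>v. norm (indicator {a..} v *\<^sub>R exp (- s * of_real v)) \<partial>lborel) = exp (- Re s * a) / Re s"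
proof -
  let ?f = "\<lambda>v. indicator {a..} v *\<^sub>R exp (- s * of_real v)"
  let ?\<sigma> = "Re s"
  have [measurable]: "(\<lambda>v. exp (- s * complex_of_real v)) \<in> borel_measurable borel"
    by (intro borel_measurable_continuous_onI continuous_intros)
  have nf: "norm (?f v) = exp (- ?\<sigma> * v) * indicator {a..} v" for v
    by (simp add: norm_exp_eq_Re indicator_def)
  have lim: "((\<lambda>v. - exp (- ?\<sigma> * v) / ?\<sigma>) \<longlongrightarrow> 0) at_top"
    using s by real_asymp
  have nn: "(\<integral>\<^sup>+v. ennreal (norm (?f v)) \<partial>lborel) = ennreal (exp (- ?\<sigma> * a) / ?\<sigma>)"
  proof -
    have "(\<integral>\<^sup>+v. ennreal (exp (- ?\<sigma> * v)) * indicator {a..} v \<partial>lborel) = ennreal (0 - (- exp (- ?\<sigma> * a) / ?\<sigma>))"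
    proof (rule nn_integral_FTC_atLeast[OF _ _ _ lim])
      show "((\<lambda>v. - exp (- ?\<sigma> * v) / ?\<sigma>) has_real_derivative exp (- ?\<sigma> * x)) (at x)" for x
        using s by (auto intro!: derivative_eq_intros)
    qed auto
    moreover have "ennreal (norm (?f v)) = ennreal (exp (- ?\<sigma> * v)) * indicator {a..} v" for v
      unfolding nf by (simp add: indicator_def)
    ultimately show ?thesis by simp
  qed
  show int: "integrable lborel ?f"
    by (rule integrableI_bounded) (simp_all add: nn[simplified])
  have nint: "integrable lborel (\<lambda>v. norm (?f v))" by (rule integrable_norm[OF int])
  have "ennreal (\<integral>v. norm (?f v) \<partial>lborel) = ennreal (exp (- ?\<sigma> * a) / ?\<sigma>)"
    unfolding nn[symmetric] by (rule nn_integral_eq_integral[symmetric, OF nint]) auto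
  then show "(\<integral>v. norm (?f v) \<partial>lborel) = exp (- ?\<sigma> * a) / ?\<sigma>"
    using s by (subst (asm) ennreal_inj) (auto intro!: integral_nonneg_AE)
  define P where "P v = - exp (- s * of_real v) / s" for v :: real
  have s0: "s \<noteq> 0" using s by auto
  have ftc: "(\<integral>v. indicator {a..a + real n} v *\<^sub>R exp (- s * of_real v) \<partial>lborel) = P (a + real n) - P a" for n
  proof (rule integral_FTC_Icc)
    fix x :: real
    have "((\<lambda>z. - exp (- s * z) / s) has_field_derivative exp (- s * of_real x)) (at (of_real x))"
      using s0 by (auto intro!: derivative_eq_intros)
    then have "(P has_vector_derivative exp (- s * of_real x)) (at x)"
      unfolding P_def by (rule has_vector_derivative_real_field)
    then show "(P has_vector_derivative exp (- s * of_real x)) (at x within {a..a + real n})"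
      by (rule has_vector_derivative_at_within)
  qed (auto intro!: continuous_intros)
  have "(\<lambda>n. P (a + real n) - P a) \<longlonglongrightarrow> integral\<^sup>L lborel ?f"
    unfolding ftc[symmetric]
  proof (rule integral_dominated_convergence[OF _ _ nint])
    show "AE v in lborel. (\<lambda>n. indicator {a..a + real n} v *\<^sub>R exp (- s * of_real v)) \<longlonglongrightarrow> ?f v"
    proof (intro AE_I2)
      fix v :: real
      obtain N :: nat where N: "v - a \<le> real N" using real_arch_simple by blast
      have "eventually (\<lambda>n. indicator {a..a + real n} v *\<^sub>R exp (- s * of_real v) = ?f v) sequentially"
        using eventually_ge_at_top[of N]
      proof eventually_elim
        case (elim n)
        then have "real N \<le> real n" by simp
        then show ?case using N by (auto simp: indicator_def)
      qed
      then show "(\<lambda>n. indicator {a..a + real n} v *\<^sub>R exp (- s * of_real v)) \<longlonglongrightarrow> ?f v"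
        by (rule tendsto_eventually)
    qed
    show "AE v in lborel. norm (indicator {a..a + real n} v *\<^sub>R exp (- s * of_real v)) \<le> norm (?f v)" for n
      by (intro AE_I2) (auto simp: indicator_def)
  qed auto
  moreover have "(\<lambda>n. P (a + real n) - P a) \<longlonglongrightarrow> 0 - P a"
  proof (rule tendsto_diff[OF tendsto_norm_zero_cancel tendsto_const])
    have "norm (P (a + real n)) = exp (- ?\<sigma> * (a + real n)) / norm s" for n
      by (simp add: P_def norm_divide norm_exp_eq_Re)
    moreover have "(\<lambda>n. exp (- ?\<sigma> * (a + real n)) / norm s) \<longlonglongrightarrow> 0"
      by (rule tendsto_divide_zero) (use s in real_asymp)
    ultimately show "(\<lambda>n. norm (P (a + real n))) \<longlonglongrightarrow> 0" by simp
  qed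
  ultimately have "integral\<^sup>L lborel ?f = 0 - P a" by (rule LIMSEQ_unique)
  then show "integral\<^sup>L lborel ?f = exp (- s * of_real a) / s" by (simp add: P_def)
qed

definition cheb_psi :: "real \<Rightarrow> real" where
  "cheb_psi x = (\<Sum>n | 0 < n \<and> real n \<le> x. mangoldt n)"

text \<open>
  The main term \<open>x - 1\<close> instead of \<open>x\<close> makes the error vanish for \<open>x < 1\<close>, so its transform
  in \<open>ln x\<close> is an integral over a half-line; to the right of 1 its increments are those of
  \<open>cheb_psi x - x\<close>.
\<close>
definition psi_err :: "real \<Rightarrow> real" where
  "psi_err x = cheb_psi x - max 0 (x - 1)"

lemma finite_nat_le_real: "finite {n. 0 < n \<and> real n \<le> x}"
  by (rule finite_subset[of _ "{..nat \<lfloor>x\<rfloor>}"]) (auto simp: le_nat_floor)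

lemma cheb_psi_nonneg: "cheb_psi x \<ge> 0"
  unfolding cheb_psi_def by (intro sum_nonneg mangoldt_nonneg)

lemma cheb_psi_mono: "mono cheb_psi"
  unfolding cheb_psi_def by (intro monoI sum_mono2 finite_nat_le_real mangoldt_nonneg) auto

lemma cheb_psi_le: "x > 0 \<Longrightarrow> cheb_psi x \<le> x\<^sup>2"
proof -
  assume x: "x > 0"
  have "cheb_psi x \<le> real (card {n. 0 < n \<and> real n \<le> x}) * x"
    unfolding cheb_psi_def
  proof (rule sum_bounded_above)
    fix n assume n: "n \<in> {n. 0 < n \<and> real n \<le> x}"
    have "mangoldt n \<le> ln (real n)" using n by (intro mangoldt_le_ln) auto
    also have "\<dots> \<le> real n" using n ln_bound[of "real n"] by simp
    finally show "mangoldt n \<le> x" using n by simp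
  qed
  also have "\<dots> \<le> x * x"
  proof (intro mult_right_mono)
    have "{n. 0 < n \<and> real n \<le> x} \<subseteq> {1..nat \<lfloor>x\<rfloor>}" by (auto simp: le_nat_floor)
    then have "card {n. 0 < n \<and> real n \<le> x} \<le> card {1..nat \<lfloor>x\<rfloor>}" by (intro card_mono) auto
    then have "real (card {n. 0 < n \<and> real n \<le> x}) \<le> real (nat \<lfloor>x\<rfloor>)" by simp
    also have "\<dots> \<le> x" using x by simp
    finally show "real (card {n. 0 < n \<and> real n \<le> x}) \<le> x" .
  qed (use x in auto)
  finally show ?thesis by (simp add: power2_eq_square)
qed

lemma psi_err_bound:
  assumes x: "x > 0"
  shows "\<bar>psi_err x\<bar> \<le> x\<^sup>2"
proof -
  have "x - 1 \<le> x\<^sup>2" using sum_squares_bound[of 1 x] x by simp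
  then have "0 \<le> max 0 (x - 1)" "max 0 (x - 1) \<le> x\<^sup>2" by auto
  with cheb_psi_le[OF x] cheb_psi_nonneg[of x] show ?thesis unfolding psi_err_def by linarith
qed

lemma borel_measurable_psi_err [measurable]: "psi_err \<in> borel_measurable borel"
proof -
  have [measurable]: "cheb_psi \<in> borel_measurable borel" by (rule borel_measurable_mono[OF cheb_psi_mono])
  show ?thesis unfolding psi_err_def by measurable
qed

lemma isCont_psi_err:
  assumes "x \<notin> range real" "x > 0"
  shows "isCont psi_err x"
proof -
  define k where "k = nat \<lfloor>x\<rfloor>"
  have k: "real k \<le> x" "x < real k + 1" using assms(2) by (auto simp: k_def)
  have "real k \<noteq> x" using assms(1) by auto
  then have k: "real k < x" "x < real k + 1" using k by auto
  have "eventually (\<lambda>y. y \<in> {real k<..<real k + 1}) (nhds x)"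
    using k by (intro eventually_nhds_in_open) auto
  then have "eventually (\<lambda>y. cheb_psi y = cheb_psi x) (nhds x)"
  proof eventually_elim
    case (elim y)
    have "real n \<le> y \<longleftrightarrow> n \<le> k" for n
      using elim by (auto simp flip: of_nat_Suc)
    moreover have "real n \<le> x \<longleftrightarrow> n \<le> k" for n
      using k by (auto simp flip: of_nat_Suc)
    ultimately show ?case by (simp add: cheb_psi_def)
  qed
  from isCont_cong[OF this] have "isCont cheb_psi x" by simp
  then show ?thesis unfolding psi_err_def by (intro continuous_intros) auto
qed

lemma ln_le_iff_le_exp: "x > 0 \<Longrightarrow> ln x \<le> v \<longleftrightarrow> x \<le> exp v" for x v :: real
  by (metis exp_le_cancel_iff exp_ln)

lemma exp_ln_nat_powr: "exp (- (s::complex) * of_real (ln (real (Suc n)))) = of_nat (Suc n) powr (- s)"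
  by (simp add: powr_def Ln_of_nat_Suc del: of_nat_Suc)

text \<open>
  \<open>cheb_psi (exp v)\<close> is the sum of \<open>mangoldt n\<close> times the step function that jumps at \<open>ln n\<close>; the
  series may be integrated term by term since it converges absolutely for \<open>Re s > 1\<close>.
\<close>
lemma cheb_psi_transform:
  assumes s: "Re s > 1"
  shows "integrable lborel (\<lambda>v. of_real (cheb_psi (exp v)) * exp (- s * of_real v))"
    and "(\<integral>v. of_real (cheb_psi (exp v)) * exp (- s * of_real v) \<partial>lborel) = mangoldt_series s / s"
proof -
  define f where "f n v = of_real (mangoldt (Suc n)) * (indicator {ln (real (Suc n))..} v *\<^sub>R exp (- s * of_real v))" for n and v :: real
  have s0: "Re s > 0" using s by simp
  note tail = exp_tail_integral[OF s0]
  have f_int: "integrable lborel (f n)" for n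
    unfolding f_def by (intro integrable_mult_right tail)
  have f_val: "integral\<^sup>L lborel (f n) = mangoldt (Suc n) * of_nat (Suc n) powr (- s) / s" for n
    unfolding f_def by (simp only: integral_mult_right_zero tail exp_ln_nat_powr) simp
  have f_norm: "(\<integral>v. norm (f n v) \<partial>lborel) = norm (mangoldt (Suc n) * of_nat (Suc n) powr (- s) :: complex) / Re s" for n
  proof -
    have "(\<integral>v. norm (f n v) \<partial>lborel) = (\<integral>v. mangoldt (Suc n) * norm (indicator {ln (real (Suc n))..} v *\<^sub>R exp (- s * of_real v)) \<partial>lborel)"
      unfolding f_def norm_mult by (simp add: mangoldt_nonneg)
    also have "\<dots> = mangoldt (Suc n) * (exp (- Re s * ln (real (Suc n))) / Re s)"
      by (simp only: integral_mult_right_zero tail)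
    also have "exp (- Re s * ln (real (Suc n))) = real (Suc n) powr (- Re s)" by (simp add: powr_def)
    finally show ?thesis using norm_nat_powr[of n "- s"] by (simp add: norm_mult del: of_nat_Suc)
  qed
  have fin: "finite {n. ln (real (Suc n)) \<le> v}" for v
  proof (rule finite_subset)
    show "{n. ln (real (Suc n)) \<le> v} \<subseteq> {n. 0 < n \<and> real n \<le> exp v} \<union> {0}"
      using ln_le_iff_le_exp[of "real (Suc n)" v for n] by auto
  qed (use finite_nat_le_real in auto)
  have f_sums: "(\<lambda>n. f n v) sums (of_real (cheb_psi (exp v)) * exp (- s * of_real v))" for v
  proof -
    have "(\<lambda>n. f n v) sums (\<Sum>n | ln (real (Suc n)) \<le> v. f n v)"
      by (rule sums_finite[OF fin]) (auto simp: f_def)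
    also have "(\<Sum>n | ln (real (Suc n)) \<le> v. f n v) = (\<Sum>n | ln (real (Suc n)) \<le> v. of_real (mangoldt (Suc n)) * exp (- s * of_real v))"
      by (intro sum.cong refl) (auto simp: f_def)
    also have "\<dots> = of_real (\<Sum>n | ln (real (Suc n)) \<le> v. mangoldt (Suc n)) * exp (- s * of_real v)"
      by (simp only: of_real_sum sum_distrib_right)
    also have "(\<Sum>n | ln (real (Suc n)) \<le> v. mangoldt (Suc n)) = cheb_psi (exp v)"
      unfolding cheb_psi_def
    proof (rule sum.reindex_bij_witness[of _ "\<lambda>n. n - 1" Suc])
      show "Suc n \<in> {n. 0 < n \<and> real n \<le> exp v}" if "n \<in> {n. ln (real (Suc n)) \<le> v}" for n
        using that by (simp add: ln_le_iff_le_exp[symmetric] del: of_nat_Suc)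
      show "n - 1 \<in> {n. ln (real (Suc n)) \<le> v}" if "n \<in> {n. 0 < n \<and> real n \<le> exp v}" for n
        using that by (auto simp: ln_le_iff_le_exp[symmetric] del: of_nat_Suc)
    qed auto
    finally show ?thesis .
  qed
  have sumn: "summable (\<lambda>n. norm (f n v))" for v
    by (rule summable_finite[OF fin[of v]]) (auto simp: f_def)
  have sumi: "summable (\<lambda>n. \<integral>v. norm (f n v) \<partial>lborel)"
    unfolding f_norm by (intro summable_divide summable_norm_mangoldt_term s)
  have eq: "(\<lambda>v. \<Sum>n. f n v) = (\<lambda>v. of_real (cheb_psi (exp v)) * exp (- s * of_real v))"
    using sums_unique[OF f_sums] by auto
  have "integrable lborel (\<lambda>v. \<Sum>n. f n v)"
    by (rule integrable_suminf[OF f_int AE_I2[OF sumn] sumi])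
  then show "integrable lborel (\<lambda>v. of_real (cheb_psi (exp v)) * exp (- s * of_real v))" unfolding eq .
  have "integral\<^sup>L lborel (\<lambda>v. \<Sum>n. f n v) = (\<Sum>n. integral\<^sup>L lborel (f n))"
    by (rule integral_suminf[OF f_int AE_I2[OF sumn] sumi])
  also have "\<dots> = mangoldt_series s / s"
    unfolding f_val using sums_divide[OF mangoldt_series_sums[OF s], of s] by (rule sums_unique[symmetric])
  finally show "(\<integral>v. of_real (cheb_psi (exp v)) * exp (- s * of_real v) \<partial>lborel) = mangoldt_series s / s"
    unfolding eq .
qed

text \<open>
  The transform of \<open>exp v - 1\<close> on the half-line is \<open>1 / (s - 1) - 1 / s\<close>, which cancels the pole of
  the von Mangoldt series at 1.
\<close>
lemma psi_err_transform:
  assumes s: "Re s > 1"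
  shows "integrable lborel (\<lambda>v. of_real (psi_err (exp v)) * exp (- s * of_real v))"
    and "(\<integral>v. of_real (psi_err (exp v)) * exp (- s * of_real v) \<partial>lborel) = - (deriv reg_zeta s / reg_zeta s) / s"
proof -
  let ?g = "\<lambda>s v. indicator {0..} v *\<^sub>R exp (- s * of_real v)"
  have s0: "Re s > 0" "Re (s - 1) > 0" using s by auto
  have eq: "(\<lambda>v. of_real (psi_err (exp v)) * exp (- s * of_real v))
      = (\<lambda>v. of_real (cheb_psi (exp v)) * exp (- s * of_real v) - (?g (s - 1) v - ?g s v))"
  proof
    fix v :: real
    have "of_real (max 0 (exp v - 1)) * exp (- s * of_real v) = ?g (s - 1) v - ?g s v"
    proof (cases "v \<ge> 0")
      case True
      then have "max 0 (exp v - 1) = exp v - 1" by simp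
      then have "of_real (max 0 (exp v - 1)) * exp (- s * of_real v) = exp (of_real v) * exp (- s * of_real v) - exp (- s * of_real v)"
        by (simp add: left_diff_distrib exp_of_real)
      also have "exp (of_real v) * exp (- s * of_real v) = exp (- (s - 1) * of_real v)"
        by (simp add: algebra_simps flip: exp_add)
      finally show ?thesis using True by simp
    next
      case False
      then have "max 0 (exp v - 1) = 0" by simp
      then show ?thesis using False by simp
    qed
    then show "of_real (psi_err (exp v)) * exp (- s * of_real v)
        = of_real (cheb_psi (exp v)) * exp (- s * of_real v) - (?g (s - 1) v - ?g s v)"
      by (simp only: psi_err_def of_real_diff left_diff_distrib)
  qed
  note t1 = exp_tail_integral[OF s0(1), of 0] and t2 = exp_tail_integral[OF s0(2), of 0]
    and t3 = cheb_psi_transform[OF s]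
  show "integrable lborel (\<lambda>v. of_real (psi_err (exp v)) * exp (- s * of_real v))"
    unfolding eq by (intro Bochner_Integration.integrable_diff t1 t2 t3)
  have "(\<integral>v. of_real (psi_err (exp v)) * exp (- s * of_real v) \<partial>lborel)
      = mangoldt_series s / s - (exp (- (s - 1) * of_real 0) / (s - 1) - exp (- s * of_real 0) / s)"
    unfolding eq using t1(1) t2(1) t3(1)
    by (simp only: Bochner_Integration.integral_diff Bochner_Integration.integrable_diff t1(2) t2(2) t3(2))
  also have "\<dots> = - (1 / (s - 1) - mangoldt_series s) / s"
  proof -
    have "s \<noteq> 0" "s - 1 \<noteq> 0" using s0 by auto
    moreover have "v / z - (1 / (z - 1) - 1 / z) = - (1 / (z - 1) - v) / z" if "z \<noteq> 0" "z - 1 \<noteq> 0" for z v :: complex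
      using that by (simp add: divide_simps)
    ultimately show ?thesis by simp
  qed
  also have "1 / (s - 1) - mangoldt_series s = deriv reg_zeta s / reg_zeta s"
    using reg_zeta_logderiv_eq[OF s] by simp
  finally show "(\<integral>v. of_real (psi_err (exp v)) * exp (- s * of_real v) \<partial>lborel) = - (deriv reg_zeta s / reg_zeta s) / s" .
qed

section \<open>Mean square of Chebyshev's function over multiplicative windows\<close>

text \<open>
  The increment of the error over the window from \<open>exp u\<close> to \<open>exp (u + \<theta>)\<close>. In the
  logarithmic variable a window of constant ratio is a translation.
\<close>
definition psi_window :: "real \<Rightarrow> real \<Rightarrow> real" where
  "psi_window \<theta> u = psi_err (exp (u + \<theta>)) - psi_err (exp u)"

text \<open>
  The continuation to \<open>Re s > 1/2\<close> of the Laplace transform of \<open>psi_window \<theta>\<close>.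
\<close>
definition window_transform :: "real \<Rightarrow> complex \<Rightarrow> complex" where
  "window_transform \<theta> s = - (deriv reg_zeta s / reg_zeta s) * ((exp (s * of_real \<theta>) - 1) / s)"

lemma borel_measurable_psi_window [measurable]:
  "psi_window \<theta> \<in> borel_measurable borel"
  "case_prod psi_window \<in> borel_measurable (lborel \<Otimes>\<^sub>M lborel)"
  unfolding psi_window_def by measurable

lemma psi_window_transform:
  assumes s: "Re s > 1"
  shows "integrable lborel (\<lambda>v. of_real (psi_window \<theta> v) * exp (- s * of_real v))"
    and "(\<integral>v. of_real (psi_window \<theta> v) * exp (- s * of_real v) \<partial>lborel) = window_transform \<theta> s"
proof -
  let ?f = "\<lambda>v. complex_of_real (psi_err (exp v)) * exp (- s * of_real v)"
  note t = psi_err_transform[OF s]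
  have eq: "of_real (psi_window \<theta> v) * exp (- s * of_real v) = exp (s * of_real \<theta>) * ?f (\<theta> + 1 * v) - ?f v" for v
  proof -
    have "exp (s * of_real \<theta>) * exp (- s * of_real (\<theta> + 1 * v)) = exp (- s * of_real v)"
      by (simp add: algebra_simps flip: exp_add)
    then have t1: "exp (s * of_real \<theta>) * ?f (\<theta> + 1 * v) = of_real (psi_err (exp (\<theta> + 1 * v))) * exp (- s * of_real v)"
      by (metis (no_types, lifting) mult.left_commute)
    show ?thesis unfolding t1 by (simp add: psi_window_def left_diff_distrib add.commute)
  qed
  have i1: "integrable lborel (\<lambda>v. ?f (\<theta> + 1 * v))"
    by (rule lborel_integrable_real_affine[OF t(1)]) simp
  have i2: "integral\<^sup>L lborel (\<lambda>v. ?f (\<theta> + 1 * v)) = integral\<^sup>L lborel ?f"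
    using lborel_integral_real_affine[of 1 ?f \<theta>] by simp
  show "integrable lborel (\<lambda>v. of_real (psi_window \<theta> v) * exp (- s * of_real v))"
    unfolding eq by (intro Bochner_Integration.integrable_diff integrable_mult_right i1 t)
  have "(\<integral>v. of_real (psi_window \<theta> v) * exp (- s * of_real v) \<partial>lborel)
      = exp (s * of_real \<theta>) * integral\<^sup>L lborel ?f - integral\<^sup>L lborel ?f"
    unfolding eq using i1 t(1)
    by (simp only: Bochner_Integration.integral_diff integrable_mult_right integral_mult_right_zero i2)
  also have "\<dots> = window_transform \<theta> s"
    unfolding t(2) window_transform_def by (simp add: diff_divide_distrib algebra_simps)
  finally show "(\<integral>v. of_real (psi_window \<theta> v) * exp (- s * of_real v) \<partial>lborel) = window_transform \<theta> s" .
qed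

lemma psi_window_bound: "\<bar>psi_window \<theta> v * exp (- 2 * v)\<bar> \<le> exp (2 * \<theta>) + 1"
proof -
  have "\<bar>psi_window \<theta> v\<bar> \<le> (exp (v + \<theta>))\<^sup>2 + (exp v)\<^sup>2"
    unfolding psi_window_def using psi_err_bound[of "exp (v + \<theta>)"] psi_err_bound[of "exp v"] by simp
  then have "\<bar>psi_window \<theta> v * exp (- 2 * v)\<bar> \<le> ((exp (v + \<theta>))\<^sup>2 + (exp v)\<^sup>2) * exp (- 2 * v)"
    unfolding abs_mult by (intro mult_mono) auto
  also have "\<dots> = exp (2 * \<theta>) + 1"
    by (simp add: distrib_right algebra_simps flip: exp_double exp_add)
  finally show ?thesis .
qed

text \<open>
  The jumps of the two terms lie at logarithms of natural numbers and at their translates.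
\<close>
lemma AE_isCont_psi_window: "AE u in lborel. isCont (psi_window \<theta>) u"
proof -
  define S where "S = (\<lambda>n. ln (real n)) ` UNIV \<union> (\<lambda>n. ln (real n) - \<theta>) ` UNIV"
  have "S \<in> null_sets lborel"
    unfolding S_def by (intro countable_imp_null_set_lborel countable_Un) auto
  then show ?thesis
  proof (rule AE_I', intro subsetI)
    fix u assume u: "u \<in> {u \<in> space lborel. \<not> isCont (psi_window \<theta>) u}"
    show "u \<in> S"
    proof (rule ccontr)
      assume "u \<notin> S"
      have "exp u \<noteq> real k" for k
      proof
        assume "exp u = real k"
        then have "u = ln (real k)" by (metis ln_exp)
        then show False using \<open>u \<notin> S\<close> by (auto simp: S_def)
      qed
      moreover have "exp (u + \<theta>) \<noteq> real k" for k
      proof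
        assume "exp (u + \<theta>) = real k"
        then have "u + \<theta> = ln (real k)" by (metis ln_exp)
        then have "u = ln (real k) - \<theta>" by simp
        then show False using \<open>u \<notin> S\<close> by (auto simp: S_def)
      qed
      ultimately have n: "exp u \<notin> range real" "exp (u + \<theta>) \<notin> range real" by blast+
      have "isCont (\<lambda>u. psi_err (exp (u + \<theta>)) - psi_err (exp u)) u"
        by (intro continuous_intros isCont_o2[of u "\<lambda>u. exp (u + \<theta>)" psi_err] isCont_o2[of u exp psi_err]
            isCont_psi_err n) auto
      then show False using u by (simp add: psi_window_def[abs_def])
    qed
  qed
qed

lemma norm_exp_minus_1_le:
  assumes z: "Re z \<le> 2"
  shows "norm (exp z - 1) \<le> exp 2 * norm z"
proof -
  have "norm (exp z - exp 0) \<le> exp 2 * norm (z - 0)"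
  proof (rule field_differentiable_bound[where S = "{z. Re z \<le> 2}" and f = exp and f' = exp])
    show "convex {z. Re z \<le> 2}" by (rule convex_halfspace_Re_le)
    show "(exp has_field_derivative exp w) (at w within {z. Re z \<le> 2})" for w
      by (rule has_field_derivative_at_within[OF DERIV_exp])
  qed (use z in \<open>auto simp: norm_exp_eq_Re\<close>)
  then show ?thesis by simp
qed

lemma exp_2_le: "exp (2::real) \<le> 8"
proof -
  have "exp (2::real) = exp 1 * exp 1" by (simp flip: exp_add)
  also have "\<dots> \<le> 2.8 * 2.8" using e_less_272 by (intro mult_mono) auto
  finally show ?thesis by simp
qed

text \<open>
  The factor is \<open>O(\<delta>)\<close> near the real axis and \<open>O(1 / |Im s|)\<close> far from it; the right side is
  comparable to the square of the smaller of the two.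
\<close>
lemma window_factor_bound:
  assumes s: "1 / 2 \<le> Re s" "Re s \<le> 2" and \<theta>: "0 \<le> \<theta>" "\<theta> \<le> \<delta>" "\<delta> \<le> 1" "\<delta> > 0"
  shows "(norm ((exp (s * of_real \<theta>) - 1) / s))\<^sup>2 \<le> 162 * \<delta>\<^sup>2 / (1 + \<delta>\<^sup>2 * (Im s)\<^sup>2)"
proof -
  define N where "N = norm ((exp (s * of_real \<theta>) - 1) / s)"
  have s0: "norm s > 0" using s by auto
  have Re: "Re (s * of_real \<theta>) \<le> 2"
  proof -
    have "Re s * \<theta> \<le> 2 * 1" using s \<theta> by (intro mult_mono) auto
    then show ?thesis by simp
  qed
  have 1: "N \<le> 9 * \<delta>"
  proof -
    have "norm (exp (s * of_real \<theta>) - 1) \<le> exp 2 * (norm s * \<theta>)"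
      using norm_exp_minus_1_le[OF Re] \<theta> by (simp add: norm_mult)
    then have "N \<le> exp 2 * \<theta>" unfolding N_def norm_divide using s0 by (simp add: divide_le_eq mult_ac)
    also have "\<dots> \<le> 9 * \<delta>" using exp_2_le \<theta> by (intro mult_mono) auto
    finally show ?thesis .
  qed
  have 2: "N * \<bar>Im s\<bar> \<le> 9"
  proof -
    have "norm (exp (s * of_real \<theta>) - 1) \<le> norm (exp (s * of_real \<theta>)) + 1"
      using norm_triangle_ineq4[of "exp (s * of_real \<theta>)" 1] by simp
    also have "norm (exp (s * of_real \<theta>)) \<le> exp 2" unfolding norm_exp_eq_Re using Re by simp
    finally have "norm (exp (s * of_real \<theta>) - 1) \<le> 9" using exp_2_le by simp
    then have "N * norm s \<le> 9" unfolding N_def norm_divide using s0 by simp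
    moreover have "N * \<bar>Im s\<bar> \<le> N * norm s" by (intro mult_left_mono abs_Im_le_cmod) (simp add: N_def)
    ultimately show ?thesis by simp
  qed
  have N0: "N \<ge> 0" by (simp add: N_def)
  have "N\<^sup>2 \<le> (9 * \<delta>)\<^sup>2" using 1 N0 by (intro power_mono) auto
  then have a: "N\<^sup>2 \<le> 81 * \<delta>\<^sup>2" by (simp add: power_mult_distrib)
  have "(N * \<bar>Im s\<bar>)\<^sup>2 \<le> 9\<^sup>2" using 2 N0 by (intro power_mono) auto
  then have b: "N\<^sup>2 * (Im s)\<^sup>2 \<le> 81" by (simp add: power_mult_distrib)
  have "N\<^sup>2 * (1 + \<delta>\<^sup>2 * (Im s)\<^sup>2) = N\<^sup>2 + \<delta>\<^sup>2 * (N\<^sup>2 * (Im s)\<^sup>2)" by (simp add: algebra_simps)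
  also have "\<dots> \<le> 81 * \<delta>\<^sup>2 + \<delta>\<^sup>2 * 81" using a b by (intro add_mono mult_left_mono) auto
  finally have "N\<^sup>2 * (1 + \<delta>\<^sup>2 * (Im s)\<^sup>2) \<le> 162 * \<delta>\<^sup>2" by simp
  moreover have "1 + \<delta>\<^sup>2 * (Im s)\<^sup>2 > 0" by (intro add_pos_nonneg) auto
  ultimately show ?thesis unfolding N_def by (simp add: pos_le_divide_eq)
qed

definition log_weight_integral :: ennreal where
  "log_weight_integral = (\<integral>\<^sup>+v. ennreal ((ln (\<bar>v\<bar> + 3))\<^sup>2 / (1 + v\<^sup>2)) \<partial>lborel)"

text \<open>
  The logarithm is at most four times the fourth root, so the integrand is \<open>O(v powr (- 3 / 2))\<close>.
\<close>
lemma log_weight_integral_finite: "log_weight_integral < \<top>"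
proof -
  let ?w = "\<lambda>v::real. (ln (\<bar>v\<bar> + 3))\<^sup>2 / (1 + v\<^sup>2)"
  let ?h = "\<lambda>v::real. 288 * (v + 3) powr (- 3 / 2)"
  have le: "?w v \<le> ?h v" if v: "v \<ge> 0" for v
  proof -
    define x where "x = v + 3"
    have x: "x \<ge> 3" using v by (simp add: x_def)
    have lnb: "(ln x)\<^sup>2 \<le> 16 * x powr (1 / 2)"
    proof -
      have "ln x \<le> 4 * x powr (1 / 4)" using ln_le_powr[of x "1 / 4"] x by simp
      then have "(ln x)\<^sup>2 \<le> (4 * x powr (1 / 4))\<^sup>2" using x by (intro power_mono) auto
      also have "\<dots> = 16 * (x powr (1 / 4) * x powr (1 / 4))" by (simp add: power2_eq_square)
      also have "x powr (1 / 4) * x powr (1 / 4) = x powr (1 / 2)" by (simp flip: powr_add)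
      finally show ?thesis .
    qed
    have "x\<^sup>2 \<le> 18 * (1 + v\<^sup>2)"
    proof -
      have "18 * (1 + v\<^sup>2) - x\<^sup>2 = (v - 3)\<^sup>2 + 16 * v\<^sup>2"
        by (simp add: x_def power2_eq_square algebra_simps)
      also have "\<dots> \<ge> 0" by simp
      finally show ?thesis by simp
    qed
    then have "1 / (1 + v\<^sup>2) \<le> 18 / x\<^sup>2"
      using x by (simp add: divide_simps add_pos_nonneg split: if_splits)
    then have "(ln x)\<^sup>2 * (1 / (1 + v\<^sup>2)) \<le> (16 * x powr (1 / 2)) * (18 / x\<^sup>2)"
      using lnb by (intro mult_mono) (auto simp: add_nonneg_nonneg)
    also have "\<dots> = 288 * (x powr (1 / 2) / x powr 2)" using x by simp
    also have "x powr (1 / 2) / x powr 2 = x powr (- 3 / 2)" by (simp flip: powr_diff)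
    finally show ?thesis using v by (simp add: x_def)
  qed
  have lim: "((\<lambda>v::real. - 576 * (v + 3) powr (- 1 / 2)) \<longlongrightarrow> 0) at_top" by real_asymp
  have half: "(\<integral>\<^sup>+v. ennreal (?w v) * indicator {0..} v \<partial>lborel) < \<top>"
  proof -
    have "(\<integral>\<^sup>+v. ennreal (?w v) * indicator {0..} v \<partial>lborel) \<le> (\<integral>\<^sup>+v. ennreal (?h v) * indicator {0..} v \<partial>lborel)"
    proof (intro nn_integral_mono)
      fix v :: real
      show "ennreal (?w v) * indicator {0..} v \<le> ennreal (?h v) * indicator {0..} v"
        using ennreal_leI[OF le[of v]] by (cases "v \<ge> 0") auto
    qed
    also have "\<dots> = ennreal (0 - (- 576 * (0 + 3) powr (- 1 / 2)))"
    proof (rule nn_integral_FTC_atLeast[OF _ _ _ lim])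
      show "((\<lambda>v. - 576 * (v + 3) powr (- 1 / 2)) has_real_derivative ?h x) (at x)" if "0 \<le> x" for x
        using that by (auto intro!: derivative_eq_intros simp: field_simps)
    qed auto
    finally show ?thesis by (rule le_less_trans) simp
  qed
  have half': "(\<integral>\<^sup>+v. ennreal (?w v) * indicator {..0} v \<partial>lborel) = (\<integral>\<^sup>+v. ennreal (?w v) * indicator {0..} v \<partial>lborel)"
    by (subst nn_integral_real_affine[where c = "-1" and t = 0]) (auto simp: indicator_def intro!: nn_integral_cong)
  have "log_weight_integral \<le> (\<integral>\<^sup>+v. ennreal (?w v) * indicator {0..} v + ennreal (?w v) * indicator {..0} v \<partial>lborel)"
    unfolding log_weight_integral_def by (intro nn_integral_mono) (auto simp: indicator_def)
  also have "\<dots> = (\<integral>\<^sup>+v. ennreal (?w v) * indicator {0..} v \<partial>lborel) + (\<integral>\<^sup>+v. ennreal (?w v) * indicator {..0} v \<partial>lborel)"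
    by (rule nn_integral_add) auto
  also have "\<dots> < \<top>" using half half' by simp
  finally show ?thesis .
qed

text \<open>
  Substitute \<open>t = v / \<delta>\<close> and use \<open>ln (|v| / \<delta> + 3) \<le> (1 + ln (1 / \<delta>)) * ln (|v| + 3)\<close>.
\<close>
lemma log_window_integral_le:
  assumes \<delta>: "0 < \<delta>" "\<delta> \<le> 1"
  shows "(\<integral>\<^sup>+t. ennreal ((ln (\<bar>t\<bar> + 3))\<^sup>2 * (\<delta>\<^sup>2 / (1 + \<delta>\<^sup>2 * t\<^sup>2))) \<partial>lborel)
    \<le> ennreal (\<delta> * (1 + ln (1 / \<delta>))\<^sup>2) * log_weight_integral"
proof -
  let ?w = "\<lambda>v::real. (ln (\<bar>v\<bar> + 3))\<^sup>2 / (1 + v\<^sup>2)"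
  have "(\<integral>\<^sup>+t. ennreal ((ln (\<bar>t\<bar> + 3))\<^sup>2 * (\<delta>\<^sup>2 / (1 + \<delta>\<^sup>2 * t\<^sup>2))) \<partial>lborel)
     = ennreal \<bar>1 / \<delta>\<bar> * (\<integral>\<^sup>+v. ennreal ((ln (\<bar>0 + 1 / \<delta> * v\<bar> + 3))\<^sup>2 * (\<delta>\<^sup>2 / (1 + \<delta>\<^sup>2 * (0 + 1 / \<delta> * v)\<^sup>2))) \<partial>lborel)"
    using \<delta> by (intro nn_integral_real_affine) auto
  also have "\<dots> = (\<integral>\<^sup>+v. ennreal \<bar>1 / \<delta>\<bar> * ennreal ((ln (\<bar>0 + 1 / \<delta> * v\<bar> + 3))\<^sup>2 * (\<delta>\<^sup>2 / (1 + \<delta>\<^sup>2 * (0 + 1 / \<delta> * v)\<^sup>2))) \<partial>lborel)"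
    by (rule nn_integral_cmult[symmetric]) measurable
  also have "\<dots> \<le> (\<integral>\<^sup>+v. ennreal (\<delta> * (1 + ln (1 / \<delta>))\<^sup>2) * ennreal (?w v) \<partial>lborel)"
  proof (intro nn_integral_mono)
    fix v :: real
    define b where "b = ln (\<bar>v\<bar> + 3)"
    have b: "b \<ge> 1" unfolding b_def using ln_3_ge_1 ln_le_cancel_iff[of 3 "\<bar>v\<bar> + 3"] by linarith
    have a: "ln (1 / \<delta>) \<ge> 0" using \<delta> by (intro ln_ge_zero) simp
    have "\<bar>1 / \<delta> * v\<bar> + 3 \<le> 1 / \<delta> * (\<bar>v\<bar> + 3)"
      using \<delta> by (simp add: abs_mult field_simps)
    then have "ln (\<bar>1 / \<delta> * v\<bar> + 3) \<le> ln (1 / \<delta> * (\<bar>v\<bar> + 3))"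
      using \<delta> by (subst ln_le_cancel_iff) (auto intro!: mult_pos_pos add_nonneg_pos)
    also have "\<dots> = ln (1 / \<delta>) + b" unfolding b_def using \<delta> by (intro ln_mult_pos) auto
    also have "\<dots> \<le> (1 + ln (1 / \<delta>)) * b" using a b mult_left_mono[of 1 b "ln (1 / \<delta>)"] by (simp add: algebra_simps)
    finally have "(ln (\<bar>1 / \<delta> * v\<bar> + 3))\<^sup>2 \<le> ((1 + ln (1 / \<delta>)) * b)\<^sup>2"
      using \<delta> by (intro power_mono) auto
    then have l: "(ln (\<bar>1 / \<delta> * v\<bar> + 3))\<^sup>2 \<le> (1 + ln (1 / \<delta>))\<^sup>2 * b\<^sup>2" by (simp add: power_mult_distrib)
    have e: "\<delta>\<^sup>2 * (1 / \<delta> * v)\<^sup>2 = v\<^sup>2" using \<delta> by (simp add: power_mult_distrib power_divide)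
    have "1 / \<delta> * ((ln (\<bar>1 / \<delta> * v\<bar> + 3))\<^sup>2 * (\<delta>\<^sup>2 / (1 + v\<^sup>2))) \<le> 1 / \<delta> * ((1 + ln (1 / \<delta>))\<^sup>2 * b\<^sup>2 * (\<delta>\<^sup>2 / (1 + v\<^sup>2)))"
      using \<delta> by (intro mult_left_mono mult_right_mono l) (auto intro!: divide_nonneg_nonneg add_nonneg_nonneg)
    also have "\<dots> = \<delta> * (1 + ln (1 / \<delta>))\<^sup>2 * ?w v"
      using \<delta> by (simp add: b_def power2_eq_square)
    finally have "1 / \<delta> * ((ln (\<bar>1 / \<delta> * v\<bar> + 3))\<^sup>2 * (\<delta>\<^sup>2 / (1 + \<delta>\<^sup>2 * (1 / \<delta> * v)\<^sup>2))) \<le> \<delta> * (1 + ln (1 / \<delta>))\<^sup>2 * ?w v"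
      unfolding e .
    then have "ennreal (1 / \<delta> * ((ln (\<bar>1 / \<delta> * v\<bar> + 3))\<^sup>2 * (\<delta>\<^sup>2 / (1 + \<delta>\<^sup>2 * (1 / \<delta> * v)\<^sup>2)))) \<le> ennreal (\<delta> * (1 + ln (1 / \<delta>))\<^sup>2 * ?w v)"
      by (rule ennreal_leI)
    then show "ennreal \<bar>1 / \<delta>\<bar> * ennreal ((ln (\<bar>0 + 1 / \<delta> * v\<bar> + 3))\<^sup>2 * (\<delta>\<^sup>2 / (1 + \<delta>\<^sup>2 * (0 + 1 / \<delta> * v)\<^sup>2)))
        \<le> ennreal (\<delta> * (1 + ln (1 / \<delta>))\<^sup>2) * ennreal (?w v)"
      using \<delta> by (simp only: add_0_left abs_of_pos zero_less_divide_1_iff) (subst (asm) ennreal_mult', simp, subst (asm) ennreal_mult', simp, assumption)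
  qed
  also have "\<dots> = ennreal (\<delta> * (1 + ln (1 / \<delta>))\<^sup>2) * log_weight_integral"
    unfolding log_weight_integral_def by (rule nn_integral_cmult) measurable
  finally show ?thesis .
qed

text \<open>
  The mean square over a unit interval of the logarithmic variable, from the
  transform on the line \<open>Re s = 1/2 + \<eta>\<close>. The bound is uniform in \<open>\<theta> \<le> \<delta>\<close>.
\<close>
lemma psi_window_mean_square_log:
  assumes RH: "riemann_hypothesis"
  obtains K where "K > 0"
    "\<And>\<eta> \<theta> \<delta> U. 0 < \<eta> \<Longrightarrow> \<eta> \<le> 1 \<Longrightarrow> 0 \<le> \<theta> \<Longrightarrow> \<theta> \<le> \<delta> \<Longrightarrow> 0 < \<delta> \<Longrightarrow> \<delta> \<le> 1 \<Longrightarrow>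
      (\<integral>\<^sup>+u. ennreal ((psi_window \<theta> u)\<^sup>2 * exp (- (1 + 2 * \<eta>) * u)) * indicator {U..U+1} u \<partial>lborel)
       \<le> ennreal (K / \<eta>\<^sup>2 * (\<delta> * (1 + ln (1 / \<delta>))\<^sup>2))"
proof -
  obtain A where A: "A > 0" "\<And>s. 1 / 2 < Re s \<Longrightarrow> Re s \<le> 2 \<Longrightarrow>
       norm (deriv reg_zeta s / reg_zeta s) \<le> A * ln (\<bar>Im s\<bar> + 3) / (Re s - 1 / 2)"
    by (rule reg_zeta_logderiv_bound[OF RH], rule that; simp)
  obtain J where J: "log_weight_integral = ennreal J" "J \<ge> 0"
    using log_weight_integral_finite by (cases log_weight_integral) auto
  define K where "K = exp 5 * (A\<^sup>2 * 162) * (J + 1)"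
  have K: "K > 0" using A J by (simp add: K_def)
  show thesis
  proof (rule that[OF K])
    fix \<eta> \<theta> \<delta> U :: real
    assume \<eta>: "0 < \<eta>" "\<eta> \<le> 1" and \<theta>: "0 \<le> \<theta>" "\<theta> \<le> \<delta>" and \<delta>: "0 < \<delta>" "\<delta> \<le> 1"
    define \<sigma> where "\<sigma> = 1 / 2 + \<eta>"
    have \<sigma>: "1 / 2 < \<sigma>" "0 \<le> \<sigma>" "\<sigma> \<le> 2" using \<eta> by (auto simp: \<sigma>_def)
    have Q_sq: "(norm (window_transform \<theta> s))\<^sup>2
        \<le> A\<^sup>2 * 162 / \<eta>\<^sup>2 * ((ln (\<bar>Im s\<bar> + 3))\<^sup>2 * (\<delta>\<^sup>2 / (1 + \<delta>\<^sup>2 * (Im s)\<^sup>2)))"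
      if s: "\<sigma> \<le> Re s" "Re s \<le> 2" for s
    proof -
      have l: "ln (\<bar>Im s\<bar> + 3) \<ge> 0" by simp
      have "norm (deriv reg_zeta s / reg_zeta s) \<le> A * ln (\<bar>Im s\<bar> + 3) / (Re s - 1 / 2)"
        using s \<sigma> by (intro A) auto
      also have "\<dots> \<le> A * ln (\<bar>Im s\<bar> + 3) / \<eta>"
        using s \<eta> l A by (intro divide_left_mono mult_nonneg_nonneg mult_pos_pos) (auto simp: \<sigma>_def)
      finally have "(norm (deriv reg_zeta s / reg_zeta s))\<^sup>2 \<le> (A * ln (\<bar>Im s\<bar> + 3) / \<eta>)\<^sup>2"
        by (intro power_mono) auto
      moreover have "(norm ((exp (s * of_real \<theta>) - 1) / s))\<^sup>2 \<le> 162 * \<delta>\<^sup>2 / (1 + \<delta>\<^sup>2 * (Im s)\<^sup>2)"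
        using s \<sigma> \<theta> \<delta> by (intro window_factor_bound) auto
      ultimately have "(norm (deriv reg_zeta s / reg_zeta s))\<^sup>2 * (norm ((exp (s * of_real \<theta>) - 1) / s))\<^sup>2
         \<le> (A * ln (\<bar>Im s\<bar> + 3) / \<eta>)\<^sup>2 * (162 * \<delta>\<^sup>2 / (1 + \<delta>\<^sup>2 * (Im s)\<^sup>2))"
        by (intro mult_mono) auto
      then show ?thesis
        unfolding window_transform_def norm_mult norm_minus_cancel by (simp add: power_mult_distrib power_divide mult_ac)
    qed
    have growth: "norm (window_transform \<theta> s) \<le> (A * 13 / \<eta>) * (\<bar>Im s\<bar> + 3)"
      if s: "\<sigma> \<le> Re s" "Re s \<le> 2" for s
    proof -
      define L where "L = \<bar>Im s\<bar> + 3"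
      have l: "0 \<le> ln L" "ln L \<le> L" using ln_bound[of L] by (auto simp: L_def)
      have "(norm (window_transform \<theta> s))\<^sup>2
          \<le> A\<^sup>2 * 162 / \<eta>\<^sup>2 * ((ln L)\<^sup>2 * (\<delta>\<^sup>2 / (1 + \<delta>\<^sup>2 * (Im s)\<^sup>2)))" unfolding L_def by (rule Q_sq[OF s])
      also have "\<dots> \<le> A\<^sup>2 * 169 / \<eta>\<^sup>2 * (L\<^sup>2 * 1)"
      proof (intro mult_mono power_mono l)
        have "\<delta>\<^sup>2 \<le> 1" using \<delta> by (simp add: power_le_one)
        moreover have "0 \<le> \<delta>\<^sup>2 * (Im s)\<^sup>2" by simp
        moreover from this have p: "1 + \<delta>\<^sup>2 * (Im s)\<^sup>2 > 0" by (rule add_pos_nonneg[OF zero_less_one])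
        ultimately show "\<delta>\<^sup>2 / (1 + \<delta>\<^sup>2 * (Im s)\<^sup>2) \<le> 1" unfolding divide_le_eq_1_pos[OF p] by linarith
        show "A\<^sup>2 * 162 / \<eta>\<^sup>2 \<le> A\<^sup>2 * 169 / \<eta>\<^sup>2" by (intro divide_right_mono) auto
      qed (auto intro!: divide_nonneg_nonneg add_nonneg_nonneg)
      also have "\<dots> = ((A * 13 / \<eta>) * L)\<^sup>2" by (simp add: power_mult_distrib power_divide)
      finally show ?thesis unfolding L_def[symmetric]
        by (rule power2_le_imp_le) (use A \<eta> in \<open>auto simp: L_def\<close>)
    qed
    have hol: "window_transform \<theta> holomorphic_on {s. Re s > 1 / 2}"
    proof -
      have op: "open {s. Re s > 1 / 2}" by (rule open_halfspace_Re_gt)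
      have 1: "reg_zeta holomorphic_on {s. Re s > 1 / 2}"
        by (rule holomorphic_on_subset[OF reg_zeta_holomorphic]) auto
      have 2: "reg_zeta s \<noteq> 0" if "Re s > 1 / 2" for s
        using Re_reg_zeta_zero[OF RH, of s] that by auto
      show ?thesis unfolding window_transform_def
        using 2 by (intro holomorphic_intros holomorphic_deriv 1 op) auto
    qed
    have "(\<integral>\<^sup>+u. ennreal ((psi_window \<theta> u)\<^sup>2 * exp (- 2 * \<sigma> * u)) * indicator {U..U+1} u \<partial>lborel)
     \<le> ennreal (exp 5) * (\<integral>\<^sup>+t. ennreal ((norm (window_transform \<theta> (Complex \<sigma> t)))\<^sup>2) \<partial>lborel)"
    proof (rule L2_bound_by_shifted_transform[where \<alpha> = "1 / 2" and C = "A * 13 / \<eta>" and B = "exp (2 * \<theta>) + 1"])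
      have eq: "of_real (psi_window \<theta> v) * exp (- (2::complex) * of_real v) = of_real (psi_window \<theta> v * exp (- 2 * v))" for v
        by (simp flip: exp_of_real)
      have "integrable lborel (\<lambda>v. of_real (psi_window \<theta> v) * exp (- (2::complex) * of_real v))"
        by (rule psi_window_transform(1)) simp
      from integrable_Re[OF this[unfolded eq]] show "integrable lborel (\<lambda>v. psi_window \<theta> v * exp (- 2 * v))"
        by (simp only: Re_complex_of_real)
      show "(\<integral>v. of_real (psi_window \<theta> v) * exp (- Complex 2 t * of_real v) \<partial>lborel) = window_transform \<theta> (Complex 2 t)" for t
        by (rule psi_window_transform(2)) simp
    qed (use psi_window_bound AE_isCont_psi_window hol \<sigma> growth in \<open>auto\<close>)
    also have "(\<integral>\<^sup>+t. ennreal ((norm (window_transform \<theta> (Complex \<sigma> t)))\<^sup>2) \<partial>lborel)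
       \<le> (\<integral>\<^sup>+t. ennreal (A\<^sup>2 * 162 / \<eta>\<^sup>2) * ennreal ((ln (\<bar>t\<bar> + 3))\<^sup>2 * (\<delta>\<^sup>2 / (1 + \<delta>\<^sup>2 * t\<^sup>2))) \<partial>lborel)"
    proof (intro nn_integral_mono)
      fix t
      have "(norm (window_transform \<theta> (Complex \<sigma> t)))\<^sup>2
         \<le> A\<^sup>2 * 162 / \<eta>\<^sup>2 * ((ln (\<bar>t\<bar> + 3))\<^sup>2 * (\<delta>\<^sup>2 / (1 + \<delta>\<^sup>2 * t\<^sup>2)))"
        using Q_sq[of "Complex \<sigma> t"] \<sigma> by simp
      then have "ennreal ((norm (window_transform \<theta> (Complex \<sigma> t)))\<^sup>2)
         \<le> ennreal (A\<^sup>2 * 162 / \<eta>\<^sup>2 * ((ln (\<bar>t\<bar> + 3))\<^sup>2 * (\<delta>\<^sup>2 / (1 + \<delta>\<^sup>2 * t\<^sup>2))))" by (rule ennreal_leI)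
      then show "ennreal ((norm (window_transform \<theta> (Complex \<sigma> t)))\<^sup>2)
         \<le> ennreal (A\<^sup>2 * 162 / \<eta>\<^sup>2) * ennreal ((ln (\<bar>t\<bar> + 3))\<^sup>2 * (\<delta>\<^sup>2 / (1 + \<delta>\<^sup>2 * t\<^sup>2)))"
        by (subst ennreal_mult'[symmetric]) auto
    qed
    also have "\<dots> = ennreal (A\<^sup>2 * 162 / \<eta>\<^sup>2) * (\<integral>\<^sup>+t. ennreal ((ln (\<bar>t\<bar> + 3))\<^sup>2 * (\<delta>\<^sup>2 / (1 + \<delta>\<^sup>2 * t\<^sup>2))) \<partial>lborel)"
      by (rule nn_integral_cmult) measurable
    also have "\<dots> \<le> ennreal (A\<^sup>2 * 162 / \<eta>\<^sup>2) * (ennreal (\<delta> * (1 + ln (1 / \<delta>))\<^sup>2) * log_weight_integral)"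
      by (intro mult_left_mono log_window_integral_le \<delta>) auto
    also have "\<dots> = ennreal (A\<^sup>2 * 162 / \<eta>\<^sup>2 * (\<delta> * (1 + ln (1 / \<delta>))\<^sup>2 * J))"
    proof -
      have "ennreal (\<delta> * (1 + ln (1 / \<delta>))\<^sup>2) * ennreal J = ennreal (\<delta> * (1 + ln (1 / \<delta>))\<^sup>2 * J)"
        using \<delta> J(2) by (intro ennreal_mult[symmetric]) auto
      then show ?thesis unfolding J(1)
        using \<delta> J(2) by (simp only: ennreal_mult[symmetric, of "A\<^sup>2 * 162 / \<eta>\<^sup>2"] zero_le_power2 mult_nonneg_nonneg
            divide_nonneg_nonneg less_imp_le zero_le_numeral)
    qed
    finally have "(\<integral>\<^sup>+u. ennreal ((psi_window \<theta> u)\<^sup>2 * exp (- 2 * \<sigma> * u)) * indicator {U..U+1} u \<partial>lborel)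
      \<le> ennreal (exp 5) * ennreal (A\<^sup>2 * 162 / \<eta>\<^sup>2 * (\<delta> * (1 + ln (1 / \<delta>))\<^sup>2 * J))"
      by (simp add: mult_left_mono)
    also have "\<dots> = ennreal (exp 5 * (A\<^sup>2 * 162 / \<eta>\<^sup>2 * (\<delta> * (1 + ln (1 / \<delta>))\<^sup>2 * J)))"
      using \<delta> J(2) by (subst ennreal_mult) auto
    also have "\<dots> \<le> ennreal (K / \<eta>\<^sup>2 * (\<delta> * (1 + ln (1 / \<delta>))\<^sup>2))"
    proof (rule ennreal_leI)
      have "exp 5 * (A\<^sup>2 * 162 / \<eta>\<^sup>2 * (\<delta> * (1 + ln (1 / \<delta>))\<^sup>2 * J)) \<le> exp 5 * (A\<^sup>2 * 162 / \<eta>\<^sup>2 * (\<delta> * (1 + ln (1 / \<delta>))\<^sup>2 * (J + 1)))"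
        using \<delta> by (intro mult_left_mono) auto
      also have "\<dots> = K / \<eta>\<^sup>2 * (\<delta> * (1 + ln (1 / \<delta>))\<^sup>2)" by (simp add: K_def)
      finally show "exp 5 * (A\<^sup>2 * 162 / \<eta>\<^sup>2 * (\<delta> * (1 + ln (1 / \<delta>))\<^sup>2 * J)) \<le> K / \<eta>\<^sup>2 * (\<delta> * (1 + ln (1 / \<delta>))\<^sup>2)" .
    qed
    finally have le: "(\<integral>\<^sup>+u. ennreal ((psi_window \<theta> u)\<^sup>2 * exp (- 2 * \<sigma> * u)) * indicator {U..U+1} u \<partial>lborel)
       \<le> ennreal (K / \<eta>\<^sup>2 * (\<delta> * (1 + ln (1 / \<delta>))\<^sup>2))" .
    have "- (1 + 2 * \<eta>) * u = - 2 * \<sigma> * u" for u by (simp add: \<sigma>_def algebra_simps)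
    then show "(\<integral>\<^sup>+u. ennreal ((psi_window \<theta> u)\<^sup>2 * exp (- (1 + 2 * \<eta>) * u)) * indicator {U..U+1} u \<partial>lborel)
       \<le> ennreal (K / \<eta>\<^sup>2 * (\<delta> * (1 + ln (1 / \<delta>))\<^sup>2))" using le by (simp only:)
  qed
qed

section \<open>From multiplicative windows to square-root windows\<close>

text \<open>
  The logarithm of the ratio of the end points of the layer that starts at \<open>exp u\<close>.
\<close>
definition log_window :: "real \<Rightarrow> real \<Rightarrow> real" where
  "log_window c u = ln (1 + c * exp (- u / 2))"

lemma exp_log_window:
  assumes c: "c > 0"
  shows "exp (u + log_window c u) = exp u + c * sqrt (exp u)"
proof -
  have "1 + c * exp (- u / 2) > 0" using c by (intro add_pos_pos) auto
  then have "exp (u + log_window c u) = exp u * (1 + c * exp (- u / 2))"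
    by (simp add: log_window_def exp_add)
  also have "\<dots> = exp u + c * exp (u / 2)" by (simp add: distrib_left flip: exp_add)
  also have "exp (u / 2) = sqrt (exp u)"
    by (rule real_sqrt_unique[symmetric]) (simp_all flip: exp_double)
  finally show ?thesis .
qed

lemma log_window_bounds:
  assumes c: "c > 0" and u: "U \<le> u"
  shows "0 \<le> log_window c u" "log_window c u \<le> c * exp (- U / 2)"
proof -
  show "0 \<le> log_window c u" unfolding log_window_def using c by (intro ln_ge_zero) simp
  have "log_window c u \<le> c * exp (- u / 2)"
    unfolding log_window_def using c by (intro ln_add_one_self_le_self) simp
  also have "\<dots> \<le> c * exp (- U / 2)" using c u by (intro mult_left_mono) auto
  finally show "log_window c u \<le> c * exp (- U / 2)" .
qed

text \<open>
  The map \<open>u + log_window c u\<close> is increasing with derivative at least 1/2 and moves no point by more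
  than 1.
\<close>
lemma nn_integral_log_window_substitution:
  fixes F :: "real \<Rightarrow> ennreal"
  assumes c: "c > 0" and a: "c * exp (- U / 2) \<le> 1" and F [measurable]: "F \<in> borel_measurable borel"
  shows "(\<integral>\<^sup>+u. F (u + log_window c u) * indicator {U..U+1} u \<partial>lborel)
     \<le> 2 * (\<integral>\<^sup>+w. F w * indicator {U..U+2} w \<partial>lborel)"
proof -
  define g where "g u = u + log_window c u" for u
  define g' where "g' u = 1 - c * exp (- u / 2) / 2 / (1 + c * exp (- u / 2))" for u
  have pos: "1 + c * exp (- u / 2) > 0" for u using c by (intro add_pos_pos) auto
  have [measurable]: "g \<in> borel_measurable borel" unfolding g_def log_window_def by measurable
  have deriv: "(g has_real_derivative g' u) (at u)" for u
    unfolding g_def log_window_def g'_def using pos[of u]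
    by (auto intro!: derivative_eq_intros simp: field_simps)
  have g'_ge: "1 / 2 \<le> g' u" for u
  proof -
    have "1 / 2 \<le> 1 - z / 2 / (1 + z)" if "z > 0" for z :: real
      using that by (simp add: field_simps)
    from this[of "c * exp (- u / 2)"] show ?thesis unfolding g'_def using c by auto
  qed
  have cont: "continuous_on {U..U+1} g'"
    unfolding g'_def using pos by (intro continuous_intros) (auto simp: less_imp_neq[symmetric])
  have "(\<integral>\<^sup>+u. F (g u) * indicator {U..U+1} u \<partial>lborel)
      \<le> (\<integral>\<^sup>+u. 2 * (F (g u) * ennreal (g' u) * indicator {U..U+1} u) \<partial>lborel)"
  proof (intro nn_integral_mono)
    fix u
    have "1 \<le> 2 * ennreal (g' u)"
    proof -
      have "ennreal 1 \<le> ennreal (2 * g' u)" using g'_ge[of u] by (intro ennreal_leI) simp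
      then show ?thesis using g'_ge[of u] by (simp add: ennreal_mult')
    qed
    then have "F (g u) * indicator {U..U+1} u * 1 \<le> F (g u) * indicator {U..U+1} u * (2 * ennreal (g' u))"
      by (intro mult_left_mono) auto
    then show "F (g u) * indicator {U..U+1} u \<le> 2 * (F (g u) * ennreal (g' u) * indicator {U..U+1} u)"
      by (simp add: mult_ac)
  qed
  also have "\<dots> = 2 * (\<integral>\<^sup>+u. F (g u) * ennreal (g' u) * indicator {U..U+1} u \<partial>lborel)"
    by (rule nn_integral_cmult) (unfold g'_def, measurable)
  also have "(\<integral>\<^sup>+u. F (g u) * ennreal (g' u) * indicator {U..U+1} u \<partial>lborel)
      = (\<integral>\<^sup>+w. F w * indicator {g U..g (U+1)} w \<partial>lborel)"
  proof (rule nn_integral_substitution_aux[symmetric])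
    show "0 \<le> g' x" for x using g'_ge[of x] by linarith
  qed (use deriv cont in auto)
  also have "\<dots> \<le> (\<integral>\<^sup>+w. F w * indicator {U..U+2} w \<partial>lborel)"
  proof (intro nn_integral_mono mult_left_mono)
    have "g U \<ge> U" "g (U + 1) \<le> U + 2"
      using log_window_bounds[OF c, of U U] log_window_bounds[OF c, of U "U + 1"] a by (auto simp: g_def)
    then show "indicator {g U..g (U+1)} w \<le> (indicator {U..U+2} w :: ennreal)" for w
      by (auto simp: indicator_def)
  qed auto
  finally show ?thesis by (simp add: g_def mult_left_mono)
qed

text \<open>
  For every \<open>\<theta>\<close> the increment over the layer is \<open>psi_window (log_window c u + \<theta>) u\<close> minus
  \<open>psi_window \<theta> (u + log_window c u)\<close>. In the first term the shift by \<open>log_window c u\<close> disappears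
  after integration over \<open>\<theta>\<close>, in the second one it disappears by a substitution in \<open>u\<close>. Both
  become averages over \<open>\<theta>\<close> of mean squares with constant window length.
\<close>
lemma psi_window_average:
  fixes c U R :: real
  assumes c: "c > 0" and a: "a = c * exp (- U / 2)" "a \<le> 1"
    and bound: "\<And>\<theta> V. 0 \<le> \<theta> \<Longrightarrow> \<theta> \<le> 2 * a \<Longrightarrow> V \<in> {U, U + 1} \<Longrightarrow>
      (\<integral>\<^sup>+u. ennreal ((psi_window \<theta> u)\<^sup>2) * indicator {V..V+1} u \<partial>lborel) \<le> ennreal R"
    and R: "R \<ge> 0"
  shows "(\<integral>\<^sup>+u. ennreal ((psi_window (log_window c u) u)\<^sup>2) * indicator {U..U+1} u \<partial>lborel) \<le> ennreal (12 * R)"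
proof -
  have a0: "a > 0" using a c by simp
  have [measurable]: "log_window c \<in> borel_measurable borel" unfolding log_window_def by measurable
  have pw [measurable]: "(\<lambda>(x, y). ennreal ((psi_window (f x y) (g x y))\<^sup>2)) \<in> borel_measurable (lborel \<Otimes>\<^sub>M lborel)"
    if [measurable]: "case_prod f \<in> borel_measurable (lborel \<Otimes>\<^sub>M lborel)" "case_prod g \<in> borel_measurable (lborel \<Otimes>\<^sub>M lborel)" for f g
    unfolding psi_window_def by measurable
  let ?I = "\<integral>\<^sup>+u. ennreal ((psi_window (log_window c u) u)\<^sup>2) * indicator {U..U+1} u \<partial>lborel"
  let ?T1 = "\<lambda>u \<theta>. ennreal ((psi_window (log_window c u + \<theta>) u)\<^sup>2) * indicator {U..U+1} u * indicator {0..a} \<theta>"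
  let ?T2 = "\<lambda>u \<theta>. ennreal ((psi_window \<theta> (u + log_window c u))\<^sup>2) * indicator {U..U+1} u * indicator {0..a} \<theta>"
  have split: "ennreal ((psi_window (log_window c u) u)\<^sup>2) * indicator {U..U+1} u * indicator {0..a} \<theta>
      \<le> 2 * ?T1 u \<theta> + 2 * ?T2 u \<theta>" for u \<theta>
  proof -
    define p q where "p = psi_window (log_window c u + \<theta>) u" and "q = psi_window \<theta> (u + log_window c u)"
    have "psi_window (log_window c u) u = p - q"
      by (simp add: psi_window_def p_def q_def add_ac)
    moreover have "(p - q)\<^sup>2 \<le> 2 * p\<^sup>2 + 2 * q\<^sup>2"
      using zero_le_power2[of "p + q"] by (simp add: power2_eq_square algebra_simps)
    ultimately have "ennreal ((psi_window (log_window c u) u)\<^sup>2) \<le> ennreal (2 * p\<^sup>2 + 2 * q\<^sup>2)"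
      by (intro ennreal_leI) simp
    also have "\<dots> = 2 * ennreal (p\<^sup>2) + 2 * ennreal (q\<^sup>2)"
      by (simp add: ennreal_plus ennreal_mult')
    finally have "ennreal ((psi_window (log_window c u) u)\<^sup>2) * (indicator {U..U+1} u * indicator {0..a} \<theta>)
      \<le> (2 * ennreal (p\<^sup>2) + 2 * ennreal (q\<^sup>2)) * (indicator {U..U+1} u * indicator {0..a} \<theta>)"
      by (intro mult_right_mono) auto
    then show ?thesis by (simp add: p_def q_def distrib_left distrib_right mult_ac)
  qed
  have 1: "(\<integral>\<^sup>+u. \<integral>\<^sup>+\<theta>. ?T1 u \<theta> \<partial>lborel \<partial>lborel) \<le> ennreal (2 * a) * ennreal R"
  proof -
    have "(\<integral>\<^sup>+\<theta>. ?T1 u \<theta> \<partial>lborel) \<le> (\<integral>\<^sup>+\<theta>. ennreal ((psi_window \<theta> u)\<^sup>2) * indicator {U..U+1} u * indicator {0..2 * a} \<theta> \<partial>lborel)" for u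
    proof (cases "u \<in> {U..U+1}")
      case True
      then have l: "0 \<le> log_window c u" "log_window c u \<le> a" using log_window_bounds[OF c, of U u] a by auto
      have "(\<integral>\<^sup>+\<theta>. ?T1 u \<theta> \<partial>lborel) \<le> (\<integral>\<^sup>+\<theta>. ennreal ((psi_window (log_window c u + 1 * \<theta>) u)\<^sup>2) * indicator {U..U+1} u * indicator {0..2 * a} (log_window c u + 1 * \<theta>) \<partial>lborel)"
        using l by (intro nn_integral_mono) (auto simp: indicator_def)
      also have "\<dots> = (\<integral>\<^sup>+\<theta>. ennreal ((psi_window \<theta> u)\<^sup>2) * indicator {U..U+1} u * indicator {0..2 * a} \<theta> \<partial>lborel)"
        by (subst (2) nn_integral_real_affine[where c = 1 and t = "log_window c u"]) (auto simp: psi_window_def)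
      finally show ?thesis .
    qed simp
    then have "(\<integral>\<^sup>+u. \<integral>\<^sup>+\<theta>. ?T1 u \<theta> \<partial>lborel \<partial>lborel)
      \<le> (\<integral>\<^sup>+u. \<integral>\<^sup>+\<theta>. ennreal ((psi_window \<theta> u)\<^sup>2) * indicator {U..U+1} u * indicator {0..2 * a} \<theta> \<partial>lborel \<partial>lborel)"
      by (rule nn_integral_mono)
    also have "\<dots> = (\<integral>\<^sup>+\<theta>. \<integral>\<^sup>+u. ennreal ((psi_window \<theta> u)\<^sup>2) * indicator {U..U+1} u * indicator {0..2 * a} \<theta> \<partial>lborel \<partial>lborel)"
      by (rule lborel_pair.Fubini'[symmetric]) measurable
    also have "\<dots> = (\<integral>\<^sup>+\<theta>. (\<integral>\<^sup>+u. ennreal ((psi_window \<theta> u)\<^sup>2) * indicator {U..U+1} u \<partial>lborel) * indicator {0..2 * a} \<theta> \<partial>lborel)"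
      by (intro nn_integral_cong nn_integral_multc) measurable
    also have "\<dots> \<le> (\<integral>\<^sup>+\<theta>. ennreal R * indicator {0..2 * a} \<theta> \<partial>lborel)"
    proof (intro nn_integral_mono)
      fix \<theta> :: real
      show "(\<integral>\<^sup>+u. ennreal ((psi_window \<theta> u)\<^sup>2) * indicator {U..U+1} u \<partial>lborel) * indicator {0..2 * a} \<theta>
          \<le> ennreal R * indicator {0..2 * a} \<theta>"
        using bound[of \<theta> U] by (cases "\<theta> \<in> {0..2 * a}") auto
    qed
    also have "\<dots> = ennreal (2 * a) * ennreal R"
      using a0 by (simp add: nn_integral_cmult mult.commute)
    finally show ?thesis .
  qed
  have 2: "(\<integral>\<^sup>+u. \<integral>\<^sup>+\<theta>. ?T2 u \<theta> \<partial>lborel \<partial>lborel) \<le> ennreal a * ennreal (4 * R)"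
  proof -
    have "(\<integral>\<^sup>+u. \<integral>\<^sup>+\<theta>. ?T2 u \<theta> \<partial>lborel \<partial>lborel) = (\<integral>\<^sup>+\<theta>. \<integral>\<^sup>+u. ?T2 u \<theta> \<partial>lborel \<partial>lborel)"
      by (rule lborel_pair.Fubini'[symmetric]) measurable
    also have "\<dots> = (\<integral>\<^sup>+\<theta>. (\<integral>\<^sup>+u. ennreal ((psi_window \<theta> (u + log_window c u))\<^sup>2) * indicator {U..U+1} u \<partial>lborel) * indicator {0..a} \<theta> \<partial>lborel)"
      by (intro nn_integral_cong nn_integral_multc) measurable
    also have "\<dots> \<le> (\<integral>\<^sup>+\<theta>. ennreal (4 * R) * indicator {0..a} \<theta> \<partial>lborel)"
    proof (intro nn_integral_mono)
      fix \<theta> :: real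
      show "(\<integral>\<^sup>+u. ennreal ((psi_window \<theta> (u + log_window c u))\<^sup>2) * indicator {U..U+1} u \<partial>lborel) * indicator {0..a} \<theta>
          \<le> ennreal (4 * R) * indicator {0..a} \<theta>"
      proof (cases "\<theta> \<in> {0..a}")
        case True
        let ?F = "\<lambda>w. ennreal ((psi_window \<theta> w)\<^sup>2)"
        have "(\<integral>\<^sup>+u. ?F (u + log_window c u) * indicator {U..U+1} u \<partial>lborel)
            \<le> 2 * (\<integral>\<^sup>+w. ?F w * indicator {U..U+2} w \<partial>lborel)"
          using a c by (intro nn_integral_log_window_substitution) auto
        also have "(\<integral>\<^sup>+w. ?F w * indicator {U..U+2} w \<partial>lborel)
            \<le> (\<integral>\<^sup>+w. ?F w * indicator {U..U+1} w + ?F w * indicator {U+1..U+1+1} w \<partial>lborel)"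
          by (intro nn_integral_mono) (auto simp: indicator_def)
        also have "\<dots> = (\<integral>\<^sup>+w. ?F w * indicator {U..U+1} w \<partial>lborel) + (\<integral>\<^sup>+w. ?F w * indicator {U+1..U+1+1} w \<partial>lborel)"
          by (rule nn_integral_add) auto
        also have "\<dots> \<le> ennreal R + ennreal R"
          using True a0 by (intro add_mono bound) auto
        also have "2 * (ennreal R + ennreal R) = ennreal (4 * R)"
          using R by (simp add: ennreal_mult' flip: ennreal_plus)
        finally show ?thesis using True by (simp add: mult_left_mono)
      qed simp
    qed
    also have "\<dots> = ennreal a * ennreal (4 * R)"
      using a0 by (subst nn_integral_cmult_indicator) (simp_all add: mult.commute)
    finally show ?thesis .
  qed
  have "ennreal a * ?I = (\<integral>\<^sup>+u. ennreal ((psi_window (log_window c u) u)\<^sup>2) * indicator {U..U+1} u * ennreal a \<partial>lborel)"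
    by (subst nn_integral_multc) (auto simp: mult.commute psi_window_def)
  also have "\<dots> = (\<integral>\<^sup>+u. \<integral>\<^sup>+\<theta>. ennreal ((psi_window (log_window c u) u)\<^sup>2) * indicator {U..U+1} u * indicator {0..a} \<theta> \<partial>lborel \<partial>lborel)"
    using a0 by (simp add: nn_integral_cmult)
  also have "\<dots> \<le> (\<integral>\<^sup>+u. \<integral>\<^sup>+\<theta>. 2 * ?T1 u \<theta> + 2 * ?T2 u \<theta> \<partial>lborel \<partial>lborel)"
    by (intro nn_integral_mono split)
  also have "\<dots> = (\<integral>\<^sup>+u. 2 * (\<integral>\<^sup>+\<theta>. ?T1 u \<theta> \<partial>lborel) + 2 * (\<integral>\<^sup>+\<theta>. ?T2 u \<theta> \<partial>lborel) \<partial>lborel)"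
    by (intro nn_integral_cong) (simp add: nn_integral_add nn_integral_cmult psi_window_def)
  also have "\<dots> = 2 * (\<integral>\<^sup>+u. \<integral>\<^sup>+\<theta>. ?T1 u \<theta> \<partial>lborel \<partial>lborel) + 2 * (\<integral>\<^sup>+u. \<integral>\<^sup>+\<theta>. ?T2 u \<theta> \<partial>lborel \<partial>lborel)"
    by (subst nn_integral_add, measurable, subst nn_integral_cmult, measurable, subst nn_integral_cmult, measurable)
  also have "\<dots> \<le> 2 * (ennreal (2 * a) * ennreal R) + 2 * (ennreal a * ennreal (4 * R))"
    by (intro add_mono mult_left_mono 1 2) auto
  also have "\<dots> = ennreal a * ennreal (12 * R)"
  proof -
    have "2 * (ennreal (2 * a) * ennreal R) = ennreal (4 * a * R)" "2 * (ennreal a * ennreal (4 * R)) = ennreal (8 * a * R)"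
      using a0 R by (auto simp: ennreal_mult mult.assoc[symmetric] ennreal_numeral[symmetric] simp del: ennreal_numeral simp flip: ennreal_mult)
    then show ?thesis using a0 R by (simp flip: ennreal_plus ennreal_mult)
  qed
  finally have "ennreal a * ?I \<le> ennreal a * ennreal (12 * R)" .
  from mult_left_mono[OF this, of "ennreal (1 / a)"] have "ennreal (1 / a) * ennreal a * ?I \<le> ennreal (1 / a) * ennreal a * ennreal (12 * R)"
    by (simp add: mult.assoc)
  moreover have "ennreal (1 / a) * ennreal a = 1" using a0 by (simp flip: ennreal_mult)
  ultimately show ?thesis by simp
qed

text \<open>
  With \<open>U = ln X\<close> and \<open>\<eta> = 1 / U\<close> the weight \<open>exp (- (1 + 2 * \<eta>) * u)\<close> is \<open>1 / X\<close> up to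
  constants on \<open>[U, U + 2]\<close>, so moving so close to the critical line costs nothing but the factor
  \<open>1 / \<eta>\<^sup>2 = U\<^sup>2\<close>.
\<close>
lemma psi_err_window_mean_square:
  assumes RH: "riemann_hypothesis" and c: "c > 0"
  obtains K where "K > 0"
    "\<forall>\<^sub>F X in at_top. (\<integral>\<^sup>+x. ennreal ((psi_err (x + c * sqrt x) - psi_err x)\<^sup>2) * indicator {X..2 * X} x \<partial>lborel)
       \<le> ennreal (K * (X powr (3 / 2) * (ln X) ^ 4))"
proof -
  obtain K where K: "K > 0"
    "\<And>\<eta> \<theta> \<delta> U. 0 < \<eta> \<Longrightarrow> \<eta> \<le> 1 \<Longrightarrow> 0 \<le> \<theta> \<Longrightarrow> \<theta> \<le> \<delta> \<Longrightarrow> 0 < \<delta> \<Longrightarrow> \<delta> \<le> 1 \<Longrightarrow>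
      (\<integral>\<^sup>+u. ennreal ((psi_window \<theta> u)\<^sup>2 * exp (- (1 + 2 * \<eta>) * u)) * indicator {U..U+1} u \<partial>lborel)
       \<le> ennreal (K / \<eta>\<^sup>2 * (\<delta> * (1 + ln (1 / \<delta>))\<^sup>2))"
    by (rule psi_window_mean_square_log[OF RH], rule that; simp)
  define K2 where "K2 = 12 * exp 9 * (8 * c * K)"
  have K2: "K2 > 0" using K c by (simp add: K2_def)
  have ev1: "\<forall>\<^sub>F X in at_top. ln X \<ge> (1::real)" by real_asymp
  have ev2: "\<forall>\<^sub>F X in at_top. 2 * (c * exp (- ln X / 2)) \<le> (1::real)" using c by real_asymp
  have ev3: "\<forall>\<^sub>F X in at_top. 1 + ln (1 / (2 * (c * exp (- ln X / 2)))) \<le> 2 * ln (X::real)" using c by real_asymp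
  have "\<forall>\<^sub>F X in at_top. (\<integral>\<^sup>+x. ennreal ((psi_err (x + c * sqrt x) - psi_err x)\<^sup>2) * indicator {X..2 * X} x \<partial>lborel)
       \<le> ennreal (K2 * (X powr (3 / 2) * (ln X) ^ 4))"
    using ev1 ev2 ev3 eventually_gt_at_top[of 0]
  proof eventually_elim
    case (elim X)
    define U where "U = ln X"
    have X: "X > 0" "exp U = X" using elim by (auto simp: U_def)
    have U: "U \<ge> 1" using elim by (simp add: U_def)
    define a where "a = c * exp (- U / 2)"
    define \<delta> where "\<delta> = 2 * a"
    have a: "a > 0" using c by (simp add: a_def)
    have \<delta>: "0 < \<delta>" "\<delta> \<le> 1" using a elim by (auto simp: \<delta>_def a_def U_def)
    have l\<delta>: "1 + ln (1 / \<delta>) \<le> 2 * U" using elim by (simp add: \<delta>_def a_def U_def)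
    define \<eta> where "\<eta> = 1 / U"
    have \<eta>: "0 < \<eta>" "\<eta> \<le> 1" using U by (auto simp: \<eta>_def)
    define R0 where "R0 = K / \<eta>\<^sup>2 * (\<delta> * (1 + ln (1 / \<delta>))\<^sup>2)"
    define R where "R = exp (U + 8) * R0"
    have R0: "R0 \<ge> 0" unfolding R0_def using K(1) \<delta> by simp
    have R: "R \<ge> 0" using R0 by (simp add: R_def)
    have bound: "(\<integral>\<^sup>+u. ennreal ((psi_window \<theta> u)\<^sup>2) * indicator {V..V+1} u \<partial>lborel) \<le> ennreal R"
      if \<theta>: "0 \<le> \<theta>" "\<theta> \<le> 2 * a" and V: "V \<in> {U, U + 1}" for \<theta> V
    proof -
      have "(\<integral>\<^sup>+u. ennreal ((psi_window \<theta> u)\<^sup>2) * indicator {V..V+1} u \<partial>lborel)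
         \<le> (\<integral>\<^sup>+u. ennreal (exp (U + 8)) * (ennreal ((psi_window \<theta> u)\<^sup>2 * exp (- (1 + 2 * \<eta>) * u)) * indicator {V..V+1} u) \<partial>lborel)"
      proof (intro nn_integral_mono)
        fix u
        show "ennreal ((psi_window \<theta> u)\<^sup>2) * indicator {V..V+1} u
          \<le> ennreal (exp (U + 8)) * (ennreal ((psi_window \<theta> u)\<^sup>2 * exp (- (1 + 2 * \<eta>) * u)) * indicator {V..V+1} u)"
        proof (cases "u \<in> {V..V+1}")
          case True
          \<comment> \<open>On \<open>[U, U + 2]\<close> the exponent exceeds \<open>U\<close> by at most \<open>2 + 2 * \<eta> * U + 4 * \<eta> \<le> 8\<close>.\<close>
          have "(1 + 2 * \<eta>) * u \<le> (1 + 2 * \<eta>) * (U + 2)"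
            using True V \<eta> by (intro mult_left_mono) auto
          also have "\<dots> = U + 4 + 4 * \<eta>" using U by (simp add: \<eta>_def field_simps)
          also have "\<dots> \<le> U + 8" using \<eta> by simp
          finally have "0 \<le> U + 8 - (1 + 2 * \<eta>) * u" by simp
          then have "1 \<le> exp (U + 8 - (1 + 2 * \<eta>) * u)" by simp
          also have "\<dots> = exp (U + 8) * exp (- (1 + 2 * \<eta>) * u)"
            unfolding exp_add[symmetric] by (rule arg_cong[where f = exp]) (simp add: algebra_simps)
          finally have "(psi_window \<theta> u)\<^sup>2 * 1 \<le> (psi_window \<theta> u)\<^sup>2 * (exp (U + 8) * exp (- (1 + 2 * \<eta>) * u))"
            by (intro mult_left_mono) auto
          then have "ennreal ((psi_window \<theta> u)\<^sup>2) \<le> ennreal (exp (U + 8) * ((psi_window \<theta> u)\<^sup>2 * exp (- (1 + 2 * \<eta>) * u)))"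
            by (intro ennreal_leI) (simp add: mult_ac)
          also have "\<dots> = ennreal (exp (U + 8)) * ennreal ((psi_window \<theta> u)\<^sup>2 * exp (- (1 + 2 * \<eta>) * u))"
            by (rule ennreal_mult') simp
          finally show ?thesis using True by simp
        qed simp
      qed
      also have "\<dots> = ennreal (exp (U + 8)) * (\<integral>\<^sup>+u. ennreal ((psi_window \<theta> u)\<^sup>2 * exp (- (1 + 2 * \<eta>) * u)) * indicator {V..V+1} u \<partial>lborel)"
        by (rule nn_integral_cmult) measurable
      also have "\<dots> \<le> ennreal (exp (U + 8)) * ennreal R0"
        unfolding R0_def using \<theta> \<eta> \<delta> by (intro mult_left_mono K(2)) (auto simp: \<delta>_def)
      also have "\<dots> = ennreal R" unfolding R_def using R0 by (intro ennreal_mult[symmetric]) auto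
      finally show ?thesis .
    qed
    have avg: "(\<integral>\<^sup>+u. ennreal ((psi_window (log_window c u) u)\<^sup>2) * indicator {U..U+1} u \<partial>lborel) \<le> ennreal (12 * R)"
      using \<delta> by (intro psi_window_average[OF c a_def _ bound R]) (auto simp: \<delta>_def)
    let ?f = "\<lambda>x. ennreal ((psi_err (x + c * sqrt x) - psi_err x)\<^sup>2)"
    have "(\<integral>\<^sup>+x. ?f x * indicator {X..2 * X} x \<partial>lborel) \<le> (\<integral>\<^sup>+x. ?f x * indicator {exp U..exp (U + 1)} x \<partial>lborel)"
    proof (intro nn_integral_mono mult_left_mono)
      have "2 * X \<le> exp 1 * X" using X exp_ge_add_one_self[of "1::real"] by (intro mult_right_mono) auto
      then have "2 * X \<le> exp (U + 1)" using X by (simp add: exp_add mult.commute)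
      then show "indicator {X..2 * X} x \<le> (indicator {exp U..exp (U + 1)} x :: ennreal)" for x
        unfolding X(2) by (auto simp: indicator_def)
    qed auto
    also have "\<dots> = (\<integral>\<^sup>+u. ?f (exp u) * ennreal (exp u) * indicator {U..U+1} u \<partial>lborel)"
      by (rule nn_integral_substitution_aux) (auto intro!: continuous_intros DERIV_exp)
    also have "\<dots> \<le> (\<integral>\<^sup>+u. ennreal (exp (U + 1)) * (ennreal ((psi_window (log_window c u) u)\<^sup>2) * indicator {U..U+1} u) \<partial>lborel)"
    proof (intro nn_integral_mono)
      fix u
      have eq: "?f (exp u) = ennreal ((psi_window (log_window c u) u)\<^sup>2)"
        unfolding psi_window_def exp_log_window[OF c] ..
      show "?f (exp u) * ennreal (exp u) * indicator {U..U+1} u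
          \<le> ennreal (exp (U + 1)) * (ennreal ((psi_window (log_window c u) u)\<^sup>2) * indicator {U..U+1} u)"
      proof (cases "u \<in> {U..U+1}")
        case True
        have "P * ennreal (exp u) \<le> ennreal (exp (U + 1)) * P" for P
          using True by (subst mult.commute) (intro mult_right_mono ennreal_leI, auto)
        then show ?thesis using True by (simp add: eq)
      qed simp
    qed
    also have "\<dots> = ennreal (exp (U + 1)) * (\<integral>\<^sup>+u. ennreal ((psi_window (log_window c u) u)\<^sup>2) * indicator {U..U+1} u \<partial>lborel)"
      by (rule nn_integral_cmult) (unfold log_window_def psi_window_def, measurable)
    also have "\<dots> \<le> ennreal (exp (U + 1)) * ennreal (12 * R)" by (intro mult_left_mono avg) auto
    also have "\<dots> = ennreal (exp (U + 1) * (12 * R))" using R by (intro ennreal_mult[symmetric]) auto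
    also have "\<dots> \<le> ennreal (K2 * (X powr (3 / 2) * U ^ 4))"
    proof (rule ennreal_leI)
      have "R0 \<le> K * U\<^sup>2 * (\<delta> * (2 * U)\<^sup>2)"
      proof -
        have "0 \<le> ln (1 / \<delta>)" using \<delta> by (intro ln_ge_zero) simp
        then have "(1 + ln (1 / \<delta>))\<^sup>2 \<le> (2 * U)\<^sup>2" using l\<delta> by (intro power_mono) auto
        then have "K * U\<^sup>2 * (\<delta> * (1 + ln (1 / \<delta>))\<^sup>2) \<le> K * U\<^sup>2 * (\<delta> * (2 * U)\<^sup>2)"
          using K(1) \<delta> by (intro mult_left_mono) auto
        then show ?thesis by (simp add: R0_def \<eta>_def power_divide)
      qed
      also have "\<dots> = (8 * c * K) * (exp (- U / 2) * U ^ 4)"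
        by (simp add: \<delta>_def a_def power_mult_distrib power4_eq_xxxx power2_eq_square)
      finally have "exp (U + 1) * (12 * R) \<le> exp (U + 1) * (12 * (exp (U + 8) * ((8 * c * K) * (exp (- U / 2) * U ^ 4))))"
        unfolding R_def by (intro mult_left_mono) auto
      also have "\<dots> = 12 * (8 * c * K) * ((exp (U + 1) * exp (U + 8) * exp (- U / 2)) * U ^ 4)" by (simp only: mult_ac)
      also have "exp (U + 1) * exp (U + 8) * exp (- U / 2) = exp 9 * exp (3 / 2 * U)" by (simp flip: exp_add)
      also have "exp (3 / 2 * U) = X powr (3 / 2)" using X by (simp add: powr_def U_def)
      finally show "exp (U + 1) * (12 * R) \<le> K2 * (X powr (3 / 2) * U ^ 4)" by (simp add: K2_def mult_ac)
    qed
    finally show ?case unfolding U_def .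
  qed
  then show thesis by (rule that[OF K2])
qed

section \<open>From prime powers to primes\<close>

text \<open>
  The \<open>k\<close>-th powers of two numbers at distance \<open>j\<close> differ by at least \<open>j\<close> times the \<open>(k - 1)\<close>-st
  power of the larger one, which is at least \<open>sqrt x\<close> as \<open>k - 1 \<ge> k / 2\<close>.
\<close>
lemma card_powers_in_window:
  fixes x c :: real
  assumes x: "x \<ge> 1" and c: "c > 0" and k: "k \<ge> 2"
  shows "finite {m::nat. x < real m ^ k \<and> real m ^ k \<le> x + c * sqrt x}"
    and "real (card {m::nat. x < real m ^ k \<and> real m ^ k \<le> x + c * sqrt x}) \<le> c + 1"
proof -
  let ?S = "{m::nat. x < real m ^ k \<and> real m ^ k \<le> x + c * sqrt x}"
  have "?S \<subseteq> {..nat \<lfloor>x + c * sqrt x\<rfloor>}"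
  proof
    fix m assume m: "m \<in> ?S"
    have "m \<noteq> 0" using m x k by (intro notI) (simp add: power_0_left)
    then have "real m \<le> real m ^ k" using k by (intro self_le_power) auto
    also have "real m ^ k \<le> x + c * sqrt x" using m by simp
    finally have "real m \<le> x + c * sqrt x" .
    then show "m \<in> {..nat \<lfloor>x + c * sqrt x\<rfloor>}" by (simp add: le_nat_floor)
  qed
  then show fin: "finite ?S" by (rule finite_subset) simp
  show "real (card ?S) \<le> c + 1"
  proof (cases "?S = {}")
    case True
    show ?thesis unfolding True using c by simp
  next
    case False
    define m0 m1 where "m0 = Min ?S" and "m1 = Max ?S"
    have m0: "m0 \<in> ?S" and m1: "m1 \<in> ?S" unfolding m0_def m1_def using fin False by (auto intro: Min_in Max_in simp del: mem_Collect_eq)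
    have le: "m0 \<le> m1" unfolding m0_def using fin m1 by (intro Min_le)
    have sub: "?S \<subseteq> {m0..m1}" using fin by (auto simp: m0_def m1_def intro: Min_le Max_ge simp del: mem_Collect_eq)
    have m1_ge: "real m1 \<ge> 1"
    proof -
      have "m1 \<noteq> 0" using m1 x k by (intro notI) (simp add: power_0_left)
      then show ?thesis by simp
    qed
    obtain j where j: "k = Suc j" "j \<ge> 1" using k by (cases k) auto
    have root: "sqrt x \<le> real m1 ^ j"
    proof (rule real_le_lsqrt)
      have "x \<le> real m1 ^ k" using m1 by simp
      also have "\<dots> \<le> real m1 ^ (j * 2)" using m1_ge j by (intro power_increasing) auto
      also have "\<dots> = (real m1 ^ j)\<^sup>2" by (simp add: power_mult)
      finally show "x \<le> (real m1 ^ j)\<^sup>2" .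
    qed simp
    have "(real m1 - real m0) * sqrt x \<le> (real m1 - real m0) * real m1 ^ j"
      using root le by (intro mult_left_mono) auto
    also have "\<dots> = real m1 ^ k - real m0 * real m1 ^ j" by (simp add: j left_diff_distrib)
    also have "\<dots> \<le> real m1 ^ k - real m0 * real m0 ^ j"
      using le by (intro diff_left_mono mult_left_mono power_mono) auto
    also have "\<dots> = real m1 ^ k - real m0 ^ k" by (simp add: j)
    also have "\<dots> \<le> c * sqrt x" using m0 m1 by simp
    finally have "real m1 - real m0 \<le> c" using x by simp
    moreover have "card ?S \<le> card {m0..m1}" using sub by (intro card_mono) auto
    then have "card ?S \<le> Suc m1 - m0" by simp
    then have "real (card ?S) \<le> real m1 - real m0 + 1" using le by linarith
    ultimately show ?thesis by linarith
  qed
qed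

text \<open>
  There are at most \<open>2 * ln w\<close> exponents to consider, each with at most \<open>c + 1\<close> powers of weight
  at most \<open>ln w\<close>.
\<close>
lemma prime_power_contribution_le:
  fixes x c :: real
  assumes x: "x \<ge> 1" and c: "c > 0"
  defines "w \<equiv> x + c * sqrt x"
  shows "(\<Sum>n | x < real n \<and> real n \<le> w \<and> \<not> prime n. mangoldt n) \<le> 2 * (c + 1) * (ln w)\<^sup>2"
proof -
  have w: "w \<ge> x" using x c by (simp add: w_def)
  define K where "K = nat \<lfloor>2 * ln w\<rfloor>"
  define P where "P k = {m::nat. x < real m ^ k \<and> real m ^ k \<le> w}" for k
  define B where "B = {n::nat. x < real n \<and> real n \<le> w \<and> \<not> prime n \<and> primepow n}"
  let ?A = "{n::nat. x < real n \<and> real n \<le> w \<and> \<not> prime n}"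
  have lnw: "ln w \<ge> 0" using w x by simp
  have finA: "finite ?A"
    by (rule finite_subset[of _ "{..nat \<lfloor>w\<rfloor>}"]) (auto simp: le_nat_floor)
  have finP: "finite (P k)" and cardP: "real (card (P k)) \<le> c + 1" if "k \<ge> 2" for k
    using card_powers_in_window[OF x c that] by (auto simp: P_def w_def)
  have sub: "B \<subseteq> (\<Union>k\<in>{2..K}. (\<lambda>m. m ^ k) ` P k)"
  proof
    fix n assume n: "n \<in> B"
    then obtain p k where pk: "prime p" "k > 0" "n = p ^ k" by (auto simp: B_def primepow_def)
    have "k \<noteq> 1" using n pk by (auto simp: B_def)
    then have k2: "k \<ge> 2" using pk by simp
    have "real k * ln 2 \<le> ln w"
    proof -
      have "(2::real) ^ k \<le> real p ^ k" using prime_ge_2_nat[OF pk(1)] by (intro power_mono) auto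
      also have "\<dots> \<le> w" using n pk by (simp add: B_def)
      finally have "ln (2 ^ k) \<le> ln w" by (intro ln_mono) auto
      then show ?thesis by (simp add: ln_realpow)
    qed
    moreover have "real k * (1 / 2) \<le> real k * ln 2" using ln2_ge_two_thirds by (intro mult_left_mono) auto
    ultimately have "real k \<le> 2 * ln w" by simp
    then have "k \<le> K" by (simp add: K_def le_nat_floor)
    moreover have "p \<in> P k" using n pk by (simp add: P_def B_def)
    ultimately show "n \<in> (\<Union>k\<in>{2..K}. (\<lambda>m. m ^ k) ` P k)" using k2 pk by auto
  qed
  have "card B \<le> card (\<Union>k\<in>{2..K}. (\<lambda>m. m ^ k) ` P k)"
    using finP by (intro card_mono sub) auto
  also have "\<dots> \<le> (\<Sum>k\<in>{2..K}. card ((\<lambda>m. m ^ k) ` P k))" by (rule card_UN_le) simp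
  also have "\<dots> \<le> (\<Sum>k\<in>{2..K}. card (P k))" using finP by (intro sum_mono card_image_le) auto
  finally have "real (card B) \<le> (\<Sum>k\<in>{2..K}. real (card (P k)))" by (simp flip: of_nat_sum)
  also have "\<dots> \<le> (\<Sum>k\<in>{2..K}. c + 1)" by (intro sum_mono cardP) auto
  also have "\<dots> = real (card {2..K}) * (c + 1)" by simp
  also have "\<dots> \<le> (2 * ln w) * (c + 1)"
  proof (intro mult_right_mono)
    have "real (card {2..K}) \<le> real K" by simp
    also have "\<dots> \<le> 2 * ln w" using lnw by (simp add: K_def)
    finally show "real (card {2..K}) \<le> 2 * ln w" .
  qed (use c in simp)
  finally have cB: "real (card B) \<le> 2 * ln w * (c + 1)" .
  have "(\<Sum>n\<in>?A. mangoldt n) = (\<Sum>n\<in>B. mangoldt n :: real)"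
    using finA by (intro sum.mono_neutral_right) (auto simp: B_def mangoldt_def)
  also have "\<dots> \<le> real (card B) * ln w"
  proof (rule sum_bounded_above)
    fix n assume n: "n \<in> B"
    then have n0: "n > 0" using x by (cases n) (auto simp: B_def)
    then have "mangoldt n \<le> ln (real n)" by (rule mangoldt_le_ln)
    also have "\<dots> \<le> ln w" using n n0 by (intro ln_mono) (auto simp: B_def)
    finally show "mangoldt n \<le> ln w" .
  qed
  also have "\<dots> \<le> 2 * ln w * (c + 1) * ln w" using cB lnw by (intro mult_right_mono) auto
  finally show ?thesis by (simp add: power2_eq_square mult_ac)
qed

lemma cheb_psi_diff:
  assumes "x \<le> w"
  shows "cheb_psi w - cheb_psi x = (\<Sum>n | 0 < n \<and> x < real n \<and> real n \<le> w. mangoldt n)"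
proof -
  have "{n. 0 < n \<and> real n \<le> w} = {n. 0 < n \<and> real n \<le> x} \<union> {n. 0 < n \<and> x < real n \<and> real n \<le> w}"
    using assms by auto
  moreover have "finite {n. 0 < n \<and> x < real n \<and> real n \<le> w}"
    by (rule finite_subset[OF _ finite_nat_le_real[of w]]) auto
  ultimately show ?thesis unfolding cheb_psi_def
    using finite_nat_le_real[of x] by (simp add: sum.union_disjoint disjoint_iff)
qed

lemma card_nat_window:
  fixes x h :: real
  assumes x: "x \<ge> 0" and h: "h \<ge> 0"
  shows "finite {n::nat. x < real n \<and> real n \<le> x + h}"
    and "real (card {n::nat. x < real n \<and> real n \<le> x + h}) \<le> h + 1"
proof -
  let ?S = "{n::nat. x < real n \<and> real n \<le> x + h}"
  have sub: "?S \<subseteq> {nat \<lfloor>x\<rfloor><..nat \<lfloor>x + h\<rfloor>}"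
    using x h by (auto simp: le_nat_floor) linarith
  then show "finite ?S" by (rule finite_subset) simp
  have "nat \<lfloor>x\<rfloor> \<le> nat \<lfloor>x + h\<rfloor>" using h by (intro nat_mono floor_mono) simp
  moreover have "card ?S \<le> nat \<lfloor>x + h\<rfloor> - nat \<lfloor>x\<rfloor>" using card_mono[OF _ sub] by simp
  ultimately have "real (card ?S) \<le> real (nat \<lfloor>x + h\<rfloor>) - real (nat \<lfloor>x\<rfloor>)" by linarith
  also have "\<dots> \<le> h + 1" using x h by simp linarith
  finally show "real (card ?S) \<le> h + 1" .
qed

text \<open>
  As \<open>ln t\<close> varies by at most \<open>c / sqrt x\<close> over the layer, the number of primes weighted by their
  logarithms differs by \<open>O(1)\<close> from \<open>ln x\<close> times their number, and \<open>ln x * layer_mean c x\<close> by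
  \<open>O(1)\<close> from the length of the layer; the prime powers contribute \<open>O((ln x)\<^sup>2)\<close>.
\<close>
lemma layer_fluctuation_le:
  fixes c x :: real
  assumes c: "c > 0" and x: "x \<ge> 3"
  shows "\<bar>layer_fluctuation c x\<bar>
    \<le> \<bar>psi_err (x + c * sqrt x) - psi_err x\<bar> / ln x + (2 * c\<^sup>2 + c + 2 * (c + 1) ^ 3) * ln x"
proof -
  define h where "h = c * sqrt x"
  define w where "w = x + h"
  define l where "l = ln x"
  define \<Delta> where "\<Delta> = psi_err w - psi_err x"
  have l: "l \<ge> 1" unfolding l_def using ln_3_ge_1 x ln_mono[of 3 x] by linarith
  have "h > 0" using c x by (simp add: h_def)
  then have h: "h > 0" "w > x" "w > 0" using x by (auto simp: w_def)
  have h2: "h * h = c\<^sup>2 * x" using x by (simp add: h_def power2_eq_square)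
  have hx: "h / x \<le> c"
  proof -
    have "sqrt x \<le> x" using x by (intro real_le_lsqrt self_le_power) auto
    then have "h \<le> c * x" using c by (simp add: h_def)
    then show ?thesis using x by (simp add: divide_le_eq)
  qed
  have lw: "l \<le> ln w" "ln w \<le> l + h / x"
  proof -
    show "l \<le> ln w" unfolding l_def using h x by (intro ln_mono) auto
    have "1 + h / x = w / x" using x by (simp add: w_def add_divide_distrib)
    then have "ln w - ln x = ln (1 + h / x)" using h x by (simp add: ln_div)
    also have "\<dots> \<le> h / x" using h x by (intro ln_add_one_self_le_self) auto
    finally show "ln w \<le> l + h / x" by (simp add: l_def)
  qed
  let ?A = "{n::nat. x < real n \<and> real n \<le> w}"
  let ?P = "{p::nat. prime p \<and> x < real p \<and> real p \<le> w}"
  let ?Q = "{n::nat. x < real n \<and> real n \<le> w \<and> \<not> prime n}"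
  define N where "N = real (card ?P)"
  define T where "T = (\<Sum>p\<in>?P. ln (real p))"
  define PP where "PP = (\<Sum>n\<in>?Q. mangoldt n :: real)"
  have finA: "finite ?A" and cardA: "real (card ?A) \<le> h + 1"
    using card_nat_window[of x h] x h by (auto simp: w_def)
  have N_le: "N \<le> h + 1"
  proof -
    have "card ?P \<le> card ?A" using finA by (intro card_mono) auto
    then show ?thesis using cardA by (simp add: N_def)
  qed
  have psi: "\<Delta> = T + PP - h"
  proof -
    have "\<Delta> = cheb_psi w - cheb_psi x - h" using x h by (simp add: \<Delta>_def psi_err_def w_def)
    also have "cheb_psi w - cheb_psi x = (\<Sum>n | 0 < n \<and> x < real n \<and> real n \<le> w. mangoldt n)"
      using h by (intro cheb_psi_diff) simp
    also have "{n. 0 < n \<and> x < real n \<and> real n \<le> w} = ?P \<union> ?Q" using x by (auto intro: Nat.gr0I)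
    also have "(\<Sum>n\<in>?P \<union> ?Q. mangoldt n) = (\<Sum>n\<in>?P. mangoldt n) + PP"
      unfolding PP_def by (intro sum.union_disjoint) (auto intro: finite_subset[OF _ finA])
    also have "(\<Sum>n\<in>?P. mangoldt n) = T" unfolding T_def by (intro sum.cong refl) auto
    finally show ?thesis .
  qed
  have PP: "0 \<le> PP" "PP \<le> 2 * (c + 1) * (ln w)\<^sup>2"
    using prime_power_contribution_le[of x c] x c
    by (auto simp: PP_def w_def h_def intro!: sum_nonneg mangoldt_nonneg)
  have T1: "N * l \<le> T"
    unfolding N_def T_def l_def using x by (intro sum_bounded_below ln_mono) auto
  have T2: "T \<le> N * ln w"
    unfolding N_def T_def using x by (intro sum_bounded_above ln_mono) auto
  have T3: "T - N * l \<le> c\<^sup>2 + c"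
  proof -
    have "T - N * l \<le> N * (ln w - l)" using T2 by (simp add: algebra_simps)
    also have "\<dots> \<le> (h + 1) * (h / x)"
      using N_le lw h x by (intro mult_mono) (auto simp: N_def)
    also have "\<dots> = h * h / x + h / x" by (simp add: algebra_simps add_divide_distrib)
    also have "\<dots> = c\<^sup>2 + h / x" unfolding h2 using x by simp
    finally show ?thesis using hx by simp
  qed
  define M where "M = layer_mean c x"
  have int: "(\<lambda>t. 1 / ln t) integrable_on {x..w}" using x by (intro layer_mean_integrable) simp
  have M1: "M \<le> h / l"
  proof -
    have "integral {x..w} (\<lambda>t. 1 / ln t) \<le> integral {x..w} (\<lambda>t. 1 / l)"
    proof (intro integral_le int)
      fix t assume t: "t \<in> {x..w}"
      have "l \<le> ln t" unfolding l_def using t x by (intro ln_mono) auto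
      then show "1 / ln t \<le> 1 / l" using l by (intro divide_left_mono) auto
    qed (rule integrable_const_ivl)
    then show ?thesis using h by (simp add: M_def layer_mean_def w_def h_def)
  qed
  have M2: "h / ln w \<le> M"
  proof -
    have "integral {x..w} (\<lambda>t. 1 / ln w) \<le> integral {x..w} (\<lambda>t. 1 / ln t)"
    proof (intro integral_le int)
      fix t assume t: "t \<in> {x..w}"
      have "l \<le> ln t" unfolding l_def using t x by (intro ln_mono) auto
      moreover have "ln t \<le> ln w" using t x by (intro ln_mono) auto
      ultimately show "1 / ln w \<le> 1 / ln t" using l by (intro divide_left_mono) auto
    qed (rule integrable_const_ivl)
    then show ?thesis using h by (simp add: M_def layer_mean_def w_def h_def)
  qed
  have M3: "h - M * l \<le> c\<^sup>2" "M * l \<le> h"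
  proof -
    show "M * l \<le> h" using M1 l by (simp add: pos_le_divide_eq)
    have "h * l / ln w \<le> M * l" using mult_right_mono[OF M2, of l] l by simp
    then have "h - M * l \<le> h - h * l / ln w" by simp
    also have "\<dots> = h * ((ln w - l) / ln w)" using l lw by (simp add: field_simps)
    also have "\<dots> \<le> h * (h / x / 1)" using l lw h x by (intro mult_left_mono frac_le) auto
    also have "\<dots> = c\<^sup>2" using h2 x by simp
    finally show "h - M * l \<le> c\<^sup>2" .
  qed
  have lw2: "ln w \<le> (1 + c) * l"
  proof -
    have "c \<le> c * l" using c l by simp
    then show ?thesis using lw hx by (simp add: algebra_simps)
  qed
  have PP3: "PP \<le> 2 * (c + 1) ^ 3 * l\<^sup>2"
  proof -
    have "(ln w)\<^sup>2 \<le> ((1 + c) * l)\<^sup>2" using lw2 lw l by (intro power_mono) auto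
    then have "2 * (c + 1) * (ln w)\<^sup>2 \<le> 2 * (c + 1) * ((1 + c) * l)\<^sup>2" using c by (intro mult_left_mono) auto
    also have "\<dots> = 2 * (c + 1) ^ 3 * l\<^sup>2" by (simp add: power_mult_distrib power2_eq_square power3_eq_cube add.commute)
    finally show ?thesis using PP by simp
  qed
  have "\<bar>(N - M) * l\<bar> \<le> \<bar>\<Delta>\<bar> + (2 * c\<^sup>2 + c) + PP"
  proof -
    \<comment> \<open>Besides the error of \<open>cheb_psi\<close>: the prime powers, and the two errors from treating \<open>ln\<close> as constant on the layer.\<close>
    have "(N - M) * l = \<Delta> - PP - (T - N * l) + (h - M * l)" using psi by (simp add: algebra_simps)
    moreover have "0 \<le> T - N * l" "0 \<le> h - M * l" using T1 M3 by auto
    moreover have "0 \<le> c\<^sup>2" by simp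
    ultimately show ?thesis using T3 M3(1) PP(1) c by linarith
  qed
  also have "\<dots> \<le> \<bar>\<Delta>\<bar> + (2 * c\<^sup>2 + c + 2 * (c + 1) ^ 3) * l\<^sup>2"
  proof -
    have "(2 * c\<^sup>2 + c) * 1 \<le> (2 * c\<^sup>2 + c) * l\<^sup>2" using c l by (intro mult_left_mono) auto
    then show ?thesis using PP3 by (simp add: algebra_simps)
  qed
  finally have "\<bar>N - M\<bar> * l \<le> \<bar>\<Delta>\<bar> + (2 * c\<^sup>2 + c + 2 * (c + 1) ^ 3) * l\<^sup>2" using l by (simp add: abs_mult)
  then have "\<bar>N - M\<bar> \<le> (\<bar>\<Delta>\<bar> + (2 * c\<^sup>2 + c + 2 * (c + 1) ^ 3) * l\<^sup>2) / l" using l by (simp add: pos_le_divide_eq)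
  also have "\<dots> = \<bar>\<Delta>\<bar> / l + (2 * c\<^sup>2 + c + 2 * (c + 1) ^ 3) * l"
    using l by (simp add: add_divide_distrib power2_eq_square)
  finally show ?thesis
    unfolding layer_fluctuation_def N_def M_def l_def \<Delta>_def layer_count_def w_def h_def .
qed

section \<open>The layer variance\<close>

text \<open>
  The second term of \<open>layer_fluctuation_le\<close> contributes \<open>O((ln X)\<^sup>2)\<close> to the mean square, which is
  smaller than the bound by the factor \<open>sqrt X\<close>.
\<close>
lemma layer_mean_square_le:
  assumes RH: "riemann_hypothesis" and c: "c > 0"
  obtains K where "K > 0"
    "\<forall>\<^sub>F X in at_top. mean_square (layer_fluctuation c) X \<le> K * (sqrt X * (ln X)\<^sup>2)"
proof -
  obtain K where K: "K > 0"
    "\<forall>\<^sub>F X in at_top. (\<integral>\<^sup>+x. ennreal ((psi_err (x + c * sqrt x) - psi_err x)\<^sup>2) * indicator {X..2 * X} x \<partial>lborel)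
       \<le> ennreal (K * (X powr (3 / 2) * (ln X) ^ 4))"
    by (rule psi_err_window_mean_square[OF RH c], rule that; simp)
  define C where "C = 2 * c\<^sup>2 + c + 2 * (c + 1) ^ 3"
  have C: "C \<ge> 0" using c by (simp add: C_def)
  define L where "L = 2 * K + 8 * C\<^sup>2"
  have L: "L > 0" using K(1) by (simp add: L_def add_pos_nonneg)
  have "\<forall>\<^sub>F X in at_top. mean_square (layer_fluctuation c) X \<le> L * (sqrt X * (ln X)\<^sup>2)"
    using K(2) eventually_ge_at_top[of 3]
  proof eventually_elim
    case (elim X)
    then have X: "X \<ge> 3" by simp
    define l where "l = ln X"
    have l: "l \<ge> 1" unfolding l_def using ln_3_ge_1 X ln_mono[of 3 X] by linarith
    have mult_l: "ennreal (2 / l\<^sup>2 * y) = ennreal (2 / l\<^sup>2) * ennreal y" for y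
      by (rule ennreal_mult') simp
    let ?f = "layer_fluctuation c"
    let ?D = "\<lambda>x. psi_err (x + c * sqrt x) - psi_err x"
    define I where "I = integral {X..2 * X} (\<lambda>x. (?f x)\<^sup>2)"
    have "((\<lambda>x. (?f x)\<^sup>2) has_integral I) {X..2 * X}"
      unfolding I_def using layer_fluctuation_square_integrable[OF c, of X] X by (intro integrable_integral) auto
    from nn_integral_has_integral_lebesgue[OF _ this]
    have "ennreal I = (\<integral>\<^sup>+x. ennreal (indicator {X..2 * X} x * (?f x)\<^sup>2) \<partial>lborel)" by simp
    also have "\<dots> \<le> (\<integral>\<^sup>+x. ennreal (2 / l\<^sup>2) * (ennreal ((?D x)\<^sup>2) * indicator {X..2 * X} x)
         + ennreal (8 * C\<^sup>2 * l\<^sup>2) * indicator {X..2 * X} x \<partial>lborel)"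
    proof (intro nn_integral_mono)
      fix x
      show "ennreal (indicator {X..2 * X} x * (?f x)\<^sup>2)
        \<le> ennreal (2 / l\<^sup>2) * (ennreal ((?D x)\<^sup>2) * indicator {X..2 * X} x) + ennreal (8 * C\<^sup>2 * l\<^sup>2) * indicator {X..2 * X} x"
      proof (cases "x \<in> {X..2 * X}")
        case True
        then have x: "X \<le> x" "x \<le> 2 * X" by auto
        have lx: "l \<le> ln x" unfolding l_def using x X by (intro ln_mono) auto
        have lx2: "ln x \<le> 2 * l"
        proof -
          have "2 * X \<le> X * X" using X by (intro mult_right_mono) auto
          then have "x \<le> X * X" using x by linarith
          then have "ln x \<le> ln (X * X)" using x X by (intro ln_mono) auto
          then show ?thesis using X by (simp add: l_def ln_mult)
        qed
        have "\<bar>?f x\<bar> \<le> \<bar>?D x\<bar> / ln x + C * ln x"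
          unfolding C_def using x X by (intro layer_fluctuation_le[OF c]) auto
        also have "\<dots> \<le> \<bar>?D x\<bar> / l + C * (2 * l)"
          using lx lx2 l C by (intro add_mono divide_left_mono mult_left_mono) auto
        finally have "\<bar>?f x\<bar>\<^sup>2 \<le> (\<bar>?D x\<bar> / l + C * (2 * l))\<^sup>2" by (intro power_mono) auto
        also have "\<dots> \<le> 2 * (\<bar>?D x\<bar> / l)\<^sup>2 + 2 * (C * (2 * l))\<^sup>2"
        proof -
          have "(p + q)\<^sup>2 \<le> 2 * p\<^sup>2 + 2 * q\<^sup>2" for p q :: real
            using zero_le_power2[of "p - q"] by (simp add: power2_eq_square algebra_simps)
          then show ?thesis .
        qed
        also have "\<dots> = 2 / l\<^sup>2 * (?D x)\<^sup>2 + 8 * C\<^sup>2 * l\<^sup>2" by (simp add: power_divide power_mult_distrib)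
        finally have "(?f x)\<^sup>2 \<le> 2 / l\<^sup>2 * (?D x)\<^sup>2 + 8 * C\<^sup>2 * l\<^sup>2" by simp
        then have "ennreal ((?f x)\<^sup>2) \<le> ennreal (2 / l\<^sup>2 * (?D x)\<^sup>2 + 8 * C\<^sup>2 * l\<^sup>2)" by (rule ennreal_leI)
        also have "\<dots> = ennreal (2 / l\<^sup>2) * ennreal ((?D x)\<^sup>2) + ennreal (8 * C\<^sup>2 * l\<^sup>2)"
          unfolding mult_l[symmetric] by (rule ennreal_plus) auto
        finally show ?thesis using True by simp
      qed simp
    qed
    also have "\<dots> = (\<integral>\<^sup>+x. ennreal (2 / l\<^sup>2) * (ennreal ((?D x)\<^sup>2) * indicator {X..2 * X} x) \<partial>lborel)
         + (\<integral>\<^sup>+x. ennreal (8 * C\<^sup>2 * l\<^sup>2) * indicator {X..2 * X} x \<partial>lborel)"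
      by (rule nn_integral_add) measurable
    also have "\<dots> = ennreal (2 / l\<^sup>2) * (\<integral>\<^sup>+x. ennreal ((?D x)\<^sup>2) * indicator {X..2 * X} x \<partial>lborel)
         + ennreal (8 * C\<^sup>2 * l\<^sup>2) * emeasure lborel {X..2 * X}"
      by (subst nn_integral_cmult, measurable) (subst nn_integral_cmult_indicator, auto)
    also have "\<dots> \<le> ennreal (2 / l\<^sup>2) * ennreal (K * (X powr (3 / 2) * l ^ 4)) + ennreal (8 * C\<^sup>2 * l\<^sup>2) * ennreal X"
      using elim X by (intro add_mono mult_left_mono) (auto simp: l_def)
    also have "\<dots> = ennreal (2 / l\<^sup>2 * (K * (X powr (3 / 2) * l ^ 4)) + 8 * C\<^sup>2 * l\<^sup>2 * X)"
    proof -
      have "ennreal (8 * C\<^sup>2 * l\<^sup>2) * ennreal X = ennreal (8 * C\<^sup>2 * l\<^sup>2 * X)"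
        by (rule ennreal_mult'[symmetric]) simp
      then show ?thesis unfolding mult_l[symmetric] using K(1) X by (simp only:) (intro ennreal_plus[symmetric], auto)
    qed
    also have "2 / l\<^sup>2 * (K * (X powr (3 / 2) * l ^ 4)) = 2 * K * (X powr (3 / 2) * l\<^sup>2)"
      using l by (simp add: power2_eq_square power4_eq_xxxx)
    finally have "I \<le> 2 * K * (X powr (3 / 2) * l\<^sup>2) + 8 * C\<^sup>2 * l\<^sup>2 * X"
      by (subst (asm) ennreal_le_iff) (use K(1) X in \<open>auto intro!: add_nonneg_nonneg mult_nonneg_nonneg\<close>)
    also have "8 * C\<^sup>2 * l\<^sup>2 * X \<le> 8 * C\<^sup>2 * l\<^sup>2 * X powr (3 / 2)"
    proof (intro mult_left_mono)
      have "X powr 1 \<le> X powr (3 / 2)" using X by (intro powr_mono) auto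
      then show "X \<le> X powr (3 / 2)" using X by simp
    qed auto
    finally have "I \<le> L * (X powr (3 / 2) * l\<^sup>2)" by (simp add: L_def algebra_simps)
    also have "X powr (3 / 2) = X * sqrt X"
      using X powr_add[of X 1 "1 / 2"] by (simp add: powr_half_sqrt)
    finally have "I \<le> X * (L * (sqrt X * l\<^sup>2))" by (simp add: mult_ac)
    then have "1 / X * I \<le> L * (sqrt X * l\<^sup>2)" using X by (simp add: divide_le_eq mult.commute)
    then show ?case unfolding mean_square_def I_def l_def .
  qed
  then show thesis by (rule that[OF L])
qed

lemma RMS_nonneg_le:
  assumes "mean_square f X \<le> K * (sqrt X * (ln X)\<^sup>2)" "X \<ge> 1" "K \<ge> 0"
  shows "RMS f X \<le> sqrt K * (X powr (1 / 4) * ln X)"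
proof -
  have "RMS f X \<le> sqrt (K * (sqrt X * (ln X)\<^sup>2))" unfolding RMS_def using assms(1) by (rule real_sqrt_le_mono)
  also have "\<dots> = sqrt K * (sqrt (sqrt X) * ln X)" using assms by (simp add: real_sqrt_mult)
  also have "sqrt (sqrt X) = X powr (1 / 4)"
    using assms by (simp add: powr_half_sqrt[symmetric] powr_powr)
  finally show ?thesis .
qed

theorem theorem6p7:
  fixes c :: real
  assumes "riemann_hypothesis" and "c > 0"
  shows "mean_square (layer_fluctuation c) \<in> O[at_top](\<lambda>X. sqrt X * (ln X)\<^sup>2)
       \<and> RMS (layer_fluctuation c) \<in> O[at_top](\<lambda>X. X powr (1 / 4) * ln X)
       \<and> zeta_footprint c \<in> O[at_top](\<lambda>X. X powr (- 1 / 4) * (ln X)\<^sup>2)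
       \<and> (\<forall>a b. 0 < a \<and> a \<le> b \<longrightarrow>
            (\<exists>C. \<forall>\<^sub>F X in at_top. \<forall>p::nat. prime p \<and> a * X \<le> real p \<and> real p \<le> b * X \<longrightarrow>
               zeta_footprint c X \<le> C * (real p powr (- 1 / 4) * (ln (real p))\<^sup>2)))"
proof -
  obtain K where K: "K > 0"
    "\<forall>\<^sub>F X in at_top. mean_square (layer_fluctuation c) X \<le> K * (sqrt X * (ln X)\<^sup>2)"
    by (rule layer_mean_square_le[OF assms], rule that; simp)
  have ms0: "mean_square (layer_fluctuation c) X \<ge> 0" if "X \<ge> 2" for X
  proof -
    have "integral {X..2 * X} (\<lambda>x. (layer_fluctuation c x)\<^sup>2) \<ge> 0"
      using layer_fluctuation_square_integrable[OF assms(2) that]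
      by (intro Henstock_Kurzweil_Integration.integral_nonneg) auto
    then show ?thesis using that by (simp add: mean_square_def)
  qed
  have rms: "\<forall>\<^sub>F X in at_top. RMS (layer_fluctuation c) X \<le> sqrt K * (X powr (1 / 4) * ln X)"
    using K(2) eventually_ge_at_top[of 1]
    by eventually_elim (use K(1) in \<open>auto intro!: RMS_nonneg_le\<close>)
  have fp: "\<forall>\<^sub>F X in at_top. zeta_footprint c X \<le> sqrt K * (X powr (- 1 / 4) * (ln X)\<^sup>2)"
    using rms eventually_ge_at_top[of 3]
  proof eventually_elim
    case (elim X)
    then have X: "X \<ge> 3" "ln X > 0" by auto
    have "zeta_footprint c X = RMS (layer_fluctuation c) X * (ln X / sqrt X)"
      by (simp add: zeta_footprint_def)
    also have "\<dots> \<le> sqrt K * (X powr (1 / 4) * ln X) * (ln X / sqrt X)"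
      using elim X by (intro mult_right_mono) auto
    also have "\<dots> = sqrt K * (X powr (1 / 4) / X powr (1 / 2) * (ln X)\<^sup>2)"
      using X by (simp add: powr_half_sqrt power2_eq_square)
    also have "X powr (1 / 4) / X powr (1 / 2) = X powr (- 1 / 4)" by (simp flip: powr_diff)
    finally show ?case .
  qed
  have 1: "mean_square (layer_fluctuation c) \<in> O[at_top](\<lambda>X. sqrt X * (ln X)\<^sup>2)"
  proof (rule bigoI)
    show "\<forall>\<^sub>F X in at_top. norm (mean_square (layer_fluctuation c) X) \<le> K * norm (sqrt X * (ln X)\<^sup>2)"
      using K(2) eventually_ge_at_top[of 2] by eventually_elim (use ms0 in auto)
  qed
  have 2: "RMS (layer_fluctuation c) \<in> O[at_top](\<lambda>X. X powr (1 / 4) * ln X)"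
  proof (rule bigoI)
    show "\<forall>\<^sub>F X in at_top. norm (RMS (layer_fluctuation c) X) \<le> sqrt K * norm (X powr (1 / 4) * ln X)"
      using rms eventually_ge_at_top[of 2] by eventually_elim (use ms0 in \<open>auto simp: RMS_def\<close>)
  qed
  have 3: "zeta_footprint c \<in> O[at_top](\<lambda>X. X powr (- 1 / 4) * (ln X)\<^sup>2)"
  proof (rule bigoI)
    show "\<forall>\<^sub>F X in at_top. norm (zeta_footprint c X) \<le> sqrt K * norm (X powr (- 1 / 4) * (ln X)\<^sup>2)"
      using fp eventually_ge_at_top[of 2] by eventually_elim (use ms0 in \<open>auto simp: RMS_def zeta_footprint_def\<close>)
  qed
  have 4: "\<exists>C. \<forall>\<^sub>F X in at_top. \<forall>p::nat. prime p \<and> a * X \<le> real p \<and> real p \<le> b * X \<longrightarrow>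
               zeta_footprint c X \<le> C * (real p powr (- 1 / 4) * (ln (real p))\<^sup>2)" if ab: "0 < a" "a \<le> b" for a b
  proof -
    have b: "b > 0" using ab by simp
    define C where "C = sqrt K * (4 * b powr (1 / 4))"
    have ev: "\<forall>\<^sub>F X in at_top. ln X \<le> 2 * ln (a * X)" using ab by real_asymp
    have ev': "\<forall>\<^sub>F X in at_top. a * X \<ge> 1" using ab by real_asymp
    have "\<forall>\<^sub>F X in at_top. \<forall>p::nat. prime p \<and> a * X \<le> real p \<and> real p \<le> b * X \<longrightarrow>
               zeta_footprint c X \<le> C * (real p powr (- 1 / 4) * (ln (real p))\<^sup>2)"
      using fp ev ev' eventually_ge_at_top[of 3]
    proof eventually_elim
      case (elim X)
      show ?case
      proof (intro allI impI)
        fix p :: nat assume p: "prime p \<and> a * X \<le> real p \<and> real p \<le> b * X"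
        have p0: "real p > 0" using p elim by linarith
        have lX: "0 \<le> ln X" "ln X \<le> 2 * ln (real p)"
        proof -
          show "0 \<le> ln X" using elim by simp
          have "ln (a * X) \<le> ln (real p)" using p elim by (intro ln_mono) auto
          then show "ln X \<le> 2 * ln (real p)" using elim by linarith
        qed
        have "real p / b \<le> X" using p b by (simp add: divide_le_eq mult.commute)
        then have "X powr (- 1 / 4) \<le> (real p / b) powr (- 1 / 4)"
          using p0 b by (intro powr_mono2') auto
        also have "\<dots> = real p powr (- 1 / 4) * b powr (1 / 4)"
          using p0 b by (simp add: powr_divide powr_minus_divide)
        finally have "X powr (- 1 / 4) * (ln X)\<^sup>2 \<le> (real p powr (- 1 / 4) * b powr (1 / 4)) * (2 * ln (real p))\<^sup>2"
          using lX by (intro mult_mono power_mono) auto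
        then have "sqrt K * (X powr (- 1 / 4) * (ln X)\<^sup>2)
            \<le> sqrt K * ((real p powr (- 1 / 4) * b powr (1 / 4)) * (2 * ln (real p))\<^sup>2)"
          using K(1) by (intro mult_left_mono) auto
        also have "\<dots> = C * (real p powr (- 1 / 4) * (ln (real p))\<^sup>2)"
          by (simp add: C_def power_mult_distrib)
        finally show "zeta_footprint c X \<le> C * (real p powr (- 1 / 4) * (ln (real p))\<^sup>2)"
          using elim by linarith
      qed
    qed
    then show ?thesis by blast
  qed
  show ?thesis using 1 2 3 4 by blast
qed

end
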